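(* Let $1\le p\le\infty$, $\frac1p+\frac1{p'}=1$, $s=(s_1,s_2,\dots)$ with $s_j\ge0$, and $X=\ell^p(\mathbb Z_+(\infty),w_\alpha(s))$ with $$w_\alpha(s)=\prod_{j=1}^\infty(1+\alpha_j)^{s_j},\qquad\alpha\in\mathbb Z_+(\infty).$$ (1) $X$ is an ISL, and the elementary dilation $D_{e_j}$ has norm $\|D_{e_j}\|\le2^{s_j}$ for every $j\ge 1$. The finite-dimensional sections $\mathbb D^N_{X'}$ of $\mathbb D^\infty_{X'}$ are polydiscs: each is a product of $N$ discs equal to $\mathbb D$ or $\overline{\mathbb D}$; it is $\mathbb D^N$ if $p>1$ and $s_j\le1/p'$ for all $j\le N$, and it is $\overline{\mathbb D}^N$ if $p>1$ and $s_j>1/p'$ for all $j\le N$, or if $p=1$. (2) If an affine linear function $f(\zeta)=a+\sum_{k\ge1}a_k\zeta_k$ is nonvanishing on $\mathbb D^N_{X'}$ for every $N=1,2,\dots$, then $|a|\ge\sum_{k\ge1}|a_k|$. (3) Assume $|s|:=\sum_{j\ge1}s_j<\infty$ and let $f\in X_A\cap\ell^1(\mathbb Z_+(\infty))_A$ be factorable in the sense that $f=\prod_{j\ge1}f_j$, where the $f_j$ are affine linear functions and $$0<\prod_{j\ge1}\|f_j\|_{\ell^1}<\infty.$$ If $|s|\le1/p'$ and $f(\zeta)\ne0$ for all $\zeta\in\mathbb D^\infty_{X'}$, then $f$ is $\sigma(X,X')$-cyclic in $X_A$ ($\sigma(\ell^1,c_0)$-cyclic if $p=1$).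
   Context: $\mathbb D=\{z\in\mathbb C:|z|<1\}$. $\mathbb Z_+(\infty)$ is the set of finitely supported sequences of nonnegative integers; $e_j\in\mathbb Z_+(\infty)$ has $1$ in position $j$ and $0$ elsewhere. $\ell^p(\mathbb Z_+(\infty),w_\alpha)=\{x=(x_\alpha):(x_\alpha w_\alpha)\in\ell^p(\mathbb Z_+(\infty))\}$ with norm $\|(x_\alpha w_\alpha)\|_{\ell^p}$. For $\beta\in\mathbb Z_+(\infty)$ the dilation (shift) is $D_\beta\big(\sum_\alpha x_\alpha\delta_\alpha\big)=\sum_\alpha x_\alpha\delta_{\alpha+\beta}$. An ISL (on $\mathbb Z_+(\infty)$) is a Banach space $X$ of families $(x_\alpha)$ such that (i) $x\in X$ and $|y_\alpha|\le|x_\alpha|\ \forall\alpha$ imply $y\in X$, $\|y\|\le\|x\|$; (ii) every $D_\beta$ maps $X$ into $X$; (iii) the unit vector $\delta_0$ is in $X$. $X'=\{y:\sum_\alpha|x_\alpha y_\alpha|<\infty\ \forall x\in X\}$ with pairing $\sum_\alpha x_\alpha y_\alpha$; $\sigma(X,X')$ is the corresponding weak topology on $X$. When $p=1$ and $|s|\le 1/p'=0$ one has $X=\ell^1(\mathbb Z_+(\infty))$, and $\sigma(\ell^1,c_0)$ is its weak-* topology as the dual of $c_0(\mathbb Z_+(\infty))$. $\mathbb D^\infty_{X'}=\{\lambda=(\lambda_j)_{j\ge1}\in\mathbb C^\infty:(\lambda^\alpha)_{\alpha\in\mathbb Z_+(\infty)}\in X'\}$, where $\lambda^\alpha=\prod_j\lambda_j^{\alpha_j}$,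 and $\mathbb D^N_{X'}=\mathbb D^\infty_{X'}\cap\mathbb C^N$, where $\mathbb C^N$ is identified with the sequences $\lambda$ such that $\lambda_j=0$ for $j>N$. $X_A$ is the space of power series $f=\sum_\alpha x_\alpha\zeta^\alpha$, $x\in X$ (absolutely convergent on $\mathbb D^\infty_{X'}$), with the norm and topologies of $X$; $\ell^1(\mathbb Z_+(\infty))_A$ is the analogous space for $\ell^1(\mathbb Z_+(\infty))$, and $\|f\|_{\ell^1}$ is the sum of the moduli of the coefficients of $f$. Affine linear functions are of the form $a+\sum_{k\ge1}a_k\zeta_k$. An element $f\in X_A$ is cyclic for a topology if $\{qf:q\text{ a polynomial in finitely many of the }\zeta_j\}$ is dense in $X_A$ for it. *)

theory Defs
  imports "HOL-Analysis.Analysis" "HOL-Library.Poly_Mapping"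
begin

text \<open>
  Multiindices, i.e. finitely supported sequences of nonnegative integers.  Positions (and
  variables) are numbered from 0: position \<open>j\<close> here is position \<open>j + 1\<close> in the usual numbering
  \<open>1, 2, \<dots>\<close>, so ``\<open>j \<le> N\<close>'' becomes \<open>j < N\<close>.  The order that \<^theory>\<open>HOL-Library.Poly_Mapping\<close>
  puts on this type is lexicographic and is not used; sums and differences are pointwise.
\<close>

type_synonym multiindex = "nat \<Rightarrow>\<^sub>0 nat"

type_synonym family = "multiindex \<Rightarrow> complex"

abbreviation unit_index :: "nat \<Rightarrow> multiindex"
  where "unit_index j \<equiv> Poly_Mapping.single j 1"

definition delta :: "multiindex \<Rightarrow> family"
  where "delta \<beta> = (\<lambda>\<alpha>. if \<alpha> = \<beta> then 1 else 0)"

text \<open>The product \<open>\<Prod>\<^sub>j z\<^sub>j ^ \<alpha>\<^sub>j\<close>; the factors outside the support of \<open>\<alpha>\<close> are 1.\<close>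

definition monomial :: "(nat \<Rightarrow> complex) \<Rightarrow> multiindex \<Rightarrow> complex"
  where "monomial z \<alpha> = (\<Prod>j\<in>Poly_Mapping.keys \<alpha>. z j ^ Poly_Mapping.lookup \<alpha> j)"


subsection \<open>Sequence spaces\<close>

definition lp_space :: "ennreal \<Rightarrow> ('i \<Rightarrow> complex) set"
  where "lp_space p =
    {x. if p = \<infinity> then bdd_above (range (\<lambda>i. cmod (x i)))
        else (\<lambda>i. cmod (x i) powr enn2real p) summable_on UNIV}"

definition lp_norm :: "ennreal \<Rightarrow> ('i \<Rightarrow> complex) \<Rightarrow> real"
  where "lp_norm p x =
    (if p = \<infinity> then (SUP i. cmod (x i))
     else (\<Sum>\<^sub>\<infinity>i. cmod (x i) powr enn2real p) powr (1 / enn2real p))"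

definition c0_space :: "('i \<Rightarrow> complex) set"
  where "c0_space = {y. (y \<longlongrightarrow> 0) cofinite}"

definition weighted_lp_space :: "ennreal \<Rightarrow> ('i \<Rightarrow> real) \<Rightarrow> ('i \<Rightarrow> complex) set"
  where "weighted_lp_space p w = {x. (\<lambda>i. x i * complex_of_real (w i)) \<in> lp_space p}"

definition weighted_lp_norm :: "ennreal \<Rightarrow> ('i \<Rightarrow> real) \<Rightarrow> ('i \<Rightarrow> complex) \<Rightarrow> real"
  where "weighted_lp_norm p w x = lp_norm p (\<lambda>i. x i * complex_of_real (w i))"

text \<open>The weight \<open>\<Prod>\<^sub>j (1 + \<alpha>\<^sub>j) powr s\<^sub>j\<close>; the factors outside the support of \<open>\<alpha>\<close> are 1.\<close>

definition weight :: "(nat \<Rightarrow> real) \<Rightarrow> multiindex \<Rightarrow> real"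
  where "weight s \<alpha> =
    (\<Prod>j\<in>Poly_Mapping.keys \<alpha>. (1 + real (Poly_Mapping.lookup \<alpha> j)) powr s j)"

abbreviation X_space :: "ennreal \<Rightarrow> (nat \<Rightarrow> real) \<Rightarrow> family set"
  where "X_space p s \<equiv> weighted_lp_space p (weight s)"

abbreviation X_norm :: "ennreal \<Rightarrow> (nat \<Rightarrow> real) \<Rightarrow> family \<Rightarrow> real"
  where "X_norm p s \<equiv> weighted_lp_norm p (weight s)"


subsection \<open>Dilations and ideal spaces\<close>

text \<open>
  \<open>dilation \<beta>\<close> sends \<open>\<Sum>\<^sub>\<alpha> x\<^sub>\<alpha> \<delta>\<^sub>\<alpha>\<close> to \<open>\<Sum>\<^sub>\<alpha> x\<^sub>\<alpha> \<delta>\<^bsub>\<alpha>+\<beta>\<^esub>\<close>: the coefficient at \<open>\<gamma>\<close> is nonzero only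
  if \<open>\<gamma> = \<alpha> + \<beta>\<close> for some (then unique) \<open>\<alpha>\<close>.
\<close>

definition dilation :: "multiindex \<Rightarrow> family \<Rightarrow> family"
  where "dilation \<beta> x = (\<lambda>\<gamma>. if \<exists>\<alpha>. \<gamma> = \<alpha> + \<beta> then x (\<gamma> - \<beta>) else 0)"

definition banach_space_on :: "('i \<Rightarrow> complex) set \<Rightarrow> (('i \<Rightarrow> complex) \<Rightarrow> real) \<Rightarrow> bool"
  where "banach_space_on X nrm \<longleftrightarrow>
    (\<lambda>i. 0) \<in> X \<and>
    (\<forall>x\<in>X. \<forall>y\<in>X. (\<lambda>i. x i + y i) \<in> X \<and> nrm (\<lambda>i. x i + y i) \<le> nrm x + nrm y) \<and>
    (\<forall>x\<in>X. \<forall>c. (\<lambda>i. c * x i) \<in> X \<and> nrm (\<lambda>i. c * x i) = cmod c * nrm x) \<and>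
    (\<forall>x\<in>X. nrm x \<ge> 0 \<and> (nrm x = 0 \<longleftrightarrow> x = (\<lambda>i. 0))) \<and>
    (\<forall>u :: nat \<Rightarrow> 'i \<Rightarrow> complex.
       (\<forall>n. u n \<in> X) \<and>
       (\<forall>\<epsilon>>0. \<exists>M. \<forall>m\<ge>M. \<forall>n\<ge>M. nrm (\<lambda>i. u m i - u n i) < \<epsilon>) \<longrightarrow>
       (\<exists>x\<in>X. (\<lambda>n. nrm (\<lambda>i. u n i - x i)) \<longlonglongrightarrow> 0))"

definition ISL :: "family set \<Rightarrow> (family \<Rightarrow> real) \<Rightarrow> bool"
  where "ISL X nrm \<longleftrightarrow>
    banach_space_on X nrm \<and>
    (\<forall>x\<in>X. \<forall>y. (\<forall>\<alpha>. cmod (y \<alpha>) \<le> cmod (x \<alpha>)) \<longrightarrow> y \<in> X \<and> nrm y \<le> nrm x) \<and>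
    (\<forall>\<beta>. \<forall>x\<in>X. dilation \<beta> x \<in> X) \<and>
    delta 0 \<in> X"

text \<open>The operator norm is taken in \<^typ>\<open>ennreal\<close>, so that it is infinite for unbounded operators.\<close>

definition operator_norm_on ::
  "family set \<Rightarrow> (family \<Rightarrow> real) \<Rightarrow> (family \<Rightarrow> family) \<Rightarrow> ennreal"
  where "operator_norm_on X nrm T = (SUP x\<in>{x\<in>X. nrm x \<le> 1}. ennreal (nrm (T x)))"


subsection \<open>Duality and point evaluations\<close>

definition kothe_dual :: "('i \<Rightarrow> complex) set \<Rightarrow> ('i \<Rightarrow> complex) set"
  where "kothe_dual X = {y. \<forall>x\<in>X. (\<lambda>i. cmod (x i * y i)) summable_on UNIV}"

definition pairing :: "('i \<Rightarrow> complex) \<Rightarrow> ('i \<Rightarrow> complex) \<Rightarrow> complex"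
  where "pairing x y = (\<Sum>\<^sub>\<infinity>i. x i * y i)"

text \<open>\<open>weak_topology X Y\<close> is \<open>\<sigma>(X, Y)\<close>; the pairing has to converge on \<open>X \<times> Y\<close>.\<close>

definition weak_topology ::
  "('i \<Rightarrow> complex) set \<Rightarrow> ('i \<Rightarrow> complex) set \<Rightarrow> ('i \<Rightarrow> complex) topology"
  where "weak_topology X Y =
    topology_generated_by {{x\<in>X. pairing x y \<in> U} | y U. y \<in> Y \<and> open U}"

definition D_infty :: "family set \<Rightarrow> (nat \<Rightarrow> complex) set"
  where "D_infty Y = {z. monomial z \<in> Y}"

definition D_section :: "family set \<Rightarrow> nat \<Rightarrow> (nat \<Rightarrow> complex) set"
  where "D_section Y N = D_infty Y \<inter> {z. \<forall>j\<ge>N. z j = 0}"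

definition product_of_discs :: "nat \<Rightarrow> (nat \<Rightarrow> complex set) \<Rightarrow> (nat \<Rightarrow> complex) set"
  where "product_of_discs N E = {z. (\<forall>j<N. z j \<in> E j) \<and> (\<forall>j\<ge>N. z j = 0)}"


subsection \<open>Power series\<close>

text \<open>
  A power series \<open>\<Sum>\<^sub>\<alpha> x\<^sub>\<alpha> \<zeta>^\<alpha>\<close> is represented by its coefficient family \<open>x\<close>, so that \<open>X\<^sub>A\<close> is
  \<open>X\<close> itself, with its norm and topologies; \<open>evaluate x \<zeta>\<close> is the value at \<open>\<zeta>\<close>.
\<close>

definition evaluate :: "family \<Rightarrow> (nat \<Rightarrow> complex) \<Rightarrow> complex"
  where "evaluate x \<zeta> = (\<Sum>\<^sub>\<infinity>\<alpha>. x \<alpha> * monomial \<zeta> \<alpha>)"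

text \<open>
  The power series of \<open>a + \<Sum>\<^sub>k c\<^sub>k \<zeta>\<^sub>k\<close>; for each \<open>\<alpha>\<close> the sum over \<open>k\<close> has at most one
  nonzero term.
\<close>

definition affine_series :: "complex \<Rightarrow> (nat \<Rightarrow> complex) \<Rightarrow> family"
  where "affine_series a c = (\<lambda>\<alpha>. a * delta 0 \<alpha> + suminf (\<lambda>k. c k * delta (unit_index k) \<alpha>))"

text \<open>
  Polynomials in finitely many variables are elements of \<^typ>\<open>multiindex \<Rightarrow>\<^sub>0 complex\<close>.
  Multiplication by \<open>\<zeta>^\<beta>\<close> acts on coefficient families as \<open>dilation \<beta>\<close>.
\<close>

definition poly_mult :: "(multiindex \<Rightarrow>\<^sub>0 complex) \<Rightarrow> family \<Rightarrow> family"
  where "poly_mult q x =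
    (\<lambda>\<gamma>. \<Sum>\<beta>\<in>Poly_Mapping.keys q. Poly_Mapping.lookup q \<beta> * dilation \<beta> x \<gamma>)"

definition cyclic_in :: "family topology \<Rightarrow> family \<Rightarrow> bool"
  where "cyclic_in T f \<longleftrightarrow> T closure_of (range (\<lambda>q. poly_mult q f)) = topspace T"

text \<open>
  Factorability \<open>f = \<Prod>\<^sub>j f\<^sub>j\<close> over a set \<open>D\<close>.  Both infinite products are limits of partial
  products, that of the \<open>f\<^sub>j\<close> being taken pointwise on \<open>D\<close>.
\<close>

definition factorable_on :: "(nat \<Rightarrow> complex) set \<Rightarrow> family \<Rightarrow> bool"
  where "factorable_on D f \<longleftrightarrow>
    (\<exists>a c. (\<forall>j. affine_series (a j) (c j) \<in> lp_space 1) \<and>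
       (\<forall>\<zeta>\<in>D. (\<lambda>n. \<Prod>j<n. evaluate (affine_series (a j) (c j)) \<zeta>) \<longlonglongrightarrow> evaluate f \<zeta>) \<and>
       (\<exists>P>0. (\<lambda>n. \<Prod>j<n. lp_norm 1 (affine_series (a j) (c j))) \<longlonglongrightarrow> P))"

end

theory Submission
  imports Defs "HOL-Computational_Algebra.Primes"
begin

text \<open>
  Part (3) rests on the following observation.  Dividing by constants, \<open>f = f\<^sub>0 \<Prod>\<^sub>j (1 + l\<^sub>j)\<close> with linear
  \<open>l\<^sub>j\<close>; by part (2) and the absence of zeros \<open>m\<^sub>j = \<parallel>l\<^sub>j\<parallel>\<^sub>1 \<le> 1\<close>, and \<open>\<Sum>\<^sub>j m\<^sub>j\<close> is finite.  If \<open>S\<close> is the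
  \<open>n\<close>-th Cesaro mean of the geometric series of \<open>1 / (1 + l)\<close>, then \<open>S (1 + l) = 1 + e\<close>, where \<open>e\<close> has
  \<open>\<ell>\<^sup>1\<close> norm at most \<open>m\<close>, coefficients at most \<open>m / n\<close>, and \<open>\<bar>\<alpha>\<bar> \<bar>e\<^sub>\<alpha>\<bar> \<le> m\<close>.  All three bounds survive
  products, the last one because \<open>\<alpha> \<mapsto> \<bar>\<alpha>\<bar>\<close> acts as a derivation.  As \<open>\<Sum>\<^sub>j s\<^sub>j \<le> 1 / p'\<close>, the weight is
  at most \<open>(1 + \<bar>\<alpha>\<bar>)\<^sup>1\<^sup>/\<^sup>p\<^sup>'\<close>, so by interpolation the first and the third bound control the norm of \<open>X\<close>.
  Hence polynomial multiples of \<open>f\<close> stay bounded in \<open>X\<close> while their coefficients converge to those of a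
  prescribed polynomial, and on bounded sets this is weak convergence.
\<close>

text \<open>The obstacle is the extremal case m_j = 1: there the geometric series of 1 / (1 + l_j)
  need not converge in \<open>\<ell>\<^sup>1\<close>, and its partial sums leave a remainder in a
  single degree whose coefficients need not shrink. Averaging spreads this remainder evenly over the
  degrees 1, ..., n; parts of different degree have disjoint supports, so the coefficients gain a
  factor 1 / n while the \<open>\<ell>\<^sup>1\<close> norm stays bounded. Summability of the m_j
  comes from f(0) \<noteq> 0: the norm of f_j divided by |f_j(0)| is 1 + m_j, and the products of
  the numerators and of the denominators both have nonzero limits. Factorability speaks of values on
  the domain, whereas multiplication acts on coefficients. The finitely supported points of the open
  polydiscs lie in the domain, and for an \<open>\<ell>\<^sup>1\<close> bounded sequence convergence
  of the values there already forces convergence of the coefficients. Each l_j may involve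
  infinitely many variables, so a polynomial multiplier has to start from a truncation. A Cesaro
  mean of length n multiplies the norm of the dropped tail by n, hence a tail of size m_j / n^2 is
  harmless.\<close>

subsection \<open>The spaces \<open>\<ell>\<^sup>p\<close>\<close>

text \<open>For positive \<open>u\<close> and \<open>v\<close> this is convexity of the power; if
  one of them vanishes it reduces to \<open>t powr q \<le> t\<close> on the unit interval.\<close>

lemma powr_convex_nonneg:
  fixes u v t q :: real
  assumes "1 \<le> q" "0 \<le> u" "0 \<le> v" "0 \<le> t" "t \<le> 1"
  shows "(t * u + (1 - t) * v) powr q \<le> t * u powr q + (1 - t) * v powr q"
proof -
  have scale: "(t * u) powr q \<le> t * u powr q" if "0 \<le> u" "0 \<le> t" "t \<le> 1" for t u
  proof -
    have "t powr q \<le> t powr 1"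
      using assms(1) that by (intro powr_mono') auto
    then show ?thesis
      using that by (simp add: powr_mult mult_right_mono)
  qed
  show ?thesis
  proof (cases "u = 0 \<or> v = 0")
    case True
    then show ?thesis
      using scale[of u t] scale[of v "1 - t"] assms by auto
  next
    case False
    then show ?thesis
      using convex_onD[OF powr_convex[OF assms(1)], of "1 - t" u v] assms
      by (simp add: algebra_simps)
  qed
qed

lemma enn2real_ge_1: "1 \<le> enn2real p" if "1 \<le> p" "p \<noteq> \<infinity>"
  using that by (metis enn2real_1 enn2real_mono infinity_ennreal_def top.not_eq_extremum)

text \<open>Membership and norm bound are treated as one condition on finite sums, so that
  Minkowski's inequality, duality and limits become statements about finite sums.\<close>

lemma lp_bounded_iff:
  assumes "1 \<le> p" "p \<noteq> \<infinity>" "0 \<le> C"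
  shows "x \<in> lp_space p \<and> lp_norm p x \<le> C \<longleftrightarrow>
    (\<forall>F. finite F \<longrightarrow> (\<Sum>i\<in>F. cmod (x i) powr enn2real p) \<le> C powr enn2real p)"
proof -
  define q where "q = enn2real p"
  have q: "1 \<le> q"
    using enn2real_ge_1[OF assms(1,2)] by (simp add: q_def)
  define g where "g = (\<lambda>i. cmod (x i) powr q)"
  have g: "g i \<ge> 0" for i
    by (simp add: g_def)
  have mem: "x \<in> lp_space p \<longleftrightarrow> g summable_on UNIV"
    using assms(2) by (simp add: lp_space_def g_def q_def)
  have nrm: "lp_norm p x = infsum g UNIV powr (1 / q)"
    using assms(2) by (simp add: lp_norm_def g_def q_def)
  have inf0: "infsum g UNIV \<ge> 0"
    by (simp add: infsum_nonneg g)
  show ?thesis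
    unfolding mem nrm q_def[symmetric] g_def[symmetric]
  proof safe
    fix F :: "'a set"
    assume "g summable_on UNIV" and le: "infsum g UNIV powr (1 / q) \<le> C" and "finite F"
    have "infsum g UNIV = (infsum g UNIV powr (1 / q)) powr q"
      using inf0 q by (simp add: powr_powr)
    also have "\<dots> \<le> C powr q"
      using q le by (intro powr_mono2) auto
    finally show "sum g F \<le> C powr q"
      using finite_sum_le_infsum[OF \<open>g summable_on UNIV\<close> \<open>finite F\<close>] g by fastforce
  next
    assume *: "\<forall>F. finite F \<longrightarrow> sum g F \<le> C powr q"
    show sm: "g summable_on UNIV"
      by (rule nonneg_bdd_above_summable_on)
        (use g * in \<open>auto simp: bdd_above_def intro!: exI[of _ "C powr q"]\<close>)
    have "infsum g UNIV \<le> C powr q"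
      using * by (intro infsum_le_finite_sums[OF sm]) auto
    then have "infsum g UNIV powr (1 / q) \<le> (C powr q) powr (1 / q)"
      using inf0 q by (intro powr_mono2) auto
    then show "infsum g UNIV powr (1 / q) \<le> C"
      using q assms(3) by (simp add: powr_powr)
  qed
qed

lemma linf_bounded_iff:
  "x \<in> lp_space top \<and> lp_norm top x \<le> C \<longleftrightarrow> (\<forall>i. cmod (x i) \<le> C)"
proof safe
  assume "x \<in> lp_space top" and "lp_norm top x \<le> C"
  then show "cmod (x i) \<le> C" for i
    using cSUP_upper[of i UNIV "\<lambda>i. cmod (x i)"] by (auto simp: lp_space_def lp_norm_def)
next
  assume *: "\<forall>i. cmod (x i) \<le> C"
  show "x \<in> lp_space top"
    using * by (auto simp: lp_space_def bdd_above_def)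
  show "lp_norm top x \<le> C"
    using * by (auto simp: lp_norm_def intro: cSUP_least)
qed

text \<open>Membership matters for p = \<infinity>: the supremum of an unbounded set of reals is
  unspecified.\<close>

lemma lp_norm_nonneg: "0 \<le> lp_norm p x" if "1 \<le> p" "x \<in> lp_space p"
proof (cases "p = \<infinity>")
  case True
  then have "cmod (x undefined) \<le> lp_norm p x"
    using linf_bounded_iff[of x "lp_norm p x"] that by simp
  then show ?thesis
    by (rule order_trans[OF norm_ge_zero])
qed (simp add: lp_norm_def)

lemma lp_norm_upper: "cmod (x i) \<le> lp_norm p x" if "1 \<le> p" "x \<in> lp_space p"
proof (cases "p = \<infinity>")
  case True
  then show ?thesis
    using linf_bounded_iff[of x "lp_norm p x"] that by simp
next
  case False
  have q: "1 \<le> enn2real p"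
    using that(1) False by (rule enn2real_ge_1)
  have "cmod (x i) powr enn2real p \<le> lp_norm p x powr enn2real p"
    using lp_bounded_iff[OF that(1) False lp_norm_nonneg[OF that], of x] that
    by (auto dest!: spec[of _ "{i}"])
  then show ?thesis
    using q lp_norm_nonneg[OF that] powr_less_mono2[of "enn2real p" "lp_norm p x" "cmod (x i)"]
    by linarith
qed

text \<open>Fatou property: each finite sum passes to the limit, hence so does the bound. It serves
  for completeness, for the series in the uniform boundedness argument and for weak limits.\<close>

lemma lp_pointwise_limit:
  assumes "1 \<le> p" and "F \<noteq> bot"
    and bounded: "\<forall>\<^sub>F n in F. z n \<in> lp_space p \<and> lp_norm p (z n) \<le> C"
    and lim: "\<And>i. ((\<lambda>n. z n i) \<longlongrightarrow> x i) F"
  shows "x \<in> lp_space p \<and> lp_norm p x \<le> C"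
proof (cases "p = \<infinity>")
  case True
  have ev: "\<forall>\<^sub>F n in F. cmod (z n i) \<le> C" for i
    by (rule eventually_mono[OF bounded]) (simp add: True linf_bounded_iff)
  have "cmod (x i) \<le> C" for i
    by (rule tendsto_upperbound[OF tendsto_norm[OF lim] ev assms(2)])
  then show ?thesis
    by (simp add: True linf_bounded_iff)
next
  case False
  have q: "1 \<le> enn2real p"
    using assms(1) False by (rule enn2real_ge_1)
  obtain n where "z n \<in> lp_space p" "lp_norm p (z n) \<le> C"
    using eventually_happens[OF bounded] assms(2) by auto
  then have C: "0 \<le> C"
    by (rule order_trans[OF lp_norm_nonneg[OF assms(1)]])
  show ?thesis
    unfolding lp_bounded_iff[OF assms(1) False C]
  proof safe
    fix G :: "'b set"
    assume G: "finite G"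
    have ev: "\<forall>\<^sub>F n in F. (\<Sum>i\<in>G. cmod (z n i) powr enn2real p) \<le> C powr enn2real p"
      by (rule eventually_mono[OF bounded]) (simp add: lp_bounded_iff[OF assms(1) False C] G)
    have "((\<lambda>n. \<Sum>i\<in>G. cmod (z n i) powr enn2real p) \<longlongrightarrow>
        (\<Sum>i\<in>G. cmod (x i) powr enn2real p)) F"
      using q by (intro tendsto_sum tendsto_powr' tendsto_norm lim tendsto_const) auto
    from tendsto_upperbound[OF this ev assms(2)]
    show "(\<Sum>i\<in>G. cmod (x i) powr enn2real p) \<le> C powr enn2real p" .
  qed
qed

lemma lp_mono:
  assumes "1 \<le> p" "x \<in> lp_space p" "\<And>i. cmod (y i) \<le> cmod (x i)"
  shows "y \<in> lp_space p \<and> lp_norm p y \<le> lp_norm p x"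
proof (cases "p = \<infinity>")
  case True
  have "cmod (y i) \<le> lp_norm p x" for i
    using assms(3) lp_norm_upper[OF assms(1,2)] by (rule order_trans)
  then show ?thesis
    by (simp add: True linf_bounded_iff)
next
  case False
  have *: "\<forall>F. finite F \<longrightarrow>
      (\<Sum>i\<in>F. cmod (x i) powr enn2real p) \<le> lp_norm p x powr enn2real p"
    using lp_bounded_iff[OF assms(1) False lp_norm_nonneg[OF assms(1,2)], of x] assms by blast
  have "(\<Sum>i\<in>F. cmod (y i) powr enn2real p) \<le> (\<Sum>i\<in>F. cmod (x i) powr enn2real p)" for F
    by (intro sum_mono powr_mono2) (use assms in auto)
  then show ?thesis
    unfolding lp_bounded_iff[OF assms(1) False lp_norm_nonneg[OF assms(1,2)], of y]
    using * by (meson order_trans)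
qed

lemma lp_zero: "(\<lambda>i. 0) \<in> lp_space p" "lp_norm p (\<lambda>i. 0) = 0"
  by (auto simp: lp_space_def lp_norm_def)

lemma lp_norm_eq_0D: "x = (\<lambda>i. 0)" if "1 \<le> p" "x \<in> lp_space p" "lp_norm p x = 0"
  using lp_norm_upper[OF that(1,2)] that(3) by (metis norm_le_zero_iff)

text \<open>Minkowski's inequality. With a and b the two norms, (x + y) / (a + b) is the convex
  combination of x / a and y / b with weights t = a / (a + b) and 1 - t, and the q-th power is
  convex. Norm zero is separated because of the divisions.\<close>

lemma lp_add:
  assumes "1 \<le> p" "x \<in> lp_space p" "y \<in> lp_space p"
  shows "(\<lambda>i. x i + y i) \<in> lp_space p \<and> lp_norm p (\<lambda>i. x i + y i) \<le> lp_norm p x + lp_norm p y"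
proof -
  define a b where "a = lp_norm p x" and "b = lp_norm p y"
  have ab0: "0 \<le> a" "0 \<le> b"
    using assms lp_norm_nonneg by (auto simp: a_def b_def)
  consider "p = \<infinity>" | "a = 0" | "b = 0" | "p \<noteq> \<infinity>" "0 < a" "0 < b"
    using ab0 by fastforce
  then show ?thesis
  proof cases
    case 1
    have "cmod (x i + y i) \<le> lp_norm p x + lp_norm p y" for i
      using lp_norm_upper[OF assms(1,2), of i] lp_norm_upper[OF assms(1,3), of i]
        norm_triangle_ineq[of "x i" "y i"] by linarith
    then show ?thesis
      by (simp add: 1 linf_bounded_iff)
  next
    case 2
    then have "x = (\<lambda>i. 0)"
      using lp_norm_eq_0D[OF assms(1,2)] by (simp add: a_def)
    then show ?thesis
      using assms by (simp add: lp_zero)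
  next
    case 3
    then have "y = (\<lambda>i. 0)"
      using lp_norm_eq_0D[OF assms(1,3)] by (simp add: b_def)
    then show ?thesis
      using assms by (simp add: lp_zero)
  next
    case 4
    define q where "q = enn2real p"
    have q: "1 \<le> q"
      using enn2real_ge_1[OF assms(1) 4(1)] by (simp add: q_def)
    define t where "t = a / (a + b)"
    have t: "0 \<le> t" "t \<le> 1"
      using 4 by (auto simp: t_def field_simps)
    have e: "(a + b) * t = a" "(a + b) * (1 - t) = b"
      using 4 by (auto simp: t_def field_simps)
    have "(\<Sum>i\<in>F. cmod (x i + y i) powr q) \<le> (a + b) powr q" if F: "finite F" for F
    proof -
      have x: "(\<Sum>i\<in>F. cmod (x i) powr q) \<le> a powr q"
        using lp_bounded_iff[OF assms(1) 4(1) ab0(1), of x] assms F by (auto simp: a_def q_def)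
      have y: "(\<Sum>i\<in>F. cmod (y i) powr q) \<le> b powr q"
        using lp_bounded_iff[OF assms(1) 4(1) ab0(2), of y] assms F by (auto simp: b_def q_def)
      have "cmod (x i + y i) powr q
          \<le> (a + b) powr q * (t * (cmod (x i) powr q / a powr q)
              + (1 - t) * (cmod (y i) powr q / b powr q))" for i
      proof -
        have "cmod (x i + y i) \<le> cmod (x i) + cmod (y i)"
          by (rule norm_triangle_ineq)
        also have "\<dots> = (a + b) * (t * (cmod (x i) / a) + (1 - t) * (cmod (y i) / b))"
          using 4 by (simp add: distrib_left e flip: mult.assoc)
        finally have "cmod (x i + y i) powr q
            \<le> ((a + b) * (t * (cmod (x i) / a) + (1 - t) * (cmod (y i) / b))) powr q"
          using q by (intro powr_mono2) auto
        also have "\<dots> = (a + b) powr q * (t * (cmod (x i) / a) + (1 - t) * (cmod (y i) / b)) powr q"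
          by (rule powr_mult)
        also have "\<dots> \<le> (a + b) powr q * (t * (cmod (x i) / a) powr q
            + (1 - t) * (cmod (y i) / b) powr q)"
          using 4 t q by (intro mult_left_mono powr_convex_nonneg) auto
        finally show ?thesis
          using 4 by (simp add: powr_divide)
      qed
      then have "(\<Sum>i\<in>F. cmod (x i + y i) powr q)
          \<le> (\<Sum>i\<in>F. (a + b) powr q * (t * (cmod (x i) powr q / a powr q)
              + (1 - t) * (cmod (y i) powr q / b powr q)))"
        by (intro sum_mono)
      also have "\<dots> = (a + b) powr q * (t * ((\<Sum>i\<in>F. cmod (x i) powr q) / a powr q)
          + (1 - t) * ((\<Sum>i\<in>F. cmod (y i) powr q) / b powr q))"
        by (simp only: sum_divide_distrib sum_distrib_left flip: sum.distrib)
      also have "\<dots> \<le> (a + b) powr q * (t * 1 + (1 - t) * 1)"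
        using 4 t x y by (intro mult_left_mono add_mono) auto
      finally show ?thesis
        by simp
    qed
    then show ?thesis
      using lp_bounded_iff[OF assms(1) 4(1), of "a + b" "\<lambda>i. x i + y i"] ab0
      by (simp add: q_def a_def b_def)
  qed
qed

text \<open>The inequality \<le> is enough: applied to c x and the factor 1 / c it gives the reverse
  one.\<close>

lemma lp_scale:
  assumes "1 \<le> p" "x \<in> lp_space p"
  shows "(\<lambda>i. c * x i) \<in> lp_space p" "lp_norm p (\<lambda>i. c * x i) = cmod c * lp_norm p x"
proof -
  have *: "(\<lambda>i. c * x i) \<in> lp_space p \<and> lp_norm p (\<lambda>i. c * x i) \<le> cmod c * lp_norm p x"
    if "x \<in> lp_space p" for c x
  proof (cases "p = \<infinity>")
    case True
    then show ?thesis
      using linf_bounded_iff[of "\<lambda>i. c * x i" "cmod c * lp_norm p x"] lp_norm_upper[OF assms(1) that]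
      by (simp add: norm_mult mult_left_mono)
  next
    case False
    have C: "0 \<le> cmod c * lp_norm p x"
      using lp_norm_nonneg[OF assms(1) that] by simp
    have "(\<Sum>i\<in>F. cmod (c * x i) powr enn2real p) \<le> (cmod c * lp_norm p x) powr enn2real p"
      if "finite F" for F
    proof -
      have "(\<Sum>i\<in>F. cmod (x i) powr enn2real p) \<le> lp_norm p x powr enn2real p"
        using lp_bounded_iff[OF assms(1) False lp_norm_nonneg[OF assms(1) \<open>x \<in> _\<close>], of x]
          \<open>x \<in> _\<close> that by blast
      then show ?thesis
        using lp_norm_nonneg[OF assms(1) \<open>x \<in> _\<close>]
        by (simp add: norm_mult powr_mult mult_left_mono flip: sum_distrib_left)
    qed
    then show ?thesis
      using lp_bounded_iff[OF assms(1) False C] by blast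
  qed
  show mem: "(\<lambda>i. c * x i) \<in> lp_space p"
    using * assms by blast
  show "lp_norm p (\<lambda>i. c * x i) = cmod c * lp_norm p x"
  proof (cases "c = 0")
    case False
    then have "lp_norm p x \<le> lp_norm p (\<lambda>i. c * x i) / cmod c"
      using *[OF mem, of "inverse c"] by (simp add: norm_inverse divide_inverse mult.assoc[symmetric] mult.commute)
    then have "cmod c * lp_norm p x \<le> lp_norm p (\<lambda>i. c * x i)"
      using False by (simp add: field_simps)
    then show ?thesis
      using *[OF assms(2), of c] by linarith
  qed (simp add: lp_zero)
qed

lemma banach_space_on_lp:
  assumes "1 \<le> p"
  shows "banach_space_on (lp_space p) (lp_norm p)"
  unfolding banach_space_on_def
proof (intro conjI ballI allI impI)
  fix u :: "nat \<Rightarrow> 'a \<Rightarrow> complex"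
  assume *: "(\<forall>n. u n \<in> lp_space p) \<and>
    (\<forall>\<epsilon>>0. \<exists>M. \<forall>m\<ge>M. \<forall>n\<ge>M. lp_norm p (\<lambda>i. u m i - u n i) < \<epsilon>)"
  then have mem: "u n \<in> lp_space p" for n
    by simp
  have cauchy: "\<exists>M. \<forall>m\<ge>M. \<forall>n\<ge>M. lp_norm p (\<lambda>i. u m i - u n i) < e" if "e > 0" for e
    using * that by simp
  have diff: "(\<lambda>i. x i - y i) \<in> lp_space p" if "x \<in> lp_space p" "y \<in> lp_space p" for x y :: "'a \<Rightarrow> complex"
    using lp_add[OF assms that(1) lp_scale(1)[OF assms that(2), of "-1"]] by simp
  have "Cauchy (\<lambda>n. u n i)" for i
  proof (rule metric_CauchyI)
    fix e :: real
    assume "e > 0"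
    then obtain M where M: "\<forall>m\<ge>M. \<forall>n\<ge>M. lp_norm p (\<lambda>i. u m i - u n i) < e"
      using cauchy by metis
    have "dist (u m i) (u n i) < e" if "m \<ge> M" "n \<ge> M" for m n
      using lp_norm_upper[OF assms diff[OF mem mem], of m i n] M that
      by (auto simp: dist_norm intro: le_less_trans)
    then show "\<exists>M. \<forall>m\<ge>M. \<forall>n\<ge>M. dist (u m i) (u n i) < e"
      by blast
  qed
  then have "\<forall>i. \<exists>l. (\<lambda>n. u n i) \<longlonglongrightarrow> l"
    by (simp add: Cauchy_convergent_iff convergent_def)
  then obtain x where x: "(\<lambda>n. u n i) \<longlonglongrightarrow> x i" for i
    by metis
  \<comment> \<open>With m fixed, n tends to infinity in the Cauchy estimate;
    \<open>lp_pointwise_limit\<close> carries the norm bound over to the pointwise limit.\<close>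
  have close: "\<exists>M. \<forall>m\<ge>M. (\<lambda>i. u m i - x i) \<in> lp_space p \<and> lp_norm p (\<lambda>i. u m i - x i) \<le> e"
    if "e > 0" for e
  proof -
    obtain M where M: "\<forall>m\<ge>M. \<forall>n\<ge>M. lp_norm p (\<lambda>i. u m i - u n i) < e"
      using cauchy \<open>e > 0\<close> by metis
    have "(\<lambda>i. u m i - x i) \<in> lp_space p \<and> lp_norm p (\<lambda>i. u m i - x i) \<le> e" if "m \<ge> M" for m
    proof (rule lp_pointwise_limit[OF assms sequentially_bot, of "\<lambda>n i. u m i - u n i"])
      show "\<forall>\<^sub>F n in sequentially. (\<lambda>i. u m i - u n i) \<in> lp_space p
          \<and> lp_norm p (\<lambda>i. u m i - u n i) \<le> e"
        by (rule eventually_mono[OF eventually_ge_at_top[of M]])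
          (use M that in \<open>simp add: diff mem less_imp_le\<close>)
    qed (intro tendsto_intros x)
    then show ?thesis
      by blast
  qed
  obtain M where "(\<lambda>i. u M i - x i) \<in> lp_space p"
    using close[of 1] by auto
  then have "x \<in> lp_space p"
    using diff[OF mem, of "\<lambda>i. u M i - x i" M] by simp
  moreover have "(\<lambda>n. lp_norm p (\<lambda>i. u n i - x i)) \<longlonglongrightarrow> 0"
  proof (rule metric_LIMSEQ_I)
    fix r :: real
    assume "r > 0"
    then obtain M where M: "\<forall>m\<ge>M. (\<lambda>i. u m i - x i) \<in> lp_space p \<and> lp_norm p (\<lambda>i. u m i - x i) \<le> r / 2"
      using close[of "r / 2"] by auto
    have "dist (lp_norm p (\<lambda>i. u n i - x i)) 0 < r" if "n \<ge> M" for n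
    proof -
      have "0 \<le> lp_norm p (\<lambda>i. u n i - x i)" "lp_norm p (\<lambda>i. u n i - x i) \<le> r / 2"
        using M that lp_norm_nonneg[OF assms] by blast+
      then show ?thesis
        using \<open>r > 0\<close> by simp
    qed
    then show "\<exists>no. \<forall>n\<ge>no. dist (lp_norm p (\<lambda>i. u n i - x i)) 0 < r"
      by blast
  qed
  ultimately show "\<exists>x\<in>lp_space p. (\<lambda>n. lp_norm p (\<lambda>i. u n i - x i)) \<longlonglongrightarrow> 0"
    by (intro bexI[of _ x])
next
  show "(\<lambda>i. 0) \<in> lp_space p"
    by (rule lp_zero)
next
  fix x y :: "'a \<Rightarrow> complex" and c
  assume x: "x \<in> lp_space p"
  show "(\<lambda>i. c * x i) \<in> lp_space p" "lp_norm p (\<lambda>i. c * x i) = cmod c * lp_norm p x"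
    "0 \<le> lp_norm p x"
    by (rule lp_scale[OF assms x] lp_norm_nonneg[OF assms x])+
  show "lp_norm p x = 0 \<longleftrightarrow> x = (\<lambda>i. 0)"
    using lp_norm_eq_0D[OF assms x] lp_zero(2)[of p] by metis
  assume y: "y \<in> lp_space p"
  show "(\<lambda>i. x i + y i) \<in> lp_space p"
    "lp_norm p (\<lambda>i. x i + y i) \<le> lp_norm p x + lp_norm p y"
    using lp_add[OF assms x y] by auto
qed

section \<open>Conjugate exponents and Hoelder's inequality\<close>

lemma conjugate_exponents:
  fixes p p' :: ennreal
  assumes "1 \<le> p" "1 / p + 1 / p' = 1"
  obtains (one) "p = 1" "p' = \<infinity>"
    | (infinity) "p = \<infinity>" "p' = 1"
    | (finite) q q' where "p = ennreal q" "p' = ennreal q'" "1 < q" "1 < q'" "1 / q + 1 / q' = 1"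
proof (cases p)
  case (real q)
  then have q: "1 \<le> q"
    using assms(1) by simp
  then have ip: "1 / p = ennreal (1 / q)"
    using divide_ennreal[of 1 q] real by simp
  show ?thesis
  proof (cases p')
    case p': (real q')
    \<comment> \<open>In \<open>ennreal\<close> the quotient 1 / 0 is infinite, so p' = 0
      contradicts the relation; likewise 1 / \<infinity> = 0 is what admits the endpoint
      pairs.\<close>
    have "q' \<noteq> 0"
    proof
      assume "q' = 0"
      then show False
        using assms(2) p' by (simp add: ennreal_divide_zero)
    qed
    then have ip': "1 / p' = ennreal (1 / q')"
      using divide_ennreal[of 1 q'] p' by simp
    have "ennreal (1 / q + 1 / q') = ennreal 1"
      using assms(2) q p' unfolding ip ip' by (subst ennreal_plus) auto
    then have eq: "1 / q + 1 / q' = 1"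
      using q p' by (subst (asm) ennreal_inj) auto
    have "q \<noteq> 1" "q' > 0"
      using eq p' \<open>q' \<noteq> 0\<close> by auto
    then have "1 < q'"
    proof -
      have "0 < 1 / q"
        using q by simp
      then have "1 / q' < 1"
        using eq by linarith
      then show ?thesis
        using \<open>q' > 0\<close> by simp
    qed
    then show ?thesis
      using finite[of q q'] real p' q \<open>q \<noteq> 1\<close> eq by auto
  next
    case top
    then have "ennreal (1 / q) = ennreal 1"
      using assms(2) unfolding ip by simp
    then have "q = 1"
      using q by (subst (asm) ennreal_inj) auto
    then show ?thesis
      using one real top by simp
  qed
next
  case top
  then have "1 / p' = 1"
    using assms(2) by simp
  then have "p' = 1"
    by (simp add: divide_eq_1_ennreal)
  then show ?thesis
    using infinity top by simp
qed

lemma conjugate_exponent_ge_1: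
  fixes p p' :: ennreal
  assumes "1 \<le> p" "1 / p + 1 / p' = 1"
  shows "1 \<le> p'"
  using assms by (cases rule: conjugate_exponents) (auto simp flip: ennreal_1)

lemma l1_iff: "x \<in> lp_space 1 \<longleftrightarrow> (\<lambda>i. cmod (x i)) summable_on UNIV"
  by (simp add: lp_space_def)

lemma l1_norm: "lp_norm 1 x = (\<Sum>\<^sub>\<infinity>i. cmod (x i))"
  by (simp add: lp_norm_def infsum_nonneg)

lemma Hoelder_l1_linf:
  assumes "x \<in> lp_space 1" "y \<in> lp_space \<infinity>"
  shows "(\<lambda>i. cmod (x i * y i)) summable_on UNIV \<and>
    (\<Sum>\<^sub>\<infinity>i. cmod (x i * y i)) \<le> lp_norm 1 x * lp_norm \<infinity> y"
proof -
  have x: "(\<lambda>i. cmod (x i)) summable_on UNIV"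
    using assms(1) by (simp add: l1_iff)
  have le: "cmod (x i * y i) \<le> cmod (x i) * lp_norm \<infinity> y" for i
    using lp_norm_upper[OF _ assms(2), of i] by (simp add: norm_mult mult_left_mono)
  have sm: "(\<lambda>i. cmod (x i * y i)) summable_on UNIV"
    by (rule summable_on_comparison_test[OF summable_on_cmult_left[OF x]]) (use le in auto)
  have "(\<Sum>\<^sub>\<infinity>i. cmod (x i * y i)) \<le> (\<Sum>\<^sub>\<infinity>i. cmod (x i) * lp_norm \<infinity> y)"
    by (rule infsum_mono[OF sm summable_on_cmult_left[OF x]]) (use le in auto)
  also have "\<dots> = lp_norm 1 x * lp_norm \<infinity> y"
    by (simp add: infsum_cmult_left' l1_norm)
  finally show ?thesis
    using sm by simp
qed

theorem Hoelder:
  fixes p p' :: ennreal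
  assumes "1 \<le> p" "1 / p + 1 / p' = 1" and x: "x \<in> lp_space p" and y: "y \<in> lp_space p'"
  shows "(\<lambda>i. cmod (x i * y i)) summable_on UNIV \<and>
    (\<Sum>\<^sub>\<infinity>i. cmod (x i * y i)) \<le> lp_norm p x * lp_norm p' y"
  using assms(1,2)
proof (cases rule: conjugate_exponents)
  case one
  then show ?thesis
    using Hoelder_l1_linf x y by blast
next
  case infinity
  then show ?thesis
    using Hoelder_l1_linf[of y x] x y by (simp add: mult.commute)
next
  case (finite q q')
  have p: "p \<noteq> \<infinity>" "p' \<noteq> \<infinity>" "1 \<le> p'"
    using finite assms conjugate_exponent_ge_1 by auto
  have e: "enn2real p = q" "enn2real p' = q'"
    using finite by auto
  define a b where "a = lp_norm p x" and "b = lp_norm p' y"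
  have ab: "0 \<le> a" "0 \<le> b"
    using lp_norm_nonneg assms p by (auto simp: a_def b_def)
  have fin: "(\<Sum>i\<in>F. cmod (x i * y i)) \<le> a * b" if F: "finite F" for F
  proof (cases "a = 0 \<or> b = 0")
    case True
    then have "cmod (x i * y i) = 0" for i
      using lp_norm_upper[OF assms(1) x, of i] lp_norm_upper[OF p(3) y, of i]
      by (auto simp flip: a_def b_def)
    then have "(\<Sum>i\<in>F. cmod (x i * y i)) = 0"
      by (rule sum.neutral[OF ballI])
    then show ?thesis
      using ab by simp
  next
    case False
    then have ab: "0 < a" "0 < b"
      using ab by auto
    \<comment> \<open>After normalisation by the two norms Young's inequality applies termwise; the
      resulting sums are at most 1 / q and 1 / q', which add up to 1.\<close>
    have "(\<Sum>i\<in>F. cmod (x i * y i)) = a * b * (\<Sum>i\<in>F. cmod (x i) / a * (cmod (y i) / b))"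
      using ab by (simp add: sum_distrib_left norm_mult)
    also have "(\<Sum>i\<in>F. cmod (x i) / a * (cmod (y i) / b))
        \<le> (\<Sum>i\<in>F. (cmod (x i) / a) powr q / q + (cmod (y i) / b) powr q' / q')"
      using ab finite by (intro sum_mono Youngs_inequality) auto
    also have "\<dots> = (\<Sum>i\<in>F. cmod (x i) powr q) / a powr q / q
        + (\<Sum>i\<in>F. cmod (y i) powr q') / b powr q' / q'"
      using ab by (simp add: sum.distrib powr_divide sum_divide_distrib)
    also have "\<dots> \<le> 1 / q + 1 / q'"
    proof -
      have "(\<Sum>i\<in>F. cmod (x i) powr q) \<le> a powr q"
        using lp_bounded_iff[OF assms(1) p(1), of a x] F x ab by (simp add: a_def e)
      moreover have "(\<Sum>i\<in>F. cmod (y i) powr q') \<le> b powr q'"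
        using lp_bounded_iff[OF p(3) p(2), of b y] F y ab by (simp add: b_def e)
      ultimately show ?thesis
        using ab finite by (intro add_mono divide_right_mono) auto
    qed
    finally show ?thesis
      using ab finite by simp
  qed
  have sm: "(\<lambda>i. cmod (x i * y i)) summable_on UNIV"
    by (rule nonneg_bdd_above_summable_on)
      (use fin in \<open>auto simp: bdd_above_def intro!: exI[of _ "a * b"]\<close>)
  then show ?thesis
    using infsum_le_finite_sums[OF sm, of "a * b"] fin by (simp add: a_def b_def)
qed

text \<open>
  The bound is the uniform boundedness principle: if it failed, there would be \<open>x\<^sub>n\<close> in the unit
  ball with \<open>\<Sum>\<^sub>i \<bar>x\<^sub>n i y i\<bar> > 4^n\<close>, and \<open>\<Sum>\<^sub>n 2^-n \<bar>x\<^sub>n\<bar>\<close> would be an element of the space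
  whose pairing with \<open>y\<close> diverges.
\<close>

lemma kothe_dual_lp_bounded:
  fixes y :: "'i \<Rightarrow> complex"
  assumes "1 \<le> p" and y: "y \<in> kothe_dual (lp_space p)"
  obtains C where "0 \<le> C" and "\<And>x. x \<in> lp_space p \<Longrightarrow> (\<Sum>\<^sub>\<infinity>i. cmod (x i * y i)) \<le> C * lp_norm p x"
proof -
  have sm: "(\<lambda>i. cmod (x i * y i)) summable_on UNIV" if "x \<in> lp_space p" for x
    using y that by (simp add: kothe_dual_def)
  have "\<exists>C. \<forall>x\<in>lp_space p. lp_norm p x \<le> 1 \<longrightarrow> (\<Sum>\<^sub>\<infinity>i. cmod (x i * y i)) \<le> C"
  proof (rule ccontr)
    assume "\<not> ?thesis"
    then have "\<forall>n. \<exists>x. x \<in> lp_space p \<and> lp_norm p x \<le> 1 \<and> 4 ^ n < (\<Sum>\<^sub>\<infinity>i. cmod (x i * y i))"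
      for n :: nat
      by (meson not_le)
    then obtain x where x: "\<And>n. x n \<in> lp_space p" "\<And>n. lp_norm p (x n) \<le> 1"
      "\<And>n :: nat. 4 ^ n < (\<Sum>\<^sub>\<infinity>i. cmod (x n i * y i))"
      by metis
    define z where "z = (\<lambda>i. complex_of_real (suminf (\<lambda>n. (1 / 2) ^ n * cmod (x n i))))"
    have "summable (\<lambda>n. (1 / 2) ^ n * cmod (x n i))" for i
    proof (rule summable_comparison_test')
      show "norm ((1 / 2) ^ n * cmod (x n i)) \<le> (1 / 2) ^ n" for n
        using lp_norm_upper[OF assms(1) x(1), of n i] x(2)[of n]
        by (simp add: norm_mult mult_left_le)
    qed (simp add: summable_geometric)
    then have sums: "(\<lambda>n. (1 / 2) ^ n * cmod (x n i)) sums (suminf (\<lambda>n. (1 / 2) ^ n * cmod (x n i)))"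
      and smn: "summable (\<lambda>n. (1 / 2) ^ n * cmod (x n i))" for i
      by (auto simp: summable_sums)
    define P where "P = (\<lambda>N i. \<Sum>n<N. complex_of_real ((1 / 2) ^ n * cmod (x n i)))"
    have P: "P N \<in> lp_space p \<and> lp_norm p (P N) \<le> (\<Sum>n<N. (1 / 2) ^ n)" for N
    proof (induction N)
      case 0
      then show ?case
        by (simp add: P_def lp_zero)
    next
      case (Suc N)
      define u where "u = (\<lambda>i. complex_of_real ((1 / 2) ^ N) * complex_of_real (cmod (x N i)))"
      have x': "(\<lambda>i. complex_of_real (cmod (x N i))) \<in> lp_space p \<and>
          lp_norm p (\<lambda>i. complex_of_real (cmod (x N i))) \<le> lp_norm p (x N)"
        by (rule lp_mono[OF assms(1) x(1)]) simp
      have u: "u \<in> lp_space p" "lp_norm p u \<le> (1 / 2) ^ N"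
        using lp_scale[OF assms(1) conjunct1[OF x'], of "complex_of_real ((1 / 2) ^ N)"] x' x(2)[of N]
        by (auto simp: u_def norm_power mult_left_le)
      have "P (Suc N) = (\<lambda>i. P N i + u i)"
        by (auto simp: P_def u_def)
      then show ?case
        using lp_add[OF assms(1), of "P N" u] Suc u by auto
    qed
    have "(\<Sum>n<N. (1 / 2 :: real) ^ n) \<le> 2" for N
      using sum_le_suminf[of "\<lambda>n. (1 / 2 :: real) ^ n" "{..<N}"]
      by (simp add: suminf_geometric summable_geometric)
    then have P2: "P N \<in> lp_space p \<and> lp_norm p (P N) \<le> 2" for N
      using P[of N] by (meson order_trans)
    have lim: "(\<lambda>N. P N i) \<longlonglongrightarrow> z i" for i
      using sums_of_real[OF sums, where 'a = complex] unfolding P_def z_def sums_def .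
    have mem: "z \<in> lp_space p"
      using lp_pointwise_limit[OF assms(1) sequentially_bot, of P 2 z] P2 lim by auto
    define S where "S = (\<Sum>\<^sub>\<infinity>i. cmod (z i * y i))"
    \<comment> \<open>A single term of the series for z already dominates |x_n| / 2^n. Hence the
      finite number S would exceed every 2^n.\<close>
    have "4 ^ n < 2 ^ n * S" for n :: nat
    proof -
      have "cmod (x n i * y i) \<le> 2 ^ n * cmod (z i * y i)" for i
      proof -
        have "(1 / 2) ^ n * cmod (x n i) \<le> (suminf (\<lambda>n. (1 / 2) ^ n * cmod (x n i)))"
          using sum_le_suminf[OF smn, of "{n}"] by simp
        also have "\<dots> = cmod (z i)"
          unfolding z_def by (simp add: suminf_nonneg[OF smn])
        finally have "cmod (x n i) \<le> 2 ^ n * cmod (z i)"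
          by (simp add: field_simps)
        then have "cmod (x n i) * cmod (y i) \<le> (2 ^ n * cmod (z i)) * cmod (y i)"
          by (intro mult_right_mono) auto
        then show ?thesis
          by (simp add: norm_mult mult.assoc)
      qed
      then have "(\<Sum>\<^sub>\<infinity>i. cmod (x n i * y i)) \<le> (\<Sum>\<^sub>\<infinity>i. 2 ^ n * cmod (z i * y i))"
        by (intro infsum_mono sm x summable_on_cmult_right mem) auto
      then show ?thesis
        using x(3)[of n] by (simp add: infsum_cmult_right' S_def)
    qed
    then have "2 ^ n < S" for n :: nat
    proof -
      have "(2 :: real) ^ n * 2 ^ n < 2 ^ n * S"
        using \<open>4 ^ n < 2 ^ n * S\<close> by (simp flip: power_mult_distrib)
      then show ?thesis
        by simp
    qed
    then show False
      using real_arch_pow[of 2 S] by (metis less_asym one_less_numeral_iff semiring_norm(76))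
  qed
  then obtain C where C: "\<And>x. x \<in> lp_space p \<Longrightarrow> lp_norm p x \<le> 1 \<Longrightarrow>
      (\<Sum>\<^sub>\<infinity>i. cmod (x i * y i)) \<le> C"
    by blast
  show thesis
  proof (rule that)
    show "0 \<le> C"
      using C[of "\<lambda>i. 0"] by (simp add: lp_zero)
    fix x :: "'i \<Rightarrow> complex"
    assume x: "x \<in> lp_space p"
    show "(\<Sum>\<^sub>\<infinity>i. cmod (x i * y i)) \<le> C * lp_norm p x"
    proof (cases "lp_norm p x = 0")
      case True
      then show ?thesis
        using lp_norm_eq_0D[OF assms(1) x] by (simp add: lp_zero)
    next
      case False
      define c where "c = lp_norm p x"
      have c: "c > 0"
        using False lp_norm_nonneg[OF assms(1) x] by (simp add: c_def)
      have "(\<Sum>\<^sub>\<infinity>i. cmod (complex_of_real (1 / c) * x i * y i)) \<le> C"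
        using lp_scale[OF assms(1) x, of "complex_of_real (1 / c)"] c
        by (intro C) (auto simp: c_def norm_divide)
      moreover have "(\<Sum>\<^sub>\<infinity>i. cmod (complex_of_real (1 / c) * x i * y i))
          = (1 / c) * (\<Sum>\<^sub>\<infinity>i. cmod (x i * y i))"
        using c by (simp add: norm_mult norm_divide mult.assoc infsum_cmult_right' flip: infsum_cmult_right')
      ultimately show ?thesis
        using c by (simp add: field_simps c_def)
    qed
  qed
qed

text \<open>For the inclusion beyond Hoelder, y is tested against unit vectors if p = 1, against the
  constant family if p = \<infinity>, and otherwise against |y|^(q'-1) on a finite set, the equality
  case of Hoelder's inequality.\<close>

theorem kothe_dual_lp_space:
  fixes p p' :: ennreal
  assumes "1 \<le> p" "1 / p + 1 / p' = 1"
  shows "kothe_dual (lp_space p) = (lp_space p' :: ('i \<Rightarrow> complex) set)"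
proof (intro set_eqI iffI)
  fix y :: "'i \<Rightarrow> complex"
  assume "y \<in> lp_space p'"
  then show "y \<in> kothe_dual (lp_space p)"
    using Hoelder[OF assms] by (auto simp: kothe_dual_def)
next
  fix y :: "'i \<Rightarrow> complex"
  assume y: "y \<in> kothe_dual (lp_space p)"
  obtain C where C: "0 \<le> C"
      "\<And>x. x \<in> lp_space p \<Longrightarrow> (\<Sum>\<^sub>\<infinity>i. cmod (x i * y i)) \<le> C * lp_norm p x"
    using kothe_dual_lp_bounded[OF assms(1) y] by auto
  show "y \<in> lp_space p'"
    using assms
  proof (cases rule: conjugate_exponents)
    case one
    have "cmod (y i) \<le> C" for i
    proof -
      define x :: "'i \<Rightarrow> complex" where "x = (\<lambda>j. if j = i then 1 else 0)"
      have *: "((\<lambda>j. f j) has_sum f i) UNIV" if "\<And>j. j \<noteq> i \<Longrightarrow> f j = 0" for f :: "'i \<Rightarrow> real"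
        using has_sum_cong_neutral[of "UNIV - {i}" "{i}" f f] that
        by (metis (no_types, lifting) Diff_iff UNIV_I has_sum_cong_neutral has_sum_finiteI finite.emptyI finite.insertI insert_iff sum.insert sum.empty add_0_right empty_iff)
      have x: "((\<lambda>j. cmod (x j)) has_sum 1) UNIV" "((\<lambda>j. cmod (x j * y j)) has_sum cmod (y i)) UNIV"
        using *[of "\<lambda>j. cmod (x j)"] *[of "\<lambda>j. cmod (x j * y j)"] by (auto simp: x_def)
      then have "x \<in> lp_space p" "lp_norm p x = 1"
        by (auto simp: one l1_iff l1_norm has_sum_iff)
      then show ?thesis
        using C(2)[of x] x(2) by (simp add: has_sum_iff)
    qed
    then show ?thesis
      using linf_bounded_iff[of y C] one by simp
  next
    case infinity
    have one: "(\<lambda>i :: 'i. 1) \<in> lp_space p"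
      by (simp add: infinity lp_space_def)
    have "(\<lambda>i. cmod (1 * y i)) summable_on UNIV"
      using bspec[OF y[unfolded kothe_dual_def mem_Collect_eq] one] .
    then show ?thesis
      by (simp add: infinity l1_iff)
  next
    case (finite q q')
    have p: "p \<noteq> \<infinity>" "p' \<noteq> \<infinity>" "1 \<le> p'"
      using finite assms conjugate_exponent_ge_1 by auto
    have e: "enn2real p = q" "enn2real p' = q'"
      using finite by auto
    have qq: "(q' - 1) * q = q'" "1 - 1 / q = 1 / q'"
      using finite by (auto simp: field_simps)
    have "(\<Sum>i\<in>F. cmod (y i) powr q') \<le> C powr q'" if F: "finite F" for F
    proof (cases "(\<Sum>i\<in>F. cmod (y i) powr q') = 0")
      case False
      define T where "T = (\<Sum>i\<in>F. cmod (y i) powr q')"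
      have T: "T > 0"
        using False sum_nonneg[of F "\<lambda>i. cmod (y i) powr q'"] by (simp add: T_def)
      \<comment> \<open>As (q' - 1) q = q', this vector has norm at most T^(1/q), and the moduli of
        its products with y sum to T over F. Dividing T \<le> C T^(1/q) by T^(1/q) leaves T^(1/q')
        \<le> C.\<close>
      define x where "x = (\<lambda>i. if i \<in> F then complex_of_real (cmod (y i) powr (q' - 1)) else 0)"
      have "(\<Sum>i\<in>G. cmod (x i) powr q) \<le> (T powr (1 / q)) powr q" if G: "finite G" for G
      proof -
        have "cmod (x i) powr q = (if i \<in> F then cmod (y i) powr q' else 0)" for i
          using finite by (simp add: x_def powr_powr qq)
        then have "(\<Sum>i\<in>G. cmod (x i) powr q) = (\<Sum>i\<in>G \<inter> F. cmod (y i) powr q')"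
          using G by (simp add: sum.inter_restrict)
        also have "\<dots> \<le> T"
          unfolding T_def using F by (intro sum_mono2) auto
        also have "T = (T powr (1 / q)) powr q"
          using finite T by (simp add: powr_powr)
        finally show ?thesis .
      qed
      then have x: "x \<in> lp_space p" "lp_norm p x \<le> T powr (1 / q)"
        using lp_bounded_iff[OF assms(1) p(1), of "T powr (1 / q)" x] by (auto simp: e)
      have "T = (\<Sum>i\<in>F. cmod (x i * y i))"
        unfolding T_def
      proof (rule sum.cong)
        fix i
        assume "i \<in> F"
        then show "cmod (y i) powr q' = cmod (x i * y i)"
          using powr_add[of "cmod (y i)" "q' - 1" 1] by (auto simp: x_def norm_mult)
      qed simp
      also have "\<dots> \<le> (\<Sum>\<^sub>\<infinity>i. cmod (x i * y i))"
        using y x F by (intro finite_sum_le_infsum) (auto simp: kothe_dual_def)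
      also have "\<dots> \<le> C * T powr (1 / q)"
        using C(2)[OF x(1)] x(2) C(1) by (meson mult_left_mono order_trans)
      finally have "T powr (1 - 1 / q) \<le> C"
        using T by (simp add: powr_diff field_simps)
      then have "(T powr (1 / q')) powr q' \<le> C powr q'"
        using finite qq by (intro powr_mono2) auto
      then show ?thesis
        using T finite by (simp add: powr_powr T_def)
    qed simp
    then show ?thesis
      using lp_bounded_iff[OF p(3) p(2) C(1), of y] by (simp add: e)
  qed
qed

subsection \<open>Weighted spaces\<close>

lemma weight_superset:
  assumes "finite K" "Poly_Mapping.keys \<alpha> \<subseteq> K"
  shows "weight s \<alpha> = (\<Prod>j\<in>K. (1 + real (Poly_Mapping.lookup \<alpha> j)) powr s j)"
  unfolding weight_def using assms
  by (intro prod.mono_neutral_left) (auto simp: not_in_keys_iff_lookup_eq_zero)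

lemma monomial_superset:
  assumes "finite K" "Poly_Mapping.keys \<alpha> \<subseteq> K"
  shows "monomial z \<alpha> = (\<Prod>j\<in>K. z j ^ Poly_Mapping.lookup \<alpha> j)"
  unfolding monomial_def using assms
  by (intro prod.mono_neutral_left) (auto simp: not_in_keys_iff_lookup_eq_zero)

lemma weight_pos: "0 < weight s \<alpha>"
  unfolding weight_def by (intro prod_pos) (simp add: add_pos_nonneg)

lemma weight_ge_1:
  assumes "\<And>j. 0 \<le> s j"
  shows "1 \<le> weight s \<alpha>"
  unfolding weight_def by (intro prod_ge_1 ge_one_powr_ge_zero) (use assms in auto)

text \<open>Factorwise, 1 + a + b \<le> (1 + a) (1 + b). This makes every dilation bounded on
  X.\<close>

lemma weight_add_le:
  assumes "\<And>j. 0 \<le> s j"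
  shows "weight s (\<alpha> + \<beta>) \<le> weight s \<beta> * weight s \<alpha>"
proof -
  let ?K = "Poly_Mapping.keys \<alpha> \<union> Poly_Mapping.keys \<beta>"
  let ?l = Poly_Mapping.lookup
  have "(1 + real (?l (\<alpha> + \<beta>) j)) powr s j \<le> (1 + real (?l \<beta> j)) powr s j * (1 + real (?l \<alpha> j)) powr s j"
    for j
  proof -
    have "1 + real (?l (\<alpha> + \<beta>) j) \<le> (1 + real (?l \<beta> j)) * (1 + real (?l \<alpha> j))"
      by (simp add: lookup_add algebra_simps)
    then have "(1 + real (?l (\<alpha> + \<beta>) j)) powr s j \<le> ((1 + real (?l \<beta> j)) * (1 + real (?l \<alpha> j))) powr s j"
      using assms by (intro powr_mono2) auto
    then show ?thesis
      by (simp add: powr_mult)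
  qed
  then have "(\<Prod>j\<in>?K. (1 + real (?l (\<alpha> + \<beta>) j)) powr s j)
      \<le> (\<Prod>j\<in>?K. (1 + real (?l \<beta> j)) powr s j * (1 + real (?l \<alpha> j)) powr s j)"
    by (intro prod_mono) auto
  then show ?thesis
    using keys_add[of \<alpha> \<beta>]
    by (simp add: weight_superset[of ?K "\<alpha> + \<beta>"] weight_superset[of ?K \<alpha>] weight_superset[of ?K \<beta>]
        prod.distrib)
qed

text \<open>Only the factor at \<open>j\<close> changes, and 1 + (k + 1) \<le> 2 (1 + k).\<close>

lemma weight_add_unit_le:
  assumes "\<And>j. 0 \<le> s j"
  shows "weight s (\<alpha> + unit_index j) \<le> 2 powr s j * weight s \<alpha>"
proof -
  let ?K = "insert j (Poly_Mapping.keys \<alpha>)"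
  let ?l = Poly_Mapping.lookup
  have "(1 + real (?l (\<alpha> + unit_index j) k)) powr s k
      \<le> (if k = j then 2 powr s j else 1) * (1 + real (?l \<alpha> k)) powr s k" for k
  proof (cases "k = j")
    case True
    have "(1 + real (?l (\<alpha> + unit_index j) j)) powr s j \<le> (2 * (1 + real (?l \<alpha> j))) powr s j"
      using assms by (intro powr_mono2) (auto simp: lookup_add)
    also have "\<dots> = 2 powr s j * (1 + real (?l \<alpha> j)) powr s j"
      by (rule powr_mult)
    finally show ?thesis
      using True by simp
  qed (simp add: lookup_add lookup_single)
  then have "(\<Prod>k\<in>?K. (1 + real (?l (\<alpha> + unit_index j) k)) powr s k)
      \<le> (\<Prod>k\<in>?K. (if k = j then 2 powr s j else 1) * (1 + real (?l \<alpha> k)) powr s k)"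
    by (intro prod_mono) auto
  also have "\<dots> = 2 powr s j * (\<Prod>k\<in>?K. (1 + real (?l \<alpha> k)) powr s k)"
    by (simp only: prod.distrib prod.delta finite_insert finite_keys) simp
  finally have *: "(\<Prod>k\<in>?K. (1 + real (?l (\<alpha> + unit_index j) k)) powr s k)
      \<le> 2 powr s j * (\<Prod>k\<in>?K. (1 + real (?l \<alpha> k)) powr s k)" .
  have "Poly_Mapping.keys (\<alpha> + unit_index j) \<subseteq> ?K"
    using keys_add[of \<alpha> "unit_index j"] by auto
  from weight_superset[OF _ this, of s] weight_superset[of ?K \<alpha> s] * show ?thesis
    by (simp only: finite_insert finite_keys subset_insertI)
qed

lemma lp_space_finite_support:
  assumes "finite {i. x i \<noteq> 0}"
  shows "x \<in> lp_space p"
proof (cases "p = \<infinity>")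
  case True
  have "range (\<lambda>i. cmod (x i)) \<subseteq> insert 0 ((\<lambda>i. cmod (x i)) ` {i. x i \<noteq> 0})"
    by auto
  then have "finite (range (\<lambda>i. cmod (x i)))"
    using assms finite_subset by blast
  then show ?thesis
    using True by (simp add: lp_space_def bdd_above_finite)
next
  case False
  have "(\<lambda>i. cmod (x i) powr enn2real p) summable_on {i. x i \<noteq> 0}"
    using assms by simp
  then have "(\<lambda>i. cmod (x i) powr enn2real p) summable_on UNIV"
    by (subst summable_on_cong_neutral[where g = "\<lambda>i. cmod (x i) powr enn2real p" and T = "{i. x i \<noteq> 0}"]) auto
  then show ?thesis
    using False by (simp add: lp_space_def)
qed

text \<open>With \<open>g\<close> a translation of multiindices this reduces the boundedness of a
  dilation to a comparison of weights.\<close>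

lemma lp_push_forward:
  assumes "1 \<le> p" "x \<in> lp_space p" "inj g"
    and le: "\<And>i. cmod (y (g i)) \<le> cmod (x i)" and zero: "\<And>j. j \<notin> range g \<Longrightarrow> y j = 0"
  shows "y \<in> lp_space p \<and> lp_norm p y \<le> lp_norm p x"
proof (cases "p = \<infinity>")
  case True
  have "cmod (y j) \<le> lp_norm p x" for j
  proof (cases "j \<in> range g")
    case True
    then obtain i where "j = g i" by blast
    then show ?thesis
      using le[of i] lp_norm_upper[OF assms(1,2), of i] by simp
  next
    case False
    then show ?thesis
      using zero lp_norm_nonneg[OF assms(1,2)] by simp
  qed
  then show ?thesis
    by (simp add: True linf_bounded_iff)
next
  case False
  have C: "0 \<le> lp_norm p x"
    by (rule lp_norm_nonneg[OF assms(1,2)])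
  have "(\<Sum>j\<in>F. cmod (y j) powr enn2real p) \<le> lp_norm p x powr enn2real p" if F: "finite F" for F
  proof -
    have fin: "finite (g -` F)"
      using F assms(3) by (rule finite_vimageI)
    have "(\<Sum>j\<in>F. cmod (y j) powr enn2real p) = (\<Sum>j\<in>g ` (g -` F). cmod (y j) powr enn2real p)"
      using F zero by (intro sum.mono_neutral_right) (auto simp: image_vimage_eq)
    also have "\<dots> = (\<Sum>i\<in>g -` F. cmod (y (g i)) powr enn2real p)"
      using assms(3) by (subst sum.reindex) (auto intro: inj_on_subset)
    also have "\<dots> \<le> (\<Sum>i\<in>g -` F. cmod (x i) powr enn2real p)"
      using le by (intro sum_mono powr_mono2) auto
    also have "\<dots> \<le> lp_norm p x powr enn2real p"
      using lp_bounded_iff[OF assms(1) False C, of x] assms(2) fin by simp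
    finally show ?thesis .
  qed
  then show ?thesis
    using lp_bounded_iff[OF assms(1) False C, of y] by simp
qed

lemma banach_space_on_weighted:
  assumes "1 \<le> p" "\<And>i :: 'i. 0 < w i"
  shows "banach_space_on (weighted_lp_space p w) (weighted_lp_norm p w)"
proof -
  let ?W = "\<lambda>x i. x i * complex_of_real (w i)"
  have w: "w i \<noteq> 0" for i
    using assms(2)[of i] by simp
  note B = banach_space_on_lp[OF assms(1), where 'a = 'i, unfolded banach_space_on_def]
  show ?thesis
    unfolding banach_space_on_def
  proof (intro conjI ballI allI impI)
    show "(\<lambda>i. 0) \<in> weighted_lp_space p w"
      by (simp add: weighted_lp_space_def lp_zero)
  next
    fix u :: "nat \<Rightarrow> 'i \<Rightarrow> complex"
    assume u: "(\<forall>n. u n \<in> weighted_lp_space p w) \<and> (\<forall>\<epsilon>>0. \<exists>M. \<forall>m\<ge>M. \<forall>n\<ge>M.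
      weighted_lp_norm p w (\<lambda>i. u m i - u n i) < \<epsilon>)"
    have "(\<forall>n. ?W (u n) \<in> lp_space p) \<and> (\<forall>\<epsilon>>0. \<exists>M. \<forall>m\<ge>M. \<forall>n\<ge>M.
      lp_norm p (\<lambda>i. ?W (u m) i - ?W (u n) i) < \<epsilon>)"
      using u by (simp add: weighted_lp_space_def weighted_lp_norm_def left_diff_distrib)
    from B[THEN conjunct2, THEN conjunct2, THEN conjunct2, THEN conjunct2, THEN spec, THEN mp, OF this]
    obtain v where v: "v \<in> lp_space p" "(\<lambda>n. lp_norm p (\<lambda>i. ?W (u n) i - v i)) \<longlonglongrightarrow> 0"
      by (rule bexE)
    define x where "x = (\<lambda>i. v i / complex_of_real (w i))"
    have vx: "v = ?W x"
      using w by (auto simp: x_def)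
    show "\<exists>x\<in>weighted_lp_space p w. (\<lambda>n. weighted_lp_norm p w (\<lambda>i. u n i - x i)) \<longlonglongrightarrow> 0"
    proof (intro bexI[of _ x])
      show "x \<in> weighted_lp_space p w"
        using v(1) by (simp add: weighted_lp_space_def vx)
      show "(\<lambda>n. weighted_lp_norm p w (\<lambda>i. u n i - x i)) \<longlonglongrightarrow> 0"
        using v(2) by (simp add: weighted_lp_norm_def vx left_diff_distrib)
    qed
  next
    fix x y :: "'i \<Rightarrow> complex" and c
    assume x: "x \<in> weighted_lp_space p w"
    then have wx: "?W x \<in> lp_space p"
      by (simp add: weighted_lp_space_def)
    show "(\<lambda>i. c * x i) \<in> weighted_lp_space p w"
        "weighted_lp_norm p w (\<lambda>i. c * x i) = cmod c * weighted_lp_norm p w x"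
      using lp_scale[OF assms(1) wx, of c]
      by (simp_all add: weighted_lp_space_def weighted_lp_norm_def mult.assoc)
    show "0 \<le> weighted_lp_norm p w x"
      using lp_norm_nonneg[OF assms(1) wx] by (simp add: weighted_lp_norm_def)
    have "x = (\<lambda>i. 0)" if "weighted_lp_norm p w x = 0"
    proof
      fix i
      have "cmod (x i * complex_of_real (w i)) \<le> 0"
        using lp_norm_upper[OF assms(1) wx, of i] that by (simp add: weighted_lp_norm_def)
      then show "x i = 0"
        using w[of i] by simp
    qed
    moreover have "weighted_lp_norm p w (\<lambda>i. 0) = 0"
      by (simp add: weighted_lp_norm_def lp_zero)
    ultimately show "weighted_lp_norm p w x = 0 \<longleftrightarrow> x = (\<lambda>i. 0)"
      by metis
    assume "y \<in> weighted_lp_space p w"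
    then have wy: "?W y \<in> lp_space p"
      by (simp add: weighted_lp_space_def)
    show "(\<lambda>i. x i + y i) \<in> weighted_lp_space p w"
        "weighted_lp_norm p w (\<lambda>i. x i + y i) \<le> weighted_lp_norm p w x + weighted_lp_norm p w y"
      using lp_add[OF assms(1) wx wy]
      by (simp_all add: weighted_lp_space_def weighted_lp_norm_def distrib_right)
  qed
qed

text \<open>Multiplication by the weight identifies the weighted space with
  \<open>\<ell>\<^sup>p\<close>, so division by it identifies the duals.\<close>

lemma kothe_dual_weighted_iff:
  fixes p p' :: ennreal
  assumes "1 \<le> p" "1 / p + 1 / p' = 1" "\<And>i :: 'i. 0 < w i"
  shows "y \<in> kothe_dual (weighted_lp_space p w) \<longleftrightarrow> (\<lambda>i. y i / complex_of_real (w i)) \<in> lp_space p'"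
proof -
  let ?v = "\<lambda>i. y i / complex_of_real (w i)"
  have w: "w i \<noteq> 0" for i
    using assms(3)[of i] by simp
  have "y \<in> kothe_dual (weighted_lp_space p w) \<longleftrightarrow> ?v \<in> kothe_dual (lp_space p)"
  proof
    assume y: "y \<in> kothe_dual (weighted_lp_space p w)"
    show "?v \<in> kothe_dual (lp_space p)"
      unfolding kothe_dual_def
    proof (intro CollectI ballI)
      fix x :: "'i \<Rightarrow> complex"
      assume "x \<in> lp_space p"
      then have "(\<lambda>i. x i / complex_of_real (w i)) \<in> weighted_lp_space p w"
        using w by (simp add: weighted_lp_space_def)
      then have "(\<lambda>i. cmod (x i / complex_of_real (w i) * y i)) summable_on UNIV"
        by (rule bspec[OF y[unfolded kothe_dual_def mem_Collect_eq]])
      then show "(\<lambda>i. cmod (x i * ?v i)) summable_on UNIV"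
        by simp
    qed
  next
    assume v: "?v \<in> kothe_dual (lp_space p)"
    show "y \<in> kothe_dual (weighted_lp_space p w)"
      unfolding kothe_dual_def
    proof (intro CollectI ballI)
      fix x :: "'i \<Rightarrow> complex"
      assume "x \<in> weighted_lp_space p w"
      then have "(\<lambda>i. x i * complex_of_real (w i)) \<in> lp_space p"
        by (simp add: weighted_lp_space_def)
      then have "(\<lambda>i. cmod (x i * complex_of_real (w i) * ?v i)) summable_on UNIV"
        by (rule bspec[OF v[unfolded kothe_dual_def mem_Collect_eq]])
      then show "(\<lambda>i. cmod (x i * y i)) summable_on UNIV"
        by (simp add: w)
    qed
  qed
  then show ?thesis
    by (simp add: kothe_dual_lp_space[OF assms(1,2)])
qed

lemma dilation_X:
  assumes "1 \<le> p" "x \<in> X_space p s"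
    and le: "\<And>\<alpha>. weight s (\<alpha> + \<beta>) \<le> C * weight s \<alpha>"
  shows "dilation \<beta> x \<in> X_space p s \<and> X_norm p s (dilation \<beta> x) \<le> C * X_norm p s x"
proof -
  define v where "v = (\<lambda>\<alpha>. x \<alpha> * complex_of_real (weight s \<alpha>))"
  have v: "v \<in> lp_space p"
    using assms(2) by (simp add: v_def weighted_lp_space_def)
  have "0 < C * weight s 0"
    using weight_pos[of s "0 + \<beta>"] le[of 0] by linarith
  then have C: "0 < C"
    using weight_pos[of s 0] by (simp add: zero_less_mult_iff)
  let ?y = "\<lambda>\<gamma>. dilation \<beta> x \<gamma> * complex_of_real (weight s \<gamma>)"
  have "?y \<in> lp_space p \<and> lp_norm p ?y \<le> lp_norm p (\<lambda>\<alpha>. complex_of_real C * v \<alpha>)"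
  proof (rule lp_push_forward[OF assms(1) lp_scale(1)[OF assms(1) v], of "\<lambda>\<alpha>. \<alpha> + \<beta>"])
    show "cmod (?y (\<alpha> + \<beta>)) \<le> cmod (complex_of_real C * v \<alpha>)" for \<alpha>
    proof -
      have "cmod (?y (\<alpha> + \<beta>)) = cmod (x \<alpha>) * weight s (\<alpha> + \<beta>)"
        using weight_pos[of s "\<alpha> + \<beta>"] by (auto simp: dilation_def norm_mult)
      also have "\<dots> \<le> cmod (x \<alpha>) * (C * weight s \<alpha>)"
        by (intro mult_left_mono le) auto
      finally show ?thesis
        using C weight_pos[of s \<alpha>] by (simp add: v_def norm_mult ac_simps)
    qed
  qed (auto simp: dilation_def inj_def)
  then show ?thesis
    using lp_scale(2)[OF assms(1) v, of "complex_of_real C"] C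
    by (simp add: weighted_lp_space_def weighted_lp_norm_def v_def)
qed

lemma ISL_X:
  assumes "1 \<le> p" "\<And>j. 0 \<le> s j"
  shows "ISL (X_space p s) (X_norm p s)"
  unfolding ISL_def
proof (intro conjI ballI allI impI)
  show "banach_space_on (X_space p s) (X_norm p s)"
    using assms(1) weight_pos by (rule banach_space_on_weighted)
  show "dilation \<beta> x \<in> X_space p s" if "x \<in> X_space p s" for x \<beta>
    using dilation_X[OF assms(1) that] weight_add_le[of s] assms(2) by blast
  show "delta 0 \<in> X_space p s"
    unfolding weighted_lp_space_def
    by (intro CollectI lp_space_finite_support, rule finite_subset[of _ "{0}"]) (auto simp: delta_def)
  fix x y :: family
  assume x: "x \<in> X_space p s" and le: "\<forall>\<alpha>. cmod (y \<alpha>) \<le> cmod (x \<alpha>)"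
  have "(\<lambda>i. y i * complex_of_real (weight s i)) \<in> lp_space p \<and>
      lp_norm p (\<lambda>i. y i * complex_of_real (weight s i)) \<le> lp_norm p (\<lambda>i. x i * complex_of_real (weight s i))"
    by (rule lp_mono[OF assms(1)]) (use x le in \<open>auto simp: weighted_lp_space_def norm_mult mult_right_mono\<close>)
  then show "y \<in> X_space p s" "X_norm p s y \<le> X_norm p s x"
    by (auto simp: weighted_lp_space_def weighted_lp_norm_def)
qed

lemma operator_norm_dilation_unit:
  assumes "1 \<le> p" "\<And>j. 0 \<le> s j"
  shows "operator_norm_on (X_space p s) (X_norm p s) (dilation (unit_index j)) \<le> ennreal (2 powr s j)"
  unfolding operator_norm_on_def
proof (intro SUP_least ennreal_leI)
  fix x
  assume "x \<in> {x \<in> X_space p s. X_norm p s x \<le> 1}"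
  then have x: "x \<in> X_space p s" "X_norm p s x \<le> 1"
    by auto
  have "X_norm p s (dilation (unit_index j) x) \<le> 2 powr s j * X_norm p s x"
    using dilation_X[OF assms(1) x(1)] weight_add_unit_le[of s] assms(2) by blast
  also have "\<dots> \<le> 2 powr s j * 1"
    using x(2) by (intro mult_left_mono) auto
  finally show "X_norm p s (dilation (unit_index j) x) \<le> 2 powr s j"
    by simp
qed

section \<open>The one-variable growth and summability criterion\<close>

lemma power_exceeds_powr:
  fixes t s C :: real
  assumes "1 < t" "0 \<le> s"
  shows "\<exists>k::nat. C * (1 + real k) powr s < t ^ k"
proof (rule ccontr)
  assume "\<not> ?thesis"
  then have le: "t ^ k \<le> C * (1 + real k) powr s" for k :: nat
    by (simp add: not_less)
  \<comment> \<open>Since b^(s+1) = t, the linear growth of b^k given by Bernoulli's inequality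
    becomes growth of order s + 1 for t^k, one order more than the assumed upper bound
    allows.\<close>
  define b where "b = t powr (1 / (s + 1))"
  have b: "1 < b" "b powr (s + 1) = t"
    using assms by (auto simp: b_def powr_powr intro!: gr_one_powr)
  \<comment> \<open>Chosen for c (1 + k) \<le> 1 + k (b - 1): c \<le> 1 handles the constant term, c
    \<le> b - 1 the linear one.\<close>
  define c where "c = min 1 (b - 1)"
  have c: "0 < c" "c \<le> 1" "c \<le> b - 1"
    using b by (auto simp: c_def)
  have "c powr (s + 1) * (1 + real k) \<le> C" for k :: nat
  proof -
    have "c * (1 + real k) \<le> 1 + real k * (b - 1)"
      using c mult_right_mono[of c "b - 1" "real k"] by (simp add: distrib_left mult.commute)
    also have "\<dots> \<le> (1 + (b - 1)) ^ k"
      using b by (intro Bernoulli_inequality) auto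
    finally have "(c * (1 + real k)) powr (s + 1) \<le> (b ^ k) powr (s + 1)"
      using c assms by (intro powr_mono2) auto
    also have "\<dots> = t ^ k"
      using b by (simp add: powr_powr powr_realpow[symmetric] mult.commute flip: b(2))
    also have "\<dots> \<le> C * (1 + real k) powr s"
      by (rule le)
    finally have "c powr (s + 1) * (1 + real k) * (1 + real k) powr s \<le> C * (1 + real k) powr s"
      using powr_add[of "1 + real k" s 1] by (simp add: powr_mult ac_simps)
    then show ?thesis
      by (simp add: mult_le_cancel_right)
  qed
  moreover obtain k :: nat where "C / c powr (s + 1) < real k"
    using reals_Archimedean2 by blast
  moreover have "0 < c powr (s + 1)"
    using c by simp
  ultimately show False
    by (smt (verit, best) mult.commute pos_divide_less_eq mult_strict_left_mono)
qed

text \<open>A geometric majorant for t < 1, the series of (1 + k)^(-s q) for t = 1, unbounded terms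
  for t > 1. With q = p' the case t = 1 is the origin of the strict threshold s_j > 1 / p' for
  closed discs.\<close>

lemma summable_power_over_powr_iff:
  fixes t s q :: real
  assumes "0 \<le> t" "0 \<le> s" "1 \<le> q"
  shows "summable (\<lambda>k. (t ^ k / (1 + real k) powr s) powr q) \<longleftrightarrow> t < 1 \<or> t = 1 \<and> 1 < s * q"
proof -
  consider "t < 1" | "t = 1" | "1 < t" by linarith
  then show ?thesis
  proof cases
    case 1
    have "summable (\<lambda>k. (t powr q) ^ k)"
    proof (rule summable_geometric)
      have "t powr q < 1"
        using 1 assms powr_less_mono2[of q t 1] by simp
      then show "norm (t powr q) < 1"
        by simp
    qed
    then have "summable (\<lambda>k. (t ^ k / (1 + real k) powr s) powr q)"
    proof (rule summable_comparison_test'[where N = 0])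
      fix k :: nat
      have "1 \<le> (1 + real k) powr s"
        using assms by (intro ge_one_powr_ge_zero) auto
      then have "t ^ k / (1 + real k) powr s \<le> t ^ k"
        using assms by (simp add: divide_le_eq mult_le_cancel_left1)
      then have "(t ^ k / (1 + real k) powr s) powr q \<le> (t ^ k) powr q"
        using assms by (intro powr_mono2) auto
      also have "\<dots> = (t powr q) ^ k"
      proof (cases "t = 0")
        case True
        then show ?thesis
          using assms by (cases k) auto
      next
        case False
        then show ?thesis
          using assms by (simp add: powr_powr mult.commute flip: powr_realpow)
      qed
      finally show "norm ((t ^ k / (1 + real k) powr s) powr q) \<le> (t powr q) ^ k"
        by simp
    qed
    then show ?thesis
      using 1 by simp
  next
    case 2
    have "(t ^ k / (1 + real k) powr s) powr q = real (Suc k) powr - (s * q)" for k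
      using 2 by (simp add: powr_powr add.commute flip: powr_minus_divide)
    then have "summable (\<lambda>k. (t ^ k / (1 + real k) powr s) powr q) \<longleftrightarrow>
        summable (\<lambda>k. real k powr - (s * q))"
      using summable_Suc_iff[of "\<lambda>k. real k powr - (s * q)"] by simp
    also have "\<dots> \<longleftrightarrow> 1 < s * q"
      using summable_real_powr_iff[of "- (s * q)"] by simp
    finally show ?thesis
      using 2 by simp
  next
    case 3
    have False if "summable (\<lambda>k. (t ^ k / (1 + real k) powr s) powr q)"
    proof -
      have "Bseq (\<lambda>k. (t ^ k / (1 + real k) powr s) powr q)"
        using summable_imp_Bseq[OF that] .
      then obtain K where K: "K > 0" "\<And>k. norm ((t ^ k / (1 + real k) powr s) powr q) \<le> K"
        by (auto simp: Bseq_def)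
      obtain k :: nat where k: "(K + 1) * (1 + real k) powr s < t ^ k"
        using power_exceeds_powr[OF 3 assms(2)] by blast
      define r where "r = t ^ k / (1 + real k) powr s"
      have r: "K + 1 < r"
        using k by (simp add: r_def less_divide_eq)
      then have "r powr 1 \<le> r powr q"
        using K assms by (intro powr_mono) auto
      moreover have "r powr q \<le> K"
        using K(2)[of k] by (simp add: r_def)
      moreover have "r powr 1 = r"
        using r K(1) by simp
      ultimately show False
        using r by linarith
    qed
    then show ?thesis
      using 3 by auto
  qed
qed

subsection \<open>Sections of the domain\<close>

text \<open>The multiindices in \<open>F\<close> embed into the grid {0, ..., M}^N, over which the
  sum of products factorises.\<close>

lemma sum_prod_le_prod_sums:
  fixes f :: "nat \<Rightarrow> nat \<Rightarrow> real"
  assumes nonneg: "\<And>j k. 0 \<le> f j k" and sm: "\<And>j. j < N \<Longrightarrow> summable (f j)"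
    and F: "finite F" "\<And>\<alpha>. \<alpha> \<in> F \<Longrightarrow> Poly_Mapping.keys \<alpha> \<subseteq> {..<N}"
  shows "(\<Sum>\<alpha>\<in>F. \<Prod>j<N. f j (Poly_Mapping.lookup \<alpha> j)) \<le> (\<Prod>j<N. suminf (f j))"
proof -
  define M where "M = Max (insert 0 (\<Union>\<alpha>\<in>F. Poly_Mapping.lookup \<alpha> ` {..<N}))"
  have M: "Poly_Mapping.lookup \<alpha> j \<le> M" if "\<alpha> \<in> F" "j < N" for \<alpha> j
    unfolding M_def using that F(1) by (intro Max_ge) auto
  \<comment> \<open>\<open>restrict\<close> makes the values extensional, so that \<open>r\<close>
    maps into a \<open>PiE\<close>; nothing is lost since the supports lie below N.\<close>
  define r where "r = (\<lambda>\<alpha> :: multiindex. restrict (Poly_Mapping.lookup \<alpha>) {..<N})"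
  have inj: "inj_on r F"
  proof (rule inj_onI)
    fix \<alpha> \<beta>
    assume *: "\<alpha> \<in> F" "\<beta> \<in> F" "r \<alpha> = r \<beta>"
    show "\<alpha> = \<beta>"
    proof (rule poly_mapping_eqI)
      fix j
      show "Poly_Mapping.lookup \<alpha> j = Poly_Mapping.lookup \<beta> j"
      proof (cases "j < N")
        case True
        then show ?thesis
          using fun_cong[OF *(3), of j] by (simp add: r_def)
      next
        case False
        then have "j \<notin> Poly_Mapping.keys \<alpha>" "j \<notin> Poly_Mapping.keys \<beta>"
          using F(2) *(1,2) by blast+
        then show ?thesis
          by (simp add: in_keys_iff)
      qed
    qed
  qed
  have "(\<Sum>\<alpha>\<in>F. \<Prod>j<N. f j (Poly_Mapping.lookup \<alpha> j)) = (\<Sum>g\<in>r ` F. \<Prod>j<N. f j (g j))"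
    using inj by (simp add: sum.reindex r_def)
  also have "\<dots> \<le> (\<Sum>g\<in>PiE {..<N} (\<lambda>_. {..M}). \<Prod>j<N. f j (g j))"
    using M nonneg
    by (intro sum_mono2 finite_PiE prod_nonneg) (auto simp: r_def split: if_splits)
  also have "\<dots> = (\<Prod>j<N. \<Sum>k\<le>M. f j k)"
    by (simp add: prod_sum_PiE)
  also have "\<dots> \<le> (\<Prod>j<N. suminf (f j))"
    using nonneg sm by (intro prod_mono conjI sum_nonneg sum_le_suminf) auto
  finally show ?thesis .
qed

lemma monomial_over_weight:
  assumes "finite K" "Poly_Mapping.keys \<alpha> \<subseteq> K"
  shows "cmod (monomial z \<alpha> / complex_of_real (weight s \<alpha>)) =
    (\<Prod>j\<in>K. cmod (z j) ^ Poly_Mapping.lookup \<alpha> j / (1 + real (Poly_Mapping.lookup \<alpha> j)) powr s j)"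
  using weight_pos[of s \<alpha>]
  by (simp add: norm_divide monomial_superset[OF assms] weight_superset[OF assms] prod_dividef
      prod_norm[symmetric] norm_power)

lemma monomial_over_weight_single:
  "cmod (monomial z (Poly_Mapping.single j k) / complex_of_real (weight s (Poly_Mapping.single j k))) =
    cmod (z j) ^ k / (1 + real k) powr s j"
  by (subst monomial_over_weight[of "{j}"]) auto

lemma inverse_conjugate_less_iff:
  fixes q q' s :: real
  assumes "1 \<le> q'" "0 \<le> s"
  shows "1 / ennreal q' < ennreal s \<longleftrightarrow> 1 < s * q'"
proof -
  have "1 / ennreal q' = ennreal (1 / q')"
    using divide_ennreal[of 1 q'] assms by simp
  then show ?thesis
    using assms by (simp add: ennreal_less_iff divide_less_eq)
qed

text \<open>The monomials divided by the weights factorise over the coordinates. Restriction to the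
  powers of one variable gives necessity; for sufficiency the sum over multiindices is at most a
  product of N one-variable series. For p = 1 suprema replace the sums, and |z_j| \<le> 1 is the
  criterion for every exponent s_j \<ge> 0.\<close>

theorem D_section_eq_product_of_discs:
  fixes p p' :: ennreal
  assumes "1 \<le> p" "1 / p + 1 / p' = 1" and s: "\<And>j. 0 \<le> s j"
  shows "D_section (kothe_dual (X_space p s)) N =
    product_of_discs N (\<lambda>j. if p = 1 \<or> 1 / p' < ennreal (s j) then cball 0 1 else ball 0 1)"
proof (rule set_eqI)
  fix z :: "nat \<Rightarrow> complex"
  let ?v = "\<lambda>\<alpha>. monomial z \<alpha> / complex_of_real (weight s \<alpha>)"
  define E where "E = (\<lambda>j. if p = 1 \<or> 1 / p' < ennreal (s j) then cball 0 1 else ball (0 :: complex) 1)"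
  have mem: "z \<in> D_section (kothe_dual (X_space p s)) N \<longleftrightarrow> ?v \<in> lp_space p' \<and> (\<forall>j\<ge>N. z j = 0)"
    by (simp add: D_section_def D_infty_def kothe_dual_weighted_iff[OF assms(1,2) weight_pos])
  have "?v \<in> lp_space p' \<longleftrightarrow> (\<forall>j<N. z j \<in> E j)" if z0: "\<forall>j\<ge>N. z j = 0"
  proof (cases "p = 1")
    case one: True
    have p': "p' = \<infinity>"
      using assms(1,2)
    proof (cases rule: conjugate_exponents)
      case (finite q q')
      then show ?thesis
        using one by simp
    qed (use one in simp_all)
    show ?thesis
    proof
      assume "?v \<in> lp_space p'"
      note C = lp_norm_upper[OF conjugate_exponent_ge_1[OF assms(1,2)] this]
      show "\<forall>j<N. z j \<in> E j"
      proof (intro allI impI)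
        fix j
        have "cmod (z j) ^ k / (1 + real k) powr s j \<le> lp_norm p' ?v" for k
          using C[of "Poly_Mapping.single j k"] by (simp only: monomial_over_weight_single)
        then have "\<not> lp_norm p' ?v * (1 + real k) powr s j < cmod (z j) ^ k" for k
          by (simp add: divide_le_eq not_less)
        then have "\<not> 1 < cmod (z j)"
          using power_exceeds_powr[OF _ s, of "cmod (z j)" "lp_norm p' ?v" j] by metis
        then show "z j \<in> E j"
          using one by (simp add: E_def)
      qed
    next
      assume E: "\<forall>j<N. z j \<in> E j"
      have z1: "cmod (z j) \<le> 1" for j
        using E z0 one by (cases "j < N") (auto simp: E_def)
      have "cmod (?v \<alpha>) \<le> 1" for \<alpha>
        unfolding monomial_over_weight[OF finite_keys subset_refl]
      proof (rule prod_le_1)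
        fix j
        have "1 \<le> (1 + real (Poly_Mapping.lookup \<alpha> j)) powr s j"
          using s by (intro ge_one_powr_ge_zero) auto
        moreover have "cmod (z j) ^ Poly_Mapping.lookup \<alpha> j \<le> 1"
          using z1 by (intro power_le_one) auto
        ultimately show "0 \<le> cmod (z j) ^ Poly_Mapping.lookup \<alpha> j / (1 + real (Poly_Mapping.lookup \<alpha> j)) powr s j \<and>
            cmod (z j) ^ Poly_Mapping.lookup \<alpha> j / (1 + real (Poly_Mapping.lookup \<alpha> j)) powr s j \<le> 1"
          by (simp add: divide_le_eq)
      qed
      then show "?v \<in> lp_space p'"
        using linf_bounded_iff[of ?v 1] p' by simp
    qed
  next
    case False
    obtain q' where p': "p' = ennreal q'" and q': "1 \<le> q'"
      using assms(1,2)
    proof (cases rule: conjugate_exponents)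
      case infinity
      then show ?thesis
        using that[of 1] by simp
    next
      case (finite q q')
      then show ?thesis
        using that[of q'] by simp
    qed (use False in simp_all)
    define f where "f = (\<lambda>j k. (cmod (z j) ^ k / (1 + real k) powr s j) powr q')"
    have f0: "0 \<le> f j k" for j k
      by (simp add: f_def)
    have summable_f: "summable (f j) \<longleftrightarrow> z j \<in> E j" for j
      using False inverse_conjugate_less_iff[OF q' s, of j]
        summable_power_over_powr_iff[OF norm_ge_zero[of "z j"] s q', of j]
      by (auto simp: f_def E_def p')
    have lp: "?v \<in> lp_space p' \<longleftrightarrow> (\<lambda>\<alpha>. cmod (?v \<alpha>) powr q') summable_on UNIV"
      using q' by (simp add: lp_space_def p')
    show ?thesis
      unfolding lp
    proof
      assume sm: "(\<lambda>\<alpha>. cmod (?v \<alpha>) powr q') summable_on UNIV"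
      show "\<forall>j<N. z j \<in> E j"
      proof (intro allI impI)
        fix j
        have inj: "inj (Poly_Mapping.single j :: nat \<Rightarrow> multiindex)"
          by (rule injI) (metis lookup_single_eq)
        have "(\<lambda>\<alpha>. cmod (?v \<alpha>) powr q') summable_on range (Poly_Mapping.single j)"
          by (rule summable_on_subset_banach[OF sm]) simp
        then have "((\<lambda>\<alpha>. cmod (?v \<alpha>) powr q') \<circ> Poly_Mapping.single j) summable_on UNIV"
          using summable_on_reindex[OF inj] by blast
        also have "(\<lambda>\<alpha>. cmod (?v \<alpha>) powr q') \<circ> Poly_Mapping.single j = f j"
          by (rule ext) (simp only: comp_apply monomial_over_weight_single f_def)
        finally show "z j \<in> E j"
          using summable_on_imp_summable summable_f by blast
      qed
    next
      assume E: "\<forall>j<N. z j \<in> E j"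
      have "(\<Sum>\<alpha>\<in>F. cmod (?v \<alpha>) powr q') \<le> (\<Prod>j<N. suminf (f j))" if F: "finite F" for F
      proof -
        let ?G = "{\<alpha>\<in>F. Poly_Mapping.keys \<alpha> \<subseteq> {..<N}}"
        \<comment> \<open>A multiindex involving a variable beyond the first N contributes a factor
          0^k with k > 0.\<close>
        have "?v \<alpha> = 0" if nk: "\<not> Poly_Mapping.keys \<alpha> \<subseteq> {..<N}" for \<alpha>
        proof -
          obtain j where "j \<in> Poly_Mapping.keys \<alpha>" "N \<le> j"
            using nk by (metis lessThan_iff not_le subsetI)
          then show ?thesis
            using z0 by (auto simp: monomial_def in_keys_iff intro!: bexI[of _ j])
        qed
        then have "(\<Sum>\<alpha>\<in>F. cmod (?v \<alpha>) powr q') = (\<Sum>\<alpha>\<in>?G. cmod (?v \<alpha>) powr q')"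
          using F by (intro sum.mono_neutral_right) auto
        also have "\<dots> = (\<Sum>\<alpha>\<in>?G. \<Prod>j<N. f j (Poly_Mapping.lookup \<alpha> j))"
        proof (rule sum.cong)
          fix \<alpha>
          assume "\<alpha> \<in> ?G"
          then have K: "Poly_Mapping.keys \<alpha> \<subseteq> {..<N}"
            by simp
          have "cmod (?v \<alpha>) powr q' = (\<Prod>j<N. cmod (z j) ^ Poly_Mapping.lookup \<alpha> j /
              (1 + real (Poly_Mapping.lookup \<alpha> j)) powr s j) powr q'"
            by (simp only: monomial_over_weight[OF finite_lessThan K])
          also have "\<dots> = (\<Prod>j<N. f j (Poly_Mapping.lookup \<alpha> j))"
            unfolding f_def by (rule prod_powr_distrib)
          finally show "cmod (?v \<alpha>) powr q' = (\<Prod>j<N. f j (Poly_Mapping.lookup \<alpha> j))" .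
        qed (rule refl)
        also have "\<dots> \<le> (\<Prod>j<N. suminf (f j))"
        proof (rule sum_prod_le_prod_sums[OF f0])
          show "summable (f j)" if "j < N" for j
            using E that summable_f by blast
        qed (use F in simp_all)
        finally show ?thesis .
      qed
      then show "(\<lambda>\<alpha>. cmod (?v \<alpha>) powr q') summable_on UNIV"
        by (intro nonneg_bdd_above_summable_on)
          (auto simp: bdd_above_def intro!: exI[of _ "\<Prod>j<N. suminf (f j)"])
    qed
  qed
  then show "z \<in> D_section (kothe_dual (X_space p s)) N \<longleftrightarrow> z \<in> product_of_discs N
      (\<lambda>j. if p = 1 \<or> 1 / p' < ennreal (s j) then cball 0 1 else ball 0 1)"
    unfolding mem E_def[symmetric] product_of_discs_def by auto
qed

text \<open>This is the information about the shape of the domain on which parts (2) and (3)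
  rest.\<close>

lemma ball_subset_D_section:
  fixes p p' :: ennreal
  assumes "1 \<le> p" "1 / p + 1 / p' = 1" "\<And>j. 0 \<le> s j"
    and z: "\<And>j. j < N \<Longrightarrow> cmod (z j) < 1" "\<And>j. N \<le> j \<Longrightarrow> z j = 0"
  shows "z \<in> D_section (kothe_dual (X_space p s)) N"
  using z unfolding D_section_eq_product_of_discs[OF assms(1-3)] product_of_discs_def
  by (auto simp: less_imp_le)

section \<open>Affine functions and the bound of part (2)\<close>

lemma monomial_zero [simp]: "monomial z 0 = 1"
  by (simp add: monomial_def)

lemma monomial_single: "monomial z (Poly_Mapping.single j k) = z j ^ k"
  by (subst monomial_superset[of "{j}"]) auto

lemma unit_index_neq_0: "unit_index k \<noteq> 0"
  by (metis lookup_single_eq lookup_zero zero_neq_one)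

lemma unit_index_eq_iff: "unit_index k = unit_index j \<longleftrightarrow> k = j"
  by (metis lookup_single_eq lookup_single_not_eq zero_neq_one)

lemma affine_series_0: "affine_series a c 0 = a"
  using unit_index_neq_0 by (simp add: affine_series_def delta_def eq_commute[of 0])

lemma affine_series_unit: "affine_series a c (unit_index j) = c j"
proof -
  have "(\<lambda>k. c k * delta (unit_index k) (unit_index j)) = (\<lambda>k. if k = j then c k else 0)"
    using unit_index_eq_iff by (auto simp: delta_def fun_eq_iff)
  then show ?thesis
    using unit_index_neq_0[of j] sums_unique[OF sums_If_finite[of "\<lambda>k. k = j" c]]
    by (simp add: affine_series_def delta_def)
qed

lemma affine_series_eq_0:
  assumes "\<alpha> \<noteq> 0" "\<And>k. \<alpha> \<noteq> unit_index k"
  shows "affine_series a c \<alpha> = 0"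
  using assms by (simp add: affine_series_def delta_def)

lemma evaluate_affine_series:
  assumes "\<And>k. N \<le> k \<Longrightarrow> z k = 0"
  shows "evaluate (affine_series a c) z = a + (\<Sum>k<N. c k * z k)"
proof -
  let ?S = "insert 0 (unit_index ` {..<N})"
  have inj: "inj_on unit_index {..<N}"
    by (rule inj_onI) (simp only: unit_index_eq_iff)
  have "affine_series a c \<alpha> * monomial z \<alpha> = 0" if "\<alpha> \<notin> ?S" for \<alpha>
  proof (cases "\<exists>k. \<alpha> = unit_index k")
    case True
    then obtain k where k: "\<alpha> = unit_index k" by blast
    then have "N \<le> k"
      using that by (metis image_eqI insertCI lessThan_iff not_le)
    then show ?thesis
      using assms by (simp only: k monomial_single) simp
  next
    case False
    then show ?thesis
      using that affine_series_eq_0 by auto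
  qed
  then have "evaluate (affine_series a c) z = (\<Sum>\<^sub>\<infinity>\<alpha>\<in>?S. affine_series a c \<alpha> * monomial z \<alpha>)"
    unfolding evaluate_def by (intro infsum_cong_neutral) auto
  also have "\<dots> = (\<Sum>\<alpha>\<in>?S. affine_series a c \<alpha> * monomial z \<alpha>)"
    by simp
  also have "\<dots> = a + (\<Sum>\<alpha>\<in>unit_index ` {..<N}. affine_series a c \<alpha> * monomial z \<alpha>)"
    using unit_index_neq_0 by (subst sum.insert) (auto simp: affine_series_0 image_iff dest: sym)
  also have "(\<Sum>\<alpha>\<in>unit_index ` {..<N}. affine_series a c \<alpha> * monomial z \<alpha>)
      = (\<Sum>k<N. affine_series a c (unit_index k) * monomial z (unit_index k))"
    using sum.reindex[OF inj] by simp
  also have "\<dots> = (\<Sum>k<N. c k * z k)"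
    by (simp only: affine_series_unit monomial_single power_one_right)
  finally show ?thesis .
qed

text \<open>If the sum of the |c_k| exceeded |a|, aligning the phases of the terms c_k z_k would
  produce a zero in the open polydisc.\<close>

lemma nonvanishing_affine_bound:
  fixes p p' :: ennreal
  assumes "1 \<le> p" "1 / p + 1 / p' = 1" "\<And>j. 0 \<le> s j"
    and nz: "\<And>N z. 1 \<le> N \<Longrightarrow> z \<in> D_section (kothe_dual (X_space p s)) N \<Longrightarrow>
      evaluate (affine_series a c) z \<noteq> 0"
  shows "(\<Sum>k<N. cmod (c k)) \<le> cmod a"
proof (rule ccontr)
  assume neg: "\<not> ?thesis"
  define S where "S = (\<Sum>k<N. cmod (c k))"
  have S: "cmod a < S"
    using neg by (simp add: S_def)
  then have Spos: "0 < S"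
    using norm_ge_zero[of a] by linarith
  then have N: "1 \<le> N"
    by (cases N) (auto simp: S_def)
  \<comment> \<open>Each c_k z_k equals -(a / S) |c_k|, and |z_k| \<le> |a| / S < 1. Where c_k = 0
    the quotient 0 / 0 is 0, so z_k = 0.\<close>
  define z where "z = (\<lambda>k. if k < N then - a * complex_of_real (1 / S) * (cnj (c k) / complex_of_real (cmod (c k))) else 0)"
  have "z \<in> D_section (kothe_dual (X_space p s)) N"
  proof (rule ball_subset_D_section[OF assms(1-3)])
    fix j
    have "cmod (z j) \<le> cmod a / S"
      using Spos by (auto simp: z_def norm_mult norm_divide)
    also have "\<dots> < 1"
      using S Spos by simp
    finally show "cmod (z j) < 1" .
  qed (simp add: z_def)
  moreover have "evaluate (affine_series a c) z = 0"
  proof -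
    have "c k * z k = - a * complex_of_real (1 / S) * complex_of_real (cmod (c k))" if "k < N" for k
    proof (cases "c k = 0")
      case False
      have "c k * cnj (c k) = complex_of_real (cmod (c k)) * complex_of_real (cmod (c k))"
        by (simp add: complex_norm_square[symmetric] power2_eq_square flip: of_real_mult)
      then show ?thesis
        using that False by (simp add: z_def field_simps)
    qed simp
    then have "(\<Sum>k<N. c k * z k) = - a * complex_of_real (1 / S) * complex_of_real S"
      by (simp add: S_def sum_distrib_left)
    also have "\<dots> = - a"
      using Spos by simp
    finally show ?thesis
      by (subst evaluate_affine_series[of N]) (auto simp: z_def)
  qed
  ultimately show False
    using nz[OF N] by blast
qed

subsection \<open>Polynomials\<close>

type_synonym polynomial = "multiindex \<Rightarrow>\<^sub>0 complex"

definition total_degree :: "multiindex \<Rightarrow> nat"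
  where "total_degree \<alpha> = (\<Sum>j\<in>Poly_Mapping.keys \<alpha>. Poly_Mapping.lookup \<alpha> j)"

lemma total_degree_superset:
  assumes "finite K" "Poly_Mapping.keys \<alpha> \<subseteq> K"
  shows "total_degree \<alpha> = (\<Sum>j\<in>K. Poly_Mapping.lookup \<alpha> j)"
  unfolding total_degree_def using assms
  by (intro sum.mono_neutral_left) (auto simp: not_in_keys_iff_lookup_eq_zero)

lemma total_degree_add: "total_degree (\<alpha> + \<beta>) = total_degree \<alpha> + total_degree \<beta>"
proof -
  let ?K = "Poly_Mapping.keys \<alpha> \<union> Poly_Mapping.keys \<beta>"
  show ?thesis
    using keys_add[of \<alpha> \<beta>]
    by (simp add: total_degree_superset[of ?K "\<alpha> + \<beta>"] total_degree_superset[of ?K \<alpha>]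
        total_degree_superset[of ?K \<beta>] lookup_add sum.distrib)
qed

lemma total_degree_0 [simp]: "total_degree 0 = 0"
  by (simp add: total_degree_def)

lemma total_degree_single: "total_degree (Poly_Mapping.single j k) = k"
  by (subst total_degree_superset[of "{j}"]) auto

lemma monomial_add: "monomial z (\<alpha> + \<beta>) = monomial z \<alpha> * monomial z \<beta>"
proof -
  let ?K = "Poly_Mapping.keys \<alpha> \<union> Poly_Mapping.keys \<beta>"
  show ?thesis
    using keys_add[of \<alpha> \<beta>]
    by (simp add: monomial_superset[of ?K "\<alpha> + \<beta>"] monomial_superset[of ?K \<alpha>]
        monomial_superset[of ?K \<beta>] lookup_add power_add prod.distrib)
qed

section \<open>The coefficient norm of polynomials and convolution estimates\<close>

definition coeff_norm :: "polynomial \<Rightarrow> real"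
  where "coeff_norm q = (\<Sum>\<alpha>\<in>Poly_Mapping.keys q. cmod (Poly_Mapping.lookup q \<alpha>))"

lemma coeff_norm_superset:
  assumes "finite K" "Poly_Mapping.keys q \<subseteq> K"
  shows "coeff_norm q = (\<Sum>\<alpha>\<in>K. cmod (Poly_Mapping.lookup q \<alpha>))"
  unfolding coeff_norm_def using assms
  by (intro sum.mono_neutral_left) (auto simp: not_in_keys_iff_lookup_eq_zero)

lemma coeff_norm_nonneg: "0 \<le> coeff_norm q"
  by (simp add: coeff_norm_def sum_nonneg)

lemma coeff_norm_add: "coeff_norm (p + q) \<le> coeff_norm p + coeff_norm q"
proof -
  let ?K = "Poly_Mapping.keys p \<union> Poly_Mapping.keys q"
  have "coeff_norm (p + q) \<le> (\<Sum>\<alpha>\<in>?K. cmod (Poly_Mapping.lookup p \<alpha>) + cmod (Poly_Mapping.lookup q \<alpha>))"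
    using keys_add[of p q]
    by (subst coeff_norm_superset[of ?K]) (auto simp: lookup_add intro!: sum_mono norm_triangle_ineq)
  then show ?thesis
    by (simp add: coeff_norm_superset[of ?K p] coeff_norm_superset[of ?K q] sum.distrib)
qed

lemma coeff_norm_0 [simp]: "coeff_norm 0 = 0"
  by (simp add: coeff_norm_def)

lemma coeff_norm_minus [simp]: "coeff_norm (- q) = coeff_norm q"
  by (simp add: coeff_norm_def in_keys_iff keys.rep_eq)

lemma coeff_norm_single [simp]: "coeff_norm (Poly_Mapping.single \<alpha> c) = cmod c"
  by (subst coeff_norm_superset[of "{\<alpha>}"]) auto

lemma coeff_norm_1 [simp]: "coeff_norm 1 = 1"
  unfolding single_one[symmetric] coeff_norm_single by simp

lemma coeff_norm_sum: "coeff_norm (\<Sum>i\<in>I. q i) \<le> (\<Sum>i\<in>I. coeff_norm (q i))"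
  by (induction I rule: infinite_finite_induct) (auto intro: order_trans[OF coeff_norm_add])

lemma sum_norm_lookup_le_coeff_norm:
  assumes "finite F"
  shows "(\<Sum>\<alpha>\<in>F. cmod (Poly_Mapping.lookup q \<alpha>)) \<le> coeff_norm q"
proof -
  have "coeff_norm q = (\<Sum>\<alpha>\<in>Poly_Mapping.keys q \<union> F. cmod (Poly_Mapping.lookup q \<alpha>))"
    using assms by (intro coeff_norm_superset) auto
  then show ?thesis
    using assms by (auto intro: sum_mono2)
qed

lemma norm_lookup_le_coeff_norm: "cmod (Poly_Mapping.lookup q \<alpha>) \<le> coeff_norm q"
  using sum_norm_lookup_le_coeff_norm[of "{\<alpha>}"] by simp

lemma polynomial_decompose:
  "q = (\<Sum>\<alpha>\<in>Poly_Mapping.keys q. Poly_Mapping.single \<alpha> (Poly_Mapping.lookup q \<alpha>))"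
  for q :: polynomial
proof (rule poly_mapping_eqI)
  fix \<gamma>
  have "(\<Sum>\<alpha>\<in>Poly_Mapping.keys q. Poly_Mapping.lookup (Poly_Mapping.single \<alpha> (Poly_Mapping.lookup q \<alpha>)) \<gamma>)
      = (\<Sum>\<alpha>\<in>Poly_Mapping.keys q. if \<alpha> = \<gamma> then Poly_Mapping.lookup q \<alpha> else 0)"
    by (intro sum.cong) (auto simp: lookup_single)
  also have "\<dots> = Poly_Mapping.lookup q \<gamma>"
    by (simp add: in_keys_iff)
  finally show "Poly_Mapping.lookup q \<gamma> = Poly_Mapping.lookup
      (\<Sum>\<alpha>\<in>Poly_Mapping.keys q. Poly_Mapping.single \<alpha> (Poly_Mapping.lookup q \<alpha>)) \<gamma>"
    by (simp add: lookup_sum)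
qed

lemma times_decompose:
  "p * q = (\<Sum>\<alpha>\<in>Poly_Mapping.keys p. \<Sum>\<beta>\<in>Poly_Mapping.keys q.
    Poly_Mapping.single (\<alpha> + \<beta>) (Poly_Mapping.lookup p \<alpha> * Poly_Mapping.lookup q \<beta>))"
  for p q :: polynomial
proof -
  have "p * q = (\<Sum>\<alpha>\<in>Poly_Mapping.keys p. Poly_Mapping.single \<alpha> (Poly_Mapping.lookup p \<alpha>)) *
      (\<Sum>\<beta>\<in>Poly_Mapping.keys q. Poly_Mapping.single \<beta> (Poly_Mapping.lookup q \<beta>))"
    by (simp only: polynomial_decompose[symmetric])
  then show ?thesis
    by (simp add: sum_product mult_single)
qed

lemma lookup_times:
  "Poly_Mapping.lookup (p * q) \<gamma> = (\<Sum>\<alpha>\<in>Poly_Mapping.keys p. \<Sum>\<beta>\<in>Poly_Mapping.keys q.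
    if \<alpha> + \<beta> = \<gamma> then Poly_Mapping.lookup p \<alpha> * Poly_Mapping.lookup q \<beta> else 0)"
  for p q :: polynomial
  by (subst times_decompose) (simp add: lookup_sum lookup_single when_def)

lemma coeff_norm_times: "coeff_norm (p * q) \<le> coeff_norm p * coeff_norm q"
proof -
  have "coeff_norm (p * q) \<le> (\<Sum>\<alpha>\<in>Poly_Mapping.keys p. \<Sum>\<beta>\<in>Poly_Mapping.keys q.
      cmod (Poly_Mapping.lookup p \<alpha>) * cmod (Poly_Mapping.lookup q \<beta>))"
    by (subst times_decompose)
      (auto intro!: order_trans[OF coeff_norm_sum] sum_mono simp: norm_mult)
  then show ?thesis
    by (simp add: coeff_norm_def sum_product)
qed

lemma coeff_norm_power: "coeff_norm (p ^ k) \<le> coeff_norm p ^ k"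
proof (induction k)
  case (Suc k)
  then show ?case
    using coeff_norm_times[of p "p ^ k"] mult_left_mono[OF Suc coeff_norm_nonneg[of p]] by simp
qed simp

text \<open>By cancellation at most one \<alpha> satisfies \<alpha> + \<beta> = \<gamma>, so the
  inner sum of a convolution has at most one nonzero term.\<close>

lemma sum_shifted_le:
  fixes F :: "multiindex \<Rightarrow> real"
  assumes "finite K" "\<And>\<alpha>. F \<alpha> \<le> B" "0 \<le> B"
  shows "(\<Sum>\<alpha>\<in>K. if \<alpha> + \<beta> = \<gamma> then F \<alpha> else 0) \<le> B"
proof (cases "\<exists>\<alpha>\<in>K. \<alpha> + \<beta> = \<gamma>")
  case True
  then obtain \<alpha> where \<alpha>: "\<alpha> \<in> K" "\<alpha> + \<beta> = \<gamma>" by blast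
  then have "(\<Sum>\<alpha>'\<in>K. if \<alpha>' + \<beta> = \<gamma> then F \<alpha>' else 0) = (\<Sum>\<alpha>'\<in>K. if \<alpha>' = \<alpha> then F \<alpha>' else 0)"
    by (intro sum.cong) auto
  then show ?thesis
    using \<alpha> assms by simp
next
  case False
  then have "(\<Sum>\<alpha>\<in>K. if \<alpha> + \<beta> = \<gamma> then F \<alpha> else 0) = 0"
    by (intro sum.neutral) auto
  then show ?thesis
    using assms by simp
qed

text \<open>Leibniz rule: the degree is additive along \<alpha> + \<beta> = \<gamma>, which splits
  the weighted convolution into two sums. In each of them the factor carrying the degree is bounded
  by its supremum and the other one is summed.\<close>

lemma degree_weighted_times_bound:
  assumes A: "\<And>\<alpha>. real (total_degree \<alpha>) * cmod (Poly_Mapping.lookup p \<alpha>) \<le> A"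
    and B: "\<And>\<alpha>. real (total_degree \<alpha>) * cmod (Poly_Mapping.lookup q \<alpha>) \<le> B"
  shows "real (total_degree \<gamma>) * cmod (Poly_Mapping.lookup (p * q) \<gamma>) \<le> A * coeff_norm q + coeff_norm p * B"
proof -
  let ?p = "\<lambda>\<alpha>. cmod (Poly_Mapping.lookup p \<alpha>)" and ?q = "\<lambda>\<beta>. cmod (Poly_Mapping.lookup q \<beta>)"
  let ?d = "\<lambda>\<alpha>. real (total_degree \<alpha>)"
  have A0: "0 \<le> A" and B0: "0 \<le> B"
    using A[of 0] B[of 0] by auto
  have "cmod (Poly_Mapping.lookup (p * q) \<gamma>) \<le> (\<Sum>\<alpha>\<in>Poly_Mapping.keys p. \<Sum>\<beta>\<in>Poly_Mapping.keys q.
      if \<alpha> + \<beta> = \<gamma> then ?p \<alpha> * ?q \<beta> else 0)"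
    unfolding lookup_times
    by (intro order_trans[OF norm_sum] sum_mono) (auto simp: norm_mult intro!: sum_mono order_trans[OF norm_sum])
  then have "?d \<gamma> * cmod (Poly_Mapping.lookup (p * q) \<gamma>) \<le> ?d \<gamma> *
      (\<Sum>\<alpha>\<in>Poly_Mapping.keys p. \<Sum>\<beta>\<in>Poly_Mapping.keys q. if \<alpha> + \<beta> = \<gamma> then ?p \<alpha> * ?q \<beta> else 0)"
    by (intro mult_left_mono) auto
  also have "\<dots> = (\<Sum>\<alpha>\<in>Poly_Mapping.keys p. \<Sum>\<beta>\<in>Poly_Mapping.keys q.
      (if \<alpha> + \<beta> = \<gamma> then ?d \<alpha> * ?p \<alpha> else 0) * ?q \<beta> + (if \<beta> + \<alpha> = \<gamma> then ?d \<beta> * ?q \<beta> else 0) * ?p \<alpha>)"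
    unfolding sum_distrib_left
    by (intro sum.cong refl) (auto simp: total_degree_add distrib_right add.commute)
  also have "\<dots> = (\<Sum>\<beta>\<in>Poly_Mapping.keys q. (\<Sum>\<alpha>\<in>Poly_Mapping.keys p. if \<alpha> + \<beta> = \<gamma> then ?d \<alpha> * ?p \<alpha> else 0) * ?q \<beta>)
      + (\<Sum>\<alpha>\<in>Poly_Mapping.keys p. (\<Sum>\<beta>\<in>Poly_Mapping.keys q. if \<beta> + \<alpha> = \<gamma> then ?d \<beta> * ?q \<beta> else 0) * ?p \<alpha>)"
    unfolding sum.distrib sum_distrib_right by (subst sum.swap) (rule refl)
  also have "\<dots> \<le> (\<Sum>\<beta>\<in>Poly_Mapping.keys q. A * ?q \<beta>) + (\<Sum>\<alpha>\<in>Poly_Mapping.keys p. B * ?p \<alpha>)"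
    using A B A0 B0 by (intro add_mono sum_mono mult_right_mono sum_shifted_le) auto
  finally show ?thesis
    by (simp add: coeff_norm_def sum_distrib_left mult.commute)
qed

text \<open>Convolution of an \<open>\<ell>\<^sup>1\<close> family with a bounded one. It preserves
  smallness of coefficients under multiplication by polynomials of bounded coefficient norm.\<close>

lemma lookup_times_bound:
  assumes "\<And>\<alpha>. cmod (Poly_Mapping.lookup q \<alpha>) \<le> B"
  shows "cmod (Poly_Mapping.lookup (p * q) \<gamma>) \<le> coeff_norm p * B"
proof -
  let ?p = "\<lambda>\<alpha>. cmod (Poly_Mapping.lookup p \<alpha>)" and ?q = "\<lambda>\<beta>. cmod (Poly_Mapping.lookup q \<beta>)"
  have B0: "0 \<le> B"
    using assms[of 0] norm_ge_zero order_trans by blast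
  have "cmod (Poly_Mapping.lookup (p * q) \<gamma>) \<le> (\<Sum>\<alpha>\<in>Poly_Mapping.keys p. \<Sum>\<beta>\<in>Poly_Mapping.keys q.
      if \<alpha> + \<beta> = \<gamma> then ?p \<alpha> * ?q \<beta> else 0)"
    unfolding lookup_times
    by (intro order_trans[OF norm_sum] sum_mono) (auto simp: norm_mult intro!: sum_mono order_trans[OF norm_sum])
  also have "\<dots> = (\<Sum>\<alpha>\<in>Poly_Mapping.keys p. (\<Sum>\<beta>\<in>Poly_Mapping.keys q. if \<beta> + \<alpha> = \<gamma> then ?q \<beta> else 0) * ?p \<alpha>)"
    unfolding sum_distrib_right by (intro sum.cong refl) (auto simp: add.commute)
  also have "\<dots> \<le> (\<Sum>\<alpha>\<in>Poly_Mapping.keys p. B * ?p \<alpha>)"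
    using assms B0 by (intro sum_mono mult_right_mono sum_shifted_le) auto
  finally show ?thesis
    by (simp add: coeff_norm_def sum_distrib_left mult.commute)
qed

lemma evaluate_polynomial:
  assumes "finite K" "Poly_Mapping.keys q \<subseteq> K"
  shows "evaluate (Poly_Mapping.lookup q) z = (\<Sum>\<alpha>\<in>K. Poly_Mapping.lookup q \<alpha> * monomial z \<alpha>)"
proof -
  have "evaluate (Poly_Mapping.lookup q) z = (\<Sum>\<^sub>\<infinity>\<alpha>\<in>K. Poly_Mapping.lookup q \<alpha> * monomial z \<alpha>)"
    unfolding evaluate_def using assms(2)
    by (intro infsum_cong_neutral) (auto simp: in_keys_iff)
  then show ?thesis
    using assms(1) by simp
qed

lemma evaluate_add:
  "evaluate (Poly_Mapping.lookup (p + q)) z = evaluate (Poly_Mapping.lookup p) z + evaluate (Poly_Mapping.lookup q) z"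
proof -
  let ?K = "Poly_Mapping.keys p \<union> Poly_Mapping.keys q"
  show ?thesis
    using keys_add[of p q]
    by (simp add: evaluate_polynomial[of ?K] lookup_add distrib_right sum.distrib)
qed

lemma evaluate_0 [simp]: "evaluate (\<lambda>\<alpha>. 0) z = 0"
  by (simp add: evaluate_def)

lemma evaluate_sum:
  "evaluate (Poly_Mapping.lookup (\<Sum>i\<in>I. q i)) z = (\<Sum>i\<in>I. evaluate (Poly_Mapping.lookup (q i)) z)"
  by (induction I rule: infinite_finite_induct) (auto simp: evaluate_add)

lemma evaluate_single:
  "evaluate (Poly_Mapping.lookup (Poly_Mapping.single \<alpha> c)) z = c * monomial z \<alpha>"
  by (simp add: evaluate_polynomial[of "{\<alpha>}"])

lemma evaluate_times:
  "evaluate (Poly_Mapping.lookup (p * q)) z = evaluate (Poly_Mapping.lookup p) z * evaluate (Poly_Mapping.lookup q) z"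
proof -
  have "evaluate (Poly_Mapping.lookup (p * q)) z = (\<Sum>\<alpha>\<in>Poly_Mapping.keys p. \<Sum>\<beta>\<in>Poly_Mapping.keys q.
      (Poly_Mapping.lookup p \<alpha> * monomial z \<alpha>) * (Poly_Mapping.lookup q \<beta> * monomial z \<beta>))"
    by (subst times_decompose) (simp add: evaluate_sum evaluate_single monomial_add ac_simps)
  then show ?thesis
    by (simp add: evaluate_polynomial[OF finite_keys subset_refl] sum_product)
qed

lemma evaluate_prod:
  "evaluate (Poly_Mapping.lookup (\<Prod>i\<in>I. q i)) z = (\<Prod>i\<in>I. evaluate (Poly_Mapping.lookup (q i)) z)"
proof -
  have "evaluate (Poly_Mapping.lookup 1) z = 1"
    unfolding single_one[symmetric] evaluate_single by (simp add: monomial_def)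
  then show ?thesis
    by (induction I rule: infinite_finite_induct) (auto simp: evaluate_times)
qed

text \<open>Transfers identities in the ring of polynomials to \<open>poly_mult\<close>, which is
  defined through dilations.\<close>

lemma poly_mult_lookup: "poly_mult q (Poly_Mapping.lookup p) = Poly_Mapping.lookup (q * p)"
proof
  fix \<gamma>
  have "dilation \<beta> (Poly_Mapping.lookup p) \<gamma> =
      (\<Sum>\<alpha>\<in>Poly_Mapping.keys p. if \<beta> + \<alpha> = \<gamma> then Poly_Mapping.lookup p \<alpha> else 0)" for \<beta>
  proof (cases "\<exists>\<alpha>. \<gamma> = \<alpha> + \<beta>")
    case True
    then obtain \<alpha> where \<alpha>: "\<gamma> = \<alpha> + \<beta>" by blast
    then have "(\<Sum>\<alpha>'\<in>Poly_Mapping.keys p. if \<beta> + \<alpha>' = \<gamma> then Poly_Mapping.lookup p \<alpha>' else 0)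
        = (\<Sum>\<alpha>'\<in>Poly_Mapping.keys p. if \<alpha>' = \<alpha> then Poly_Mapping.lookup p \<alpha>' else 0)"
      by (intro sum.cong) (auto simp: add.commute)
    then show ?thesis
      using \<alpha> by (auto simp: dilation_def in_keys_iff)
  next
    case False
    then have "(\<Sum>\<alpha>\<in>Poly_Mapping.keys p. if \<beta> + \<alpha> = \<gamma> then Poly_Mapping.lookup p \<alpha> else 0) = 0"
      by (intro sum.neutral) (auto simp: add.commute)
    then show ?thesis
      using False by (simp add: dilation_def)
  qed
  then show "poly_mult q (Poly_Mapping.lookup p) \<gamma> = Poly_Mapping.lookup (q * p) \<gamma>"
    unfolding poly_mult_def lookup_times by (auto simp: sum_distrib_left intro!: sum.cong)
qed

section \<open>Homogeneous parts, products of perturbations of 1, and Cesaro means\<close>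

definition homogeneous :: "nat \<Rightarrow> polynomial \<Rightarrow> bool"
  where "homogeneous k q \<longleftrightarrow> (\<forall>\<alpha>\<in>Poly_Mapping.keys q. total_degree \<alpha> = k)"

lemma homogeneous_times:
  assumes "homogeneous k p" "homogeneous l q"
  shows "homogeneous (k + l) (p * q)"
  unfolding homogeneous_def
proof
  fix \<gamma>
  assume "\<gamma> \<in> Poly_Mapping.keys (p * q)"
  then obtain \<alpha> \<beta> where "\<gamma> = \<alpha> + \<beta>" "\<alpha> \<in> Poly_Mapping.keys p" "\<beta> \<in> Poly_Mapping.keys q"
    using keys_mult[of p q] by blast
  then show "total_degree \<gamma> = k + l"
    using assms by (simp add: homogeneous_def total_degree_add)
qed

lemma homogeneous_add: "homogeneous k p \<Longrightarrow> homogeneous k q \<Longrightarrow> homogeneous k (p + q)"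
  using keys_add[of p q] by (auto simp: homogeneous_def)

lemma homogeneous_minus: "homogeneous k q \<Longrightarrow> homogeneous k (- q)"
  by (simp add: homogeneous_def in_keys_iff)

lemma homogeneous_sum: "(\<And>i. i \<in> I \<Longrightarrow> homogeneous k (q i)) \<Longrightarrow> homogeneous k (\<Sum>i\<in>I. q i)"
  by (induction I rule: infinite_finite_induct) (auto simp: homogeneous_add, auto simp: homogeneous_def)

lemma homogeneous_single: "total_degree \<alpha> = k \<Longrightarrow> homogeneous k (Poly_Mapping.single \<alpha> c)"
  by (simp add: homogeneous_def)

lemma homogeneous_power: "homogeneous 1 p \<Longrightarrow> homogeneous k (p ^ k)"
proof (induction k)
  case 0
  show ?case
    unfolding power_0 single_one[symmetric] by (rule homogeneous_single) simp
next
  case (Suc k)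
  then show ?case
    using homogeneous_times[of 1 p k "p ^ k"] by simp
qed

text \<open>Summands of different degree have disjoint supports, so a coefficient of the sum comes
  from a single \<open>h k\<close> and is at most b rather than n b. All degrees lie between 1 and
  n, hence weighting by the degree costs at most a factor n.\<close>

lemma homogeneous_sum_bounds:
  assumes hom: "\<And>k. k < n \<Longrightarrow> homogeneous (Suc k) (h k)"
    and le: "\<And>k. k < n \<Longrightarrow> coeff_norm (h k) \<le> b" and b: "0 \<le> b"
  shows "coeff_norm (\<Sum>k<n. h k) \<le> real n * b"
    and "cmod (Poly_Mapping.lookup (\<Sum>k<n. h k) \<gamma>) \<le> b"
    and "real (total_degree \<gamma>) * cmod (Poly_Mapping.lookup (\<Sum>k<n. h k) \<gamma>) \<le> real n * b"
proof -
  have "(\<Sum>k<n. coeff_norm (h k)) \<le> (\<Sum>k<n. b)"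
    using le by (intro sum_mono) auto
  then show "coeff_norm (\<Sum>k<n. h k) \<le> real n * b"
    using coeff_norm_sum[of h "{..<n}"] by simp
  have zero: "Poly_Mapping.lookup (h k) \<gamma> = 0" if "k < n" "total_degree \<gamma> \<noteq> Suc k" for k
    using hom[OF that(1)] that(2) by (auto simp: homogeneous_def in_keys_iff)
  consider "total_degree \<gamma> = 0 \<or> n < total_degree \<gamma>" | l where "l < n" "total_degree \<gamma> = Suc l"
  proof (cases "total_degree \<gamma>")
    case (Suc l)
    then show ?thesis
      using that by (cases "l < n") auto
  qed (use that in simp)
  then have "cmod (Poly_Mapping.lookup (\<Sum>k<n. h k) \<gamma>) \<le> b \<and>
      real (total_degree \<gamma>) * cmod (Poly_Mapping.lookup (\<Sum>k<n. h k) \<gamma>) \<le> real n * b"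
  proof cases
    case 1
    then have "Poly_Mapping.lookup (\<Sum>k<n. h k) \<gamma> = 0"
      unfolding lookup_sum using zero by (intro sum.neutral) auto
    then show ?thesis
      using b by simp
  next
    case (2 l)
    have "Poly_Mapping.lookup (\<Sum>k<n. h k) \<gamma> = (\<Sum>k<n. if k = l then Poly_Mapping.lookup (h k) \<gamma> else 0)"
      unfolding lookup_sum using zero 2 by (intro sum.cong) auto
    then have "cmod (Poly_Mapping.lookup (\<Sum>k<n. h k) \<gamma>) \<le> b"
      using 2(1) order_trans[OF norm_lookup_le_coeff_norm le[OF 2(1)]] by simp
    then show ?thesis
      using 2 b by (auto intro!: mult_mono)
  qed
  then show "cmod (Poly_Mapping.lookup (\<Sum>k<n. h k) \<gamma>) \<le> b"
    and "real (total_degree \<gamma>) * cmod (Poly_Mapping.lookup (\<Sum>k<n. h k) \<gamma>) \<le> real n * b"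
    by auto
qed

text \<open>Induction on the number of factors. The constant 1 has degree 0, so 1 + e obeys the same
  degree-weighted bound as e, and V (1 + e) - 1 = (V - 1) + V e separates the new deviation from the
  old one. The product on the right is carried along because it dominates the coefficient norm of
  V.\<close>

lemma prod_one_plus_bounds:
  fixes M :: nat
  assumes \<mu>: "\<And>j. j < M \<Longrightarrow> coeff_norm (e j) \<le> \<mu> j"
      "\<And>j \<gamma>. j < M \<Longrightarrow> real (total_degree \<gamma>) * cmod (Poly_Mapping.lookup (e j) \<gamma>) \<le> \<mu> j"
    and \<eta>: "\<And>j \<gamma>. j < M \<Longrightarrow> cmod (Poly_Mapping.lookup (e j) \<gamma>) \<le> \<eta> j"
  shows "coeff_norm (\<Prod>j<M. 1 + e j) \<le> (\<Prod>j<M. 1 + \<mu> j)"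
    and "real (total_degree \<gamma>) * cmod (Poly_Mapping.lookup (\<Prod>j<M. 1 + e j) \<gamma>)
      \<le> (\<Sum>j<M. \<mu> j) * (\<Prod>j<M. 1 + \<mu> j)"
    and "cmod (Poly_Mapping.lookup ((\<Prod>j<M. 1 + e j) - 1) \<gamma>) \<le> (\<Sum>j<M. \<eta> j) * (\<Prod>j<M. 1 + \<mu> j)"
proof -
  have "coeff_norm (\<Prod>j<K. 1 + e j) \<le> (\<Prod>j<K. 1 + \<mu> j) \<and>
    (\<forall>\<gamma>. real (total_degree \<gamma>) * cmod (Poly_Mapping.lookup (\<Prod>j<K. 1 + e j) \<gamma>)
      \<le> (\<Sum>j<K. \<mu> j) * (\<Prod>j<K. 1 + \<mu> j)) \<and>
    (\<forall>\<gamma>. cmod (Poly_Mapping.lookup ((\<Prod>j<K. 1 + e j) - 1) \<gamma>) \<le> (\<Sum>j<K. \<eta> j) * (\<Prod>j<K. 1 + \<mu> j))"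
    if "K \<le> M" for K
    using that
  proof (induction K)
    case 0
    show ?case
      by (auto simp: lookup_one when_def)
  next
    case (Suc K)
    define V where "V = (\<Prod>j<K. 1 + e j)"
    define Q where "Q = (\<Prod>j<K. 1 + \<mu> j)"
    define S where "S = (\<Sum>j<K. \<mu> j)"
    define H where "H = (\<Sum>j<K. \<eta> j)"
    have IH: "coeff_norm V \<le> Q"
        "\<And>\<gamma>. real (total_degree \<gamma>) * cmod (Poly_Mapping.lookup V \<gamma>) \<le> S * Q"
        "\<And>\<gamma>. cmod (Poly_Mapping.lookup (V - 1) \<gamma>) \<le> H * Q"
      using Suc.IH Suc.prems by (auto simp: V_def Q_def S_def H_def)
    have m: "coeff_norm (e K) \<le> \<mu> K"
        "\<And>\<gamma>. real (total_degree \<gamma>) * cmod (Poly_Mapping.lookup (e K) \<gamma>) \<le> \<mu> K"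
        "\<And>\<gamma>. cmod (Poly_Mapping.lookup (e K) \<gamma>) \<le> \<eta> K"
      using Suc.prems assms by auto
    have m0: "0 \<le> \<mu> K" "0 \<le> \<eta> K" "0 \<le> Q"
      using m(1) coeff_norm_nonneg[of "e K"] m(3)[of 0] norm_ge_zero[of "Poly_Mapping.lookup (e K) 0"]
        IH(1) coeff_norm_nonneg[of V] by linarith+
    have S0: "0 \<le> S * Q" "0 \<le> H * Q"
      using IH(2)[of 0] order_trans[OF norm_ge_zero IH(3)] by auto
    have e1: "coeff_norm (1 + e K) \<le> 1 + \<mu> K"
      using coeff_norm_add[of 1 "e K"] m by simp
    have one: "real (total_degree \<gamma>) * cmod (Poly_Mapping.lookup (1 + e K) \<gamma>) \<le> \<mu> K" for \<gamma>
      using m(2)[of \<gamma>] m0 by (cases "\<gamma> = 0") (auto simp: lookup_add lookup_one)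
    have 1: "coeff_norm (V * (1 + e K)) \<le> Q * (1 + \<mu> K)"
      using IH(1) e1 m0 by (intro order_trans[OF coeff_norm_times] mult_mono) (auto simp: coeff_norm_nonneg)
    have 2: "real (total_degree \<gamma>) * cmod (Poly_Mapping.lookup (V * (1 + e K)) \<gamma>) \<le> (S + \<mu> K) * (Q * (1 + \<mu> K))"
      for \<gamma>
    proof -
      have "real (total_degree \<gamma>) * cmod (Poly_Mapping.lookup (V * (1 + e K)) \<gamma>)
          \<le> S * Q * coeff_norm (1 + e K) + coeff_norm V * \<mu> K"
        by (rule degree_weighted_times_bound[OF IH(2) one])
      also have "\<dots> \<le> S * Q * (1 + \<mu> K) + Q * \<mu> K"
        using S0 e1 IH(1) m0 by (intro add_mono mult_left_mono mult_right_mono) auto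
      \<comment> \<open>The extra factor on the second term restores the shape of the induction
        hypothesis.\<close>
      also have "\<dots> \<le> S * Q * (1 + \<mu> K) + Q * \<mu> K * (1 + \<mu> K)"
        using m0 by (simp add: algebra_simps)
      finally show ?thesis
        by (simp add: algebra_simps)
    qed
    have 3: "cmod (Poly_Mapping.lookup (V * (1 + e K) - 1) \<gamma>) \<le> (H + \<eta> K) * (Q * (1 + \<mu> K))" for \<gamma>
    proof -
      have "V * (1 + e K) - 1 = (V - 1) + V * e K"
        by (simp add: algebra_simps)
      then have "cmod (Poly_Mapping.lookup (V * (1 + e K) - 1) \<gamma>)
          \<le> cmod (Poly_Mapping.lookup (V - 1) \<gamma>) + cmod (Poly_Mapping.lookup (V * e K) \<gamma>)"
        by (simp only: lookup_add norm_triangle_ineq)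
      also have "\<dots> \<le> H * Q + coeff_norm V * \<eta> K"
        by (intro add_mono IH lookup_times_bound m)
      also have "\<dots> \<le> H * Q + Q * \<eta> K"
        using IH(1) m0 by (intro add_mono mult_right_mono) auto
      also have "\<dots> = (H + \<eta> K) * Q"
        by (simp add: algebra_simps)
      also have "\<dots> \<le> (H + \<eta> K) * Q * (1 + \<mu> K)"
        using S0 m0 by (simp add: distrib_right distrib_left)
      finally show ?thesis
        by (simp add: mult.assoc)
    qed
    show ?case
      using 1 2 3 by (simp add: V_def Q_def S_def H_def)
  qed
  from this[OF order_refl] show "coeff_norm (\<Prod>j<M. 1 + e j) \<le> (\<Prod>j<M. 1 + \<mu> j)"
    and "real (total_degree \<gamma>) * cmod (Poly_Mapping.lookup (\<Prod>j<M. 1 + e j) \<gamma>)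
      \<le> (\<Sum>j<M. \<mu> j) * (\<Prod>j<M. 1 + \<mu> j)"
    and "cmod (Poly_Mapping.lookup ((\<Prod>j<M. 1 + e j) - 1) \<gamma>) \<le> (\<Sum>j<M. \<eta> j) * (\<Prod>j<M. 1 + \<mu> j)"
    by auto
qed

text \<open>Abel summation with free coefficients \<open>B\<close>. The term \<open>D\<close> lets a
  multiplier built from one truncation of a linear form be applied to a longer one.\<close>

lemma geometric_telescope:
  fixes B :: "nat \<Rightarrow> 'a :: comm_ring_1"
  shows "(\<Sum>k<n. B k * X ^ k) * (1 - X + D) = B 0 - B n * X ^ n +
    (\<Sum>k<n. (B (Suc k) - B k) * X ^ Suc k + B k * X ^ k * D)"
  by (induction n) (simp_all add: algebra_simps)

text \<open>
  \<open>cesaro_inverse n l\<close> is a Cesaro mean of the geometric series of \<open>1 / (1 + l)\<close>.  Its product with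
  \<open>1 + l\<close> differs from 1 by \<open>-1/n\<close> times the sum of the \<open>(-l)^k\<close>, \<open>1 \<le> k \<le> n\<close>; the homogeneous parts
  are therefore of size \<open>1/n\<close>, whereas their total size stays bounded.
\<close>

definition cesaro_inverse :: "nat \<Rightarrow> polynomial \<Rightarrow> polynomial"
  where "cesaro_inverse n l =
    (\<Sum>k<n. Poly_Mapping.single 0 (complex_of_real (1 - real k / real n)) * (- l) ^ k)"

text \<open>Here \<open>D\<close> is the part of the linear form that the truncation
  \<open>l\<close> omits. In each degree 1, ..., n the error has norm at most m / n + \<delta>, and
  \<open>homogeneous_sum_bounds\<close> applies; so the omitted part costs n \<delta> in total. The
  hypothesis m \<le> 1 bounds all powers of \<open>l\<close> uniformly.\<close>

lemma cesaro_inverse_bounds: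
  assumes n: "0 < n" and hom: "homogeneous 1 l" "homogeneous 1 D"
    and l: "coeff_norm l \<le> m" "m \<le> 1" and D: "coeff_norm D \<le> \<delta>"
  defines "e \<equiv> cesaro_inverse n l * (1 + l + D) - 1"
  shows "coeff_norm e \<le> m + real n * \<delta>"
    and "cmod (Poly_Mapping.lookup e \<gamma>) \<le> m / real n + \<delta>"
    and "real (total_degree \<gamma>) * cmod (Poly_Mapping.lookup e \<gamma>) \<le> m + real n * \<delta>"
proof -
  let ?C = "\<lambda>c. Poly_Mapping.single 0 (complex_of_real c) :: polynomial"
  define B where "B = (\<lambda>k. ?C (1 - real k / real n))"
  define h where "h = (\<lambda>k. (B (Suc k) - B k) * (- l) ^ Suc k + B k * (- l) ^ k * D)"
  define b where "b = m / real n + \<delta>"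
  have m0: "0 \<le> m" "0 \<le> \<delta>"
    using l D coeff_norm_nonneg order_trans by blast+
  \<comment> \<open>The Cesaro weights fall by 1 / n at each step. As \<open>B 0 = 1\<close> and
    \<open>B n = 0\<close>, the boundary terms of the telescoping sum are 1 and 0.\<close>
  have diff: "B (Suc k) - B k = ?C (- 1 / real n)" for k
    using n by (simp add: B_def field_simps flip: single_diff of_real_diff)
  have "B 0 = 1" "B n = 0"
    using n by (simp_all add: B_def)
  then have e: "e = (\<Sum>k<n. h k)"
    using geometric_telescope[where n = n and B = B and X = "- l" and D = D] n
    by (simp add: e_def cesaro_inverse_def B_def h_def)
  have pow: "coeff_norm ((- l) ^ k) \<le> 1" "coeff_norm ((- l) ^ Suc k) \<le> m" for k
  proof -
    have k: "coeff_norm ((- l) ^ k) \<le> m ^ k" for k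
      using coeff_norm_power[of "- l" k] power_mono[OF l(1) coeff_norm_nonneg, of k] by simp
    show "coeff_norm ((- l) ^ k) \<le> 1"
      using order_trans[OF k power_le_one] m0 l by blast
    show "coeff_norm ((- l) ^ Suc k) \<le> m"
    proof (rule order_trans[OF k])
      show "m ^ Suc k \<le> m"
        using power_le_one[of m k] m0 l by (simp add: mult_left_le)
    qed
  qed
  have hk: "coeff_norm (h k) \<le> b" if "k < n" for k
  proof -
    have "coeff_norm ((B (Suc k) - B k) * (- l) ^ Suc k) \<le> 1 / real n * m"
      unfolding diff using pow(2)[of k]
      by (intro order_trans[OF coeff_norm_times] mult_mono) (auto simp: coeff_norm_nonneg norm_divide simp del: power_Suc)
    moreover have "coeff_norm (B k * (- l) ^ k * D) \<le> 1 * 1 * \<delta>"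
    proof (intro order_trans[OF coeff_norm_times] mult_mono D)
      have "cmod (complex_of_real (1 - real k / real n)) \<le> 1"
        using that unfolding norm_of_real by (simp add: abs_le_iff divide_le_eq)
      then show "coeff_norm (B k) \<le> 1"
        unfolding B_def coeff_norm_single .
    qed (use pow in \<open>auto simp: coeff_norm_nonneg\<close>)
    ultimately show ?thesis
      using coeff_norm_add[of "(B (Suc k) - B k) * (- l) ^ Suc k" "B k * (- l) ^ k * D"]
      by (simp add: h_def b_def)
  qed
  have hom_h: "homogeneous (Suc k) (h k)" for k
  proof -
    have "homogeneous (0 + Suc k) (?C (- 1 / real n) * (- l) ^ Suc k)"
      by (intro homogeneous_times homogeneous_single homogeneous_power homogeneous_minus hom) simp
    moreover have "homogeneous (0 + k + 1) (B k * (- l) ^ k * D)"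
      unfolding B_def
      by (intro homogeneous_times homogeneous_single homogeneous_power homogeneous_minus hom) simp
    ultimately show ?thesis
      unfolding h_def diff by (intro homogeneous_add) auto
  qed
  have b: "0 \<le> b" "real n * b = m + real n * \<delta>"
    using m0 n by (auto simp: b_def distrib_left)
  note bounds = homogeneous_sum_bounds[where n = n and h = h and b = b, OF hom_h hk b(1),
      folded e, unfolded b(2)]
  show "coeff_norm e \<le> m + real n * \<delta>"
    by (rule bounds(1))
  show "cmod (Poly_Mapping.lookup e \<gamma>) \<le> m / real n + \<delta>"
    using bounds(2) by (simp add: b_def)
  show "real (total_degree \<gamma>) * cmod (Poly_Mapping.lookup e \<gamma>) \<le> m + real n * \<delta>"
    by (rule bounds(3))
qed

subsection \<open>Coefficients from values\<close>

text \<open>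
  Bohr's encoding of multiindices as positive integers.  At the points \<open>z j = (pr j)^-k\<close>, with
  \<open>pr\<close> the enumeration of the primes, the monomial of \<open>\<alpha>\<close> takes the value \<open>(bohr \<alpha>)^-k\<close>,
  so that for large \<open>k\<close> the coefficients with small code dominate.
\<close>

definition nth_prime :: "nat \<Rightarrow> nat"
  where "nth_prime = enumerate {p. prime p}"

definition bohr :: "multiindex \<Rightarrow> nat"
  where "bohr \<alpha> = (\<Prod>j\<in>Poly_Mapping.keys \<alpha>. nth_prime j ^ Poly_Mapping.lookup \<alpha> j)"

lemma prime_nth_prime: "prime (nth_prime j)"
  using enumerate_in_set[OF primes_infinite, of j] by (simp add: nth_prime_def)

lemma inj_nth_prime: "inj nth_prime"
  unfolding nth_prime_def using primes_infinite by (intro inj_enumerate)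

lemma multiplicity_bohr: "multiplicity (nth_prime j) (bohr \<alpha>) = Poly_Mapping.lookup \<alpha> j"
proof -
  let ?f = "\<lambda>p. Poly_Mapping.lookup \<alpha> (inv nth_prime p)"
  have "bohr \<alpha> = (\<Prod>p\<in>nth_prime ` Poly_Mapping.keys \<alpha>. p ^ ?f p)"
    unfolding bohr_def using inj_nth_prime
    by (subst prod.reindex) (auto intro: inj_on_subset)
  also have "multiplicity (nth_prime j) \<dots> = (if nth_prime j \<in> nth_prime ` Poly_Mapping.keys \<alpha> then ?f (nth_prime j) else 0)"
    by (rule multiplicity_prod_prime_powers) (auto simp: prime_nth_prime)
  also have "\<dots> = Poly_Mapping.lookup \<alpha> j"
    using inj_nth_prime by (auto simp: inj_image_mem_iff in_keys_iff)
  finally show ?thesis .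
qed

lemma inj_bohr: "inj bohr"
  by (rule injI, rule poly_mapping_eqI) (metis multiplicity_bohr)

lemma bohr_pos: "0 < bohr \<alpha>"
  unfolding bohr_def using prime_gt_0_nat[OF prime_nth_prime] by (intro prod_pos) auto

lemma monomial_le_1: "cmod (monomial z \<alpha>) \<le> 1" if "\<And>j. cmod (z j) \<le> 1"
  unfolding monomial_def prod_norm[symmetric] norm_power
  by (intro prod_le_1 conjI power_le_one zero_le_power norm_ge_zero that)

text \<open>Strong induction on the Bohr code n of \<gamma>. After multiplication by n^k the value
  at the k-th point isolates the coefficient of \<gamma>: those of smaller code tend to 0 by
  induction, those of larger code are damped by (n / (n + 1))^k, uniformly in m thanks to the
  \<open>\<ell>\<^sup>1\<close> bound.\<close>

lemma coefficients_tendsto_0: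
  fixes g :: "nat \<Rightarrow> family"
  assumes summable: "\<And>m. (\<lambda>\<alpha>. cmod (g m \<alpha>)) summable_on UNIV"
    and bound: "\<And>m. (\<Sum>\<^sub>\<infinity>\<alpha>. cmod (g m \<alpha>)) \<le> A"
    and lim: "\<And>N z. (\<And>j. j < N \<Longrightarrow> cmod (z j) < 1) \<Longrightarrow> (\<And>j. N \<le> j \<Longrightarrow> z j = 0) \<Longrightarrow>
      (\<lambda>m. evaluate (g m) z) \<longlonglongrightarrow> 0"
  shows "(\<lambda>m. g m \<gamma>) \<longlonglongrightarrow> 0"
proof (induction "bohr \<gamma>" arbitrary: \<gamma> rule: less_induct)
  case less
  define n where "n = bohr \<gamma>"
  have n: "0 < n"
    by (simp add: n_def bohr_pos)
  define L where "L = {\<alpha>. bohr \<alpha> < n}"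
  have finL: "finite L"
    using finite_vimageI[OF finite_lessThan inj_bohr, of n] by (simp add: L_def vimage_def)
  \<comment> \<open>The points have to be finitely supported, so only the variables below N are
    kept, enough of them to contain all variables of \<gamma>.\<close>
  define N where "N = Suc (Max (insert 0 (Poly_Mapping.keys \<gamma>)))"
  have N: "Poly_Mapping.keys \<gamma> \<subseteq> {..<N}"
    by (auto simp: N_def less_Suc_eq_le)
  define z where "z = (\<lambda>k j. if j < N then complex_of_real ((1 / real (nth_prime j)) ^ k) else 0)"
  have z1: "cmod (z k j) < 1" if "0 < k" for k j
  proof -
    have "1 < real (nth_prime j)"
      using prime_gt_1_nat[OF prime_nth_prime] by simp
    then have "(1 / real (nth_prime j)) ^ k < 1"
      using power_Suc_less_one[of "1 / real (nth_prime j)" "k - 1"] that by simp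
    then show ?thesis
      by (simp add: z_def norm_power norm_divide)
  qed
  have mono: "monomial (z k) \<alpha> = (if Poly_Mapping.keys \<alpha> \<subseteq> {..<N} then complex_of_real ((1 / real (bohr \<alpha>)) ^ k) else 0)"
    if "0 < k" for k \<alpha>
  proof (cases "Poly_Mapping.keys \<alpha> \<subseteq> {..<N}")
    case True
    then have "monomial (z k) \<alpha> = (\<Prod>j\<in>Poly_Mapping.keys \<alpha>.
        complex_of_real (((1 / real (nth_prime j)) ^ k) ^ Poly_Mapping.lookup \<alpha> j))"
      unfolding monomial_def by (intro prod.cong) (auto simp: z_def)
    also have "\<dots> = complex_of_real ((\<Prod>j\<in>Poly_Mapping.keys \<alpha>. (1 / real (nth_prime j)) ^ Poly_Mapping.lookup \<alpha> j) ^ k)"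
      by (simp add: prod_power_distrib power_mult[symmetric] mult.commute)
    also have "(\<Prod>j\<in>Poly_Mapping.keys \<alpha>. (1 / real (nth_prime j)) ^ Poly_Mapping.lookup \<alpha> j) = 1 / real (bohr \<alpha>)"
      by (simp add: bohr_def power_one_over prod_dividef)
    finally show ?thesis
      using True by simp
  next
    case False
    then obtain j where "j \<in> Poly_Mapping.keys \<alpha>" "\<not> j < N"
      by blast
    then show ?thesis
      using False by (auto simp: monomial_def z_def in_keys_iff intro!: bexI[of _ j])
  qed
  have estimate: "cmod (g m \<gamma>) \<le> real n ^ k * cmod (evaluate (g m) (z k))
      + real n ^ k * (\<Sum>\<alpha>\<in>L. cmod (g m \<alpha>)) + A * (real n / (real n + 1)) ^ k"
    if k: "0 < k" for k m
  proof -
    let ?f = "\<lambda>\<alpha>. g m \<alpha> * monomial (z k) \<alpha>"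
    let ?S = "insert \<gamma> L"
    have le: "cmod (?f \<alpha>) \<le> cmod (g m \<alpha>)" for \<alpha>
      using monomial_le_1[of "z k" \<alpha>] z1[OF k] by (simp add: norm_mult mult_left_le less_imp_le)
    have abs: "(\<lambda>\<alpha>. cmod (?f \<alpha>)) summable_on UNIV"
      by (rule summable_on_comparison_test[OF summable[of m]]) (use le in auto)
    have sf: "?f summable_on T" for T
      using summable_on_subset_banach[OF abs_summable_summable[OF abs]] by blast
    have \<gamma>L: "\<gamma> \<notin> L"
      by (simp add: L_def n_def)
    have "evaluate (g m) (z k) = (\<Sum>\<^sub>\<infinity>\<alpha>\<in>?S \<union> - ?S. ?f \<alpha>)"
      by (simp add: evaluate_def)
    also have "\<dots> = (\<Sum>\<^sub>\<infinity>\<alpha>\<in>?S. ?f \<alpha>) + (\<Sum>\<^sub>\<infinity>\<alpha>\<in>- ?S. ?f \<alpha>)"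
      by (rule infsum_Un_disjoint[OF sf sf]) simp
    also have "(\<Sum>\<^sub>\<infinity>\<alpha>\<in>?S. ?f \<alpha>) = ?f \<gamma> + (\<Sum>\<alpha>\<in>L. ?f \<alpha>)"
      using finL \<gamma>L by simp
    finally have "?f \<gamma> = evaluate (g m) (z k) - (\<Sum>\<alpha>\<in>L. ?f \<alpha>) - (\<Sum>\<^sub>\<infinity>\<alpha>\<in>- ?S. ?f \<alpha>)"
      by simp
    then have "cmod (?f \<gamma>) \<le> cmod (evaluate (g m) (z k)) + cmod (\<Sum>\<alpha>\<in>L. ?f \<alpha>) + cmod (\<Sum>\<^sub>\<infinity>\<alpha>\<in>- ?S. ?f \<alpha>)"
      using norm_triangle_ineq4[of "evaluate (g m) (z k) - (\<Sum>\<alpha>\<in>L. ?f \<alpha>)" "\<Sum>\<^sub>\<infinity>\<alpha>\<in>- ?S. ?f \<alpha>"]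
        norm_triangle_ineq4[of "evaluate (g m) (z k)" "\<Sum>\<alpha>\<in>L. ?f \<alpha>"] by simp
    moreover have "cmod (\<Sum>\<alpha>\<in>L. ?f \<alpha>) \<le> (\<Sum>\<alpha>\<in>L. cmod (g m \<alpha>))"
      by (intro order_trans[OF norm_sum] sum_mono le)
    moreover have "cmod (\<Sum>\<^sub>\<infinity>\<alpha>\<in>- ?S. ?f \<alpha>) \<le> A * (1 / (real n + 1)) ^ k"
    proof -
      have le': "cmod (?f \<alpha>) \<le> cmod (g m \<alpha>) * (1 / (real n + 1)) ^ k" if "\<alpha> \<in> - ?S" for \<alpha>
      proof -
        have "bohr \<alpha> \<noteq> n"
          using that inj_bohr by (auto simp: n_def inj_eq)
        then have "real n + 1 \<le> real (bohr \<alpha>)"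
          using that by (simp add: L_def)
        then have "(1 / real (bohr \<alpha>)) ^ k \<le> (1 / (real n + 1)) ^ k"
          by (intro power_mono divide_left_mono) auto
        then have "cmod (monomial (z k) \<alpha>) \<le> (1 / (real n + 1)) ^ k"
          unfolding mono[OF k] by (auto simp: norm_power norm_divide)
        then show ?thesis
          by (simp add: norm_mult mult_left_mono)
      qed
      have sg: "(\<lambda>\<alpha>. cmod (g m \<alpha>)) summable_on - ?S"
        by (rule summable_on_subset_banach[OF summable]) simp
      have "cmod (\<Sum>\<^sub>\<infinity>\<alpha>\<in>- ?S. ?f \<alpha>) \<le> (\<Sum>\<^sub>\<infinity>\<alpha>\<in>- ?S. cmod (?f \<alpha>))"
        by (rule norm_infsum_bound) (rule summable_on_subset_banach[OF abs], simp)
      also have "\<dots> \<le> (\<Sum>\<^sub>\<infinity>\<alpha>\<in>- ?S. cmod (g m \<alpha>) * (1 / (real n + 1)) ^ k)"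
        by (intro infsum_mono le' summable_on_cmult_left sg summable_on_subset_banach[OF abs]) auto
      also have "\<dots> = (\<Sum>\<^sub>\<infinity>\<alpha>\<in>- ?S. cmod (g m \<alpha>)) * (1 / (real n + 1)) ^ k"
        by (rule infsum_cmult_left')
      also have "\<dots> \<le> A * (1 / (real n + 1)) ^ k"
      proof (rule mult_right_mono)
        have "(\<Sum>\<^sub>\<infinity>\<alpha>\<in>- ?S. cmod (g m \<alpha>)) \<le> (\<Sum>\<^sub>\<infinity>\<alpha>. cmod (g m \<alpha>))"
          by (intro infsum_mono2 sg summable) auto
        then show "(\<Sum>\<^sub>\<infinity>\<alpha>\<in>- ?S. cmod (g m \<alpha>)) \<le> A"
          using bound[of m] by linarith
      qed simp
      finally show ?thesis .
    qed
    moreover have "cmod (?f \<gamma>) = cmod (g m \<gamma>) * (1 / real n) ^ k"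
      using N by (simp add: mono[OF k] norm_mult norm_power norm_divide n_def)
    ultimately have "cmod (g m \<gamma>) * (1 / real n) ^ k \<le> cmod (evaluate (g m) (z k)) + (\<Sum>\<alpha>\<in>L. cmod (g m \<alpha>))
        + A * (1 / (real n + 1)) ^ k"
      by linarith
    then have "real n ^ k * (cmod (g m \<gamma>) * (1 / real n) ^ k) \<le> real n ^ k * (cmod (evaluate (g m) (z k))
        + (\<Sum>\<alpha>\<in>L. cmod (g m \<alpha>)) + A * (1 / (real n + 1)) ^ k)"
      by (intro mult_left_mono) auto
    then show ?thesis
      using n by (simp add: power_divide distrib_left ac_simps)
  qed
  show ?case
  proof (rule metric_LIMSEQ_I)
    fix \<epsilon> :: real
    assume \<epsilon>: "0 < \<epsilon>"
    \<comment> \<open>Order of choice: first k makes the damped part small for all m at once, and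
      with this k fixed m tends to infinity.\<close>
    have "(\<lambda>k. A * (real n / (real n + 1)) ^ k) \<longlonglongrightarrow> A * 0"
      by (intro tendsto_intros LIMSEQ_realpow_zero) auto
    then have "\<forall>\<^sub>F k in sequentially. A * (real n / (real n + 1)) ^ k < \<epsilon> / 2"
      using \<epsilon> by (intro order_tendstoD) auto
    then have "\<forall>\<^sub>F k in sequentially. 0 < k \<and> A * (real n / (real n + 1)) ^ k < \<epsilon> / 2"
      using eventually_gt_at_top[of 0] by eventually_elim simp
    then obtain k where k: "0 < k" "A * (real n / (real n + 1)) ^ k < \<epsilon> / 2"
      using eventually_happens[of _ sequentially] by auto
    have "(\<lambda>m. real n ^ k * cmod (evaluate (g m) (z k)) + real n ^ k * (\<Sum>\<alpha>\<in>L. cmod (g m \<alpha>)))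
        \<longlonglongrightarrow> real n ^ k * 0 + real n ^ k * (\<Sum>\<alpha>\<in>L. 0)"
    proof (intro tendsto_add tendsto_mult tendsto_const tendsto_sum tendsto_norm_zero)
      show "(\<lambda>m. evaluate (g m) (z k)) \<longlonglongrightarrow> 0"
        by (rule lim[of N, OF z1[OF k(1)]]) (simp add: z_def)
      show "(\<lambda>m. g m \<alpha>) \<longlonglongrightarrow> 0" if "\<alpha> \<in> L" for \<alpha>
        using less[of \<alpha>] that by (simp add: L_def n_def)
    qed
    then have "\<forall>\<^sub>F m in sequentially. real n ^ k * cmod (evaluate (g m) (z k)) + real n ^ k * (\<Sum>\<alpha>\<in>L. cmod (g m \<alpha>)) < \<epsilon> / 2"
      using \<epsilon> by (intro order_tendstoD) auto
    then have "\<forall>\<^sub>F m in sequentially. dist (g m \<gamma>) 0 < \<epsilon>"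
    proof eventually_elim
      case (elim m)
      then show ?case
        using estimate[OF k(1), of m] k(2) by simp
    qed
    then show "\<exists>M. \<forall>m\<ge>M. dist (g m \<gamma>) 0 < \<epsilon>"
      by (simp add: eventually_sequentially)
  qed
qed

subsection \<open>Weak convergence\<close>

lemma topspace_weak_topology: "Y \<noteq> {} \<Longrightarrow> topspace (weak_topology X Y) = X"
  unfolding weak_topology_def topology_generated_by_topspace by blast

text \<open>Subbasic sets suffice, since the eventual condition passes to finite intersections and
  to unions. The filter is arbitrary because both sequences and nets of finite subsets
  occur.\<close>

lemma limitin_weak_topology:
  assumes "Y \<noteq> {}" "l \<in> X" and X: "\<forall>\<^sub>F n in F. f n \<in> X"
    and lim: "\<And>y. y \<in> Y \<Longrightarrow> ((\<lambda>n. pairing (f n) y) \<longlongrightarrow> pairing l y) F"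
  shows "limitin (weak_topology X Y) f l F"
  unfolding limitin_def topspace_weak_topology[OF assms(1)]
proof (intro conjI allI impI assms(2))
  fix U
  assume U: "openin (weak_topology X Y) U \<and> l \<in> U"
  then have "generate_topology_on {{x \<in> X. pairing x y \<in> U} |y U. y \<in> Y \<and> open U} U"
    by (simp add: weak_topology_def openin_topology_generated_by_iff)
  then have "l \<in> U \<Longrightarrow> \<forall>\<^sub>F n in F. f n \<in> U"
  proof induction
    case (Int a b)
    then have "\<forall>\<^sub>F n in F. f n \<in> a" "\<forall>\<^sub>F n in F. f n \<in> b"
      by auto
    then show ?case
      by eventually_elim simp
  next
    case (UN K)
    then obtain k where "k \<in> K" "l \<in> k"
      by blast
    then have "\<forall>\<^sub>F n in F. f n \<in> k"
      using UN.IH by blast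
    then show ?case
      by (rule eventually_mono) (use \<open>k \<in> K\<close> in blast)
  next
    case (Basis S)
    then obtain y V where S: "S = {x \<in> X. pairing x y \<in> V}" "y \<in> Y" "open V"
      by blast
    have "\<forall>\<^sub>F n in F. pairing (f n) y \<in> V"
      using topological_tendstoD[OF lim[OF S(2)] S(3)] Basis.prems S(1) by simp
    with X show ?case
      unfolding S(1) by eventually_elim simp
  qed simp
  then show "\<forall>\<^sub>F n in F. f n \<in> U"
    using U by blast
qed

lemma closure_of_limit:
  assumes "limitin T f l F" "F \<noteq> bot" "\<forall>\<^sub>F n in F. f n \<in> T closure_of S"
  shows "l \<in> T closure_of S"
  using limitin_closedin[OF assms(1) closedin_closure_of assms(3,2)] .

text \<open>The property of a test family that turns bounded pointwise convergence into convergence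
  of the pairing. Every family in the space has it if the exponent is finite; for exponent
  \<infinity> it holds on \<open>c0_space\<close>, and this is how
  \<sigma>(\<open>\<ell>\<^sup>1\<close>, c_0) enters for p = 1.\<close>

definition vanishing_tails :: "ennreal \<Rightarrow> ('i \<Rightarrow> complex) \<Rightarrow> bool"
  where "vanishing_tails p v \<longleftrightarrow> v \<in> lp_space p \<and>
    (\<forall>\<epsilon>>0. \<exists>F. finite F \<and> lp_norm p (\<lambda>i. if i \<in> F then 0 else v i) \<le> \<epsilon>)"

lemma vanishing_tails_finite_exponent:
  assumes "1 \<le> p" "p \<noteq> \<infinity>" and v: "v \<in> lp_space p"
  shows "vanishing_tails p v"
  unfolding vanishing_tails_def
proof (intro conjI allI impI v)
  fix \<epsilon> :: real
  assume \<epsilon>: "0 < \<epsilon>"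
  define g where "g = (\<lambda>i. cmod (v i) powr enn2real p)"
  have sm: "g summable_on UNIV"
    using v assms(2) by (simp add: lp_space_def g_def)
  obtain F where F: "finite F" "dist (sum g F) (infsum g UNIV) \<le> \<epsilon> powr enn2real p"
    using infsum_finite_approximation[OF sm, of "\<epsilon> powr enn2real p"] \<epsilon> by auto
  have "(\<Sum>i\<in>G. cmod (if i \<in> F then 0 else v i) powr enn2real p) \<le> \<epsilon> powr enn2real p"
    if G: "finite G" for G
  proof -
    have "(\<Sum>i\<in>G. cmod (if i \<in> F then 0 else v i) powr enn2real p) = sum g (G - F)"
      using G by (intro sum.mono_neutral_cong_right) (auto simp: g_def)
    also have "\<dots> = sum g (F \<union> (G - F)) - sum g F"
      using F(1) G by (subst sum.union_disjoint) auto
    also have "sum g (F \<union> (G - F)) \<le> infsum g UNIV"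
      using F(1) G by (intro finite_sum_le_infsum[OF sm]) (auto simp: g_def)
    finally show ?thesis
      using F(2) by (auto simp: dist_real_def)
  qed
  then have "lp_norm p (\<lambda>i. if i \<in> F then 0 else v i) \<le> \<epsilon>"
    using lp_bounded_iff[OF assms(1,2), of \<epsilon> "\<lambda>i. if i \<in> F then 0 else v i"] \<epsilon> by simp
  then show "\<exists>F. finite F \<and> lp_norm p (\<lambda>i. if i \<in> F then 0 else v i) \<le> \<epsilon>"
    using F(1) by blast
qed

lemma vanishing_tails_c0:
  assumes "v \<in> c0_space"
  shows "vanishing_tails \<infinity> v"
proof -
  have fin: "finite {i. \<not> cmod (v i) < e}" if "0 < e" for e
    using assms that unfolding c0_space_def mem_Collect_eq tendsto_iff eventually_cofinite by simp
  have "cmod (v i) \<le> Max (insert 1 ((\<lambda>i. cmod (v i)) ` {i. \<not> cmod (v i) < 1}))" for i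
  proof (cases "cmod (v i) < 1")
    case True
    then show ?thesis
      using fin[of 1] by (intro order_trans[OF less_imp_le[OF True] Max_ge]) auto
  qed (use fin[of 1] in \<open>intro Max_ge, auto\<close>)
  then have "v \<in> lp_space \<infinity>"
    using linf_bounded_iff[of v "Max (insert 1 ((\<lambda>i. cmod (v i)) ` {i. \<not> cmod (v i) < 1}))"] by simp
  moreover have "\<exists>F. finite F \<and> lp_norm \<infinity> (\<lambda>i. if i \<in> F then 0 else v i) \<le> e" if "0 < e" for e
    using fin[OF that] linf_bounded_iff[of "\<lambda>i. if i \<in> {i. \<not> cmod (v i) < e} then 0 else v i" e] that
    by (intro exI[of _ "{i. \<not> cmod (v i) < e}"]) (auto simp: less_imp_le)
  ultimately show ?thesis
    by (simp add: vanishing_tails_def)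
qed

lemma Hoelder_weighted:
  fixes p p' :: ennreal
  assumes "1 \<le> p" "1 / p + 1 / p' = 1" and w: "\<And>i :: 'i. 0 < w i"
    and x: "x \<in> weighted_lp_space p w" and v: "(\<lambda>i. y i / complex_of_real (w i)) \<in> lp_space p'"
  shows "(\<lambda>i. cmod (x i * y i)) summable_on UNIV \<and>
    (\<Sum>\<^sub>\<infinity>i. cmod (x i * y i)) \<le> weighted_lp_norm p w x * lp_norm p' (\<lambda>i. y i / complex_of_real (w i))"
proof -
  have "x i * complex_of_real (w i) * (y i / complex_of_real (w i)) = x i * y i" for i
    using w[of i] by simp
  then show ?thesis
    using Hoelder[OF assms(1,2) x[unfolded weighted_lp_space_def mem_Collect_eq] v]
    by (simp add: weighted_lp_norm_def)
qed

text \<open>The pairing is split at a finite set F: on F pointwise convergence suffices, and off F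
  Hoelder's inequality bounds the difference by 2 B times the small tail of y. The limit lies in the
  same ball by \<open>lp_pointwise_limit\<close>.\<close>

lemma pairing_tendsto:
  fixes p p' :: ennreal
  assumes conj: "1 \<le> p" "1 / p + 1 / p' = 1" and w: "\<And>i :: 'i. 0 < w i"
    and y: "vanishing_tails p' (\<lambda>i. y i / complex_of_real (w i))"
    and z: "\<And>n. z n \<in> weighted_lp_space p w" "\<And>n :: nat. weighted_lp_norm p w (z n) \<le> B"
    and lim: "\<And>i. (\<lambda>n. z n i) \<longlonglongrightarrow> l i"
  shows "l \<in> weighted_lp_space p w" "(\<lambda>n. pairing (z n) y) \<longlonglongrightarrow> pairing l y"
proof -
  let ?X = "weighted_lp_space p w" and ?nrm = "weighted_lp_norm p w"
  have l: "l \<in> ?X \<and> ?nrm l \<le> B"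
    unfolding weighted_lp_space_def weighted_lp_norm_def mem_Collect_eq
    by (rule lp_pointwise_limit[OF conj(1) sequentially_bot, of "\<lambda>n i. z n i * complex_of_real (w i)"])
      (use z in \<open>auto simp: weighted_lp_space_def weighted_lp_norm_def intro!: tendsto_mult lim\<close>)
  then show "l \<in> ?X"
    by simp
  have B: "0 \<le> B"
    using lp_norm_nonneg[OF conj(1), of "\<lambda>i. l i * complex_of_real (w i)"] l
    by (simp add: weighted_lp_space_def weighted_lp_norm_def)
  define d where "d = (\<lambda>n i. z n i - l i)"
  have d: "d n \<in> ?X \<and> ?nrm (d n) \<le> 2 * B" for n
  proof -
    have "(\<lambda>i. z n i * complex_of_real (w i)) \<in> lp_space p" "(\<lambda>i. l i * complex_of_real (w i)) \<in> lp_space p"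
      using z l by (simp_all add: weighted_lp_space_def)
    from lp_add[OF conj(1) this(1) lp_scale(1)[OF conj(1) this(2), of "-1"]]
      lp_scale(2)[OF conj(1) this(2), of "-1"] z(2)[of n] l
    show ?thesis
      by (simp add: weighted_lp_space_def weighted_lp_norm_def d_def left_diff_distrib)
  qed
  have v: "(\<lambda>i. y i / complex_of_real (w i)) \<in> lp_space p'"
    using y by (simp add: vanishing_tails_def)
  have abs: "(\<lambda>i. cmod (x i * y i)) summable_on UNIV" if "x \<in> ?X" for x
    by (rule Hoelder_weighted[OF conj w that v, THEN conjunct1])
  have diff: "pairing (z n) y - pairing l y = pairing (d n) y" for n
  proof -
    have "(\<Sum>\<^sub>\<infinity>i. d n i * y i + l i * y i) = pairing (d n) y + pairing l y"
      unfolding pairing_def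
      by (rule infsum_add)
        (rule abs_summable_summable[OF abs[OF conjunct1[OF d]]] abs_summable_summable[OF abs[OF conjunct1[OF l]]])+
    moreover have "d n i * y i + l i * y i = z n i * y i" for i
      by (simp add: d_def left_diff_distrib)
    ultimately have "pairing (z n) y = pairing (d n) y + pairing l y"
      by (simp add: pairing_def)
    then show ?thesis
      by simp
  qed
  show "(\<lambda>n. pairing (z n) y) \<longlonglongrightarrow> pairing l y"
  proof (rule metric_LIMSEQ_I)
    fix e :: real
    assume e: "0 < e"
    \<comment> \<open>Chosen for 2 B \<epsilon> \<le> e / 2; the added 1 keeps the denominator
      positive when B = 0.\<close>
    define \<epsilon> where "\<epsilon> = e / (2 * (2 * B + 1))"
    have \<epsilon>: "0 < \<epsilon>"
      using e B by (simp add: \<epsilon>_def)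
    obtain F where F: "finite F" "lp_norm p' (\<lambda>i. if i \<in> F then 0 else y i / complex_of_real (w i)) \<le> \<epsilon>"
      using y \<epsilon> unfolding vanishing_tails_def by blast
    define y' where "y' = (\<lambda>i. if i \<in> F then 0 else y i)"
    have v': "(\<lambda>i. y' i / complex_of_real (w i)) = (\<lambda>i. if i \<in> F then 0 else y i / complex_of_real (w i))"
      by (auto simp: y'_def)
    have mem': "(\<lambda>i. y' i / complex_of_real (w i)) \<in> lp_space p'"
      using lp_mono[OF conjugate_exponent_ge_1[OF conj] v, of "\<lambda>i. y' i / complex_of_real (w i)"]
      by (auto simp: y'_def)
    have est: "cmod (pairing (d n) y) \<le> (\<Sum>i\<in>F. cmod (d n i * y i)) + e / 2" for n
    proof -
      have H: "(\<lambda>i. cmod (d n i * y' i)) summable_on UNIV"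
          "(\<Sum>\<^sub>\<infinity>i. cmod (d n i * y' i)) \<le> ?nrm (d n) * lp_norm p' (\<lambda>i. y' i / complex_of_real (w i))"
      by (rule Hoelder_weighted[OF conj w d[THEN conjunct1] mem', THEN conjunct1]
          Hoelder_weighted[OF conj w d[THEN conjunct1] mem', THEN conjunct2])+
      have "pairing (d n) y = (\<Sum>\<^sub>\<infinity>i\<in>F \<union> - F. d n i * y i)"
        by (simp add: pairing_def)
      also have "\<dots> = (\<Sum>\<^sub>\<infinity>i\<in>F. d n i * y i) + (\<Sum>\<^sub>\<infinity>i\<in>- F. d n i * y i)"
        by (rule infsum_Un_disjoint)
          (auto intro: summable_on_subset_banach[OF abs_summable_summable[OF abs[OF conjunct1[OF d]]]])
      also have "(\<Sum>\<^sub>\<infinity>i\<in>- F. d n i * y i) = (\<Sum>\<^sub>\<infinity>i. d n i * y' i)"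
        by (rule infsum_cong_neutral) (auto simp: y'_def)
      finally have "cmod (pairing (d n) y) \<le> cmod (\<Sum>i\<in>F. d n i * y i) + cmod (\<Sum>\<^sub>\<infinity>i. d n i * y' i)"
        using F(1) by (simp add: norm_triangle_ineq)
      also have "cmod (\<Sum>i\<in>F. d n i * y i) \<le> (\<Sum>i\<in>F. cmod (d n i * y i))"
        by (rule norm_sum)
      also have "cmod (\<Sum>\<^sub>\<infinity>i. d n i * y' i) \<le> (\<Sum>\<^sub>\<infinity>i. cmod (d n i * y' i))"
        by (rule norm_infsum_bound[OF H(1)])
      also have "\<dots> \<le> ?nrm (d n) * lp_norm p' (\<lambda>i. y' i / complex_of_real (w i))"
        by (rule H(2))
      also have "\<dots> \<le> 2 * B * \<epsilon>"
        using d[of n] F(2) B lp_norm_nonneg[OF conjugate_exponent_ge_1[OF conj] mem']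
        unfolding v' by (intro mult_mono) auto
      also have "\<dots> \<le> e / 2"
        using e B by (simp add: \<epsilon>_def field_simps)
      finally show ?thesis
        by simp
    qed
    have "(\<lambda>n. d n i) \<longlonglongrightarrow> 0" for i
      using lim[of i] by (simp add: d_def LIM_zero)
    then have "(\<lambda>n. \<Sum>i\<in>F. cmod (d n i * y i)) \<longlonglongrightarrow> (\<Sum>i\<in>F. 0)"
      by (intro tendsto_sum tendsto_norm_zero tendsto_mult_left_zero)
    then have "\<forall>\<^sub>F n in sequentially. (\<Sum>i\<in>F. cmod (d n i * y i)) < e / 2"
      using e by (intro order_tendstoD) auto
    then have "\<forall>\<^sub>F n in sequentially. dist (pairing (z n) y) (pairing l y) < e"
    proof eventually_elim
      case (elim n)
      then show ?case
        using est[of n] by (simp add: dist_norm diff)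
    qed
    then show "\<exists>N. \<forall>n\<ge>N. dist (pairing (z n) y) (pairing l y) < e"
      by (simp add: eventually_sequentially)
  qed
qed

subsection \<open>Interpolation\<close>

text \<open>Every entry of \<alpha> is at most the total degree, and with a common base the
  exponents s_j add up.\<close>

lemma weight_le_degree_power:
  assumes s: "\<And>j. 0 \<le> s j" "summable s"
  shows "weight s \<alpha> \<le> (1 + real (total_degree \<alpha>)) powr suminf s"
proof -
  let ?l = "Poly_Mapping.lookup \<alpha>" and ?K = "Poly_Mapping.keys \<alpha>"
  have "?l j \<le> total_degree \<alpha>" if "j \<in> ?K" for j
    unfolding total_degree_def using that by (intro member_le_sum) auto
  then have "weight s \<alpha> \<le> (\<Prod>j\<in>?K. (1 + real (total_degree \<alpha>)) powr s j)"
    unfolding weight_def by (intro prod_mono conjI powr_mono2) (auto simp: s)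
  also have "\<dots> = (1 + real (total_degree \<alpha>)) powr (\<Sum>j\<in>?K. s j)"
    by (rule powr_sum[symmetric]) auto
  also have "\<dots> \<le> (1 + real (total_degree \<alpha>)) powr suminf s"
    using s by (intro powr_mono sum_le_suminf) auto
  finally show ?thesis .
qed

text \<open>The inequality \<theta> p \<le> p - 1 is \<theta> \<le> 1 / p' rewritten without p', in
  the form that balances the powers in the interpolation. For p = \<infinity> the bound \<theta>
  \<le> 1 takes its place.\<close>

lemma conjugate_exponent_bound:
  fixes p p' :: ennreal
  assumes "1 \<le> p" "1 / p + 1 / p' = 1" "0 \<le> \<theta>" "ennreal \<theta> \<le> 1 / p'"
  shows "\<theta> \<le> 1" and "p \<noteq> \<infinity> \<Longrightarrow> \<theta> * enn2real p \<le> enn2real p - 1"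
proof -
  have "\<theta> \<le> 1 \<and> (p \<noteq> \<infinity> \<longrightarrow> \<theta> * enn2real p \<le> enn2real p - 1)"
    using assms(1,2)
  proof (cases rule: conjugate_exponents)
    case one
    then have "\<theta> = 0"
      using assms(3,4) by simp
    then show ?thesis
      using one by simp
  next
    case infinity
    then show ?thesis
      using assms(3,4) by simp
  next
    case (finite q q')
    have "1 / p' = ennreal (1 / q')"
      using divide_ennreal[of 1 q'] finite by simp
    then have "\<theta> \<le> 1 / q'"
      using assms(4) finite by (simp add: ennreal_le_iff)
    also have "1 / q' = 1 - 1 / q"
      using finite by simp
    finally have \<theta>: "\<theta> \<le> 1 - 1 / q" .
    then have "\<theta> * q \<le> (1 - 1 / q) * q"
      using finite by (intro mult_right_mono) auto
    also have "\<dots> = q - 1"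
      using finite by (simp add: field_simps)
    finally show ?thesis
      using \<theta> finite order_trans[OF \<theta>, of 1] by simp
  qed
  then show "\<theta> \<le> 1" and "p \<noteq> \<infinity> \<Longrightarrow> \<theta> * enn2real p \<le> enn2real p - 1"
    by auto
qed

text \<open>
  The weight is at most a power of \<open>1 + \<bar>\<alpha>\<bar>\<close> with exponent \<open>1 / p'\<close>, so the norm is controlled by
  interpolating between \<open>\<ell>\<^sup>1\<close> and the sup norm weighted with \<open>1 + \<bar>\<alpha>\<bar>\<close>.
\<close>

lemma X_norm_interpolation:
  fixes p p' :: ennreal
  assumes "1 \<le> p" "1 / p + 1 / p' = 1" and s: "\<And>j. 0 \<le> s j" "summable s" "ennreal (suminf s) \<le> 1 / p'"
    and AB: "0 \<le> A" "0 \<le> B"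
  obtains C where "\<And>x. (\<And>F. finite F \<Longrightarrow> (\<Sum>\<alpha>\<in>F. cmod (x \<alpha>)) \<le> A) \<Longrightarrow>
    (\<And>\<alpha>. real (total_degree \<alpha>) * cmod (x \<alpha>) \<le> B) \<Longrightarrow> x \<in> X_space p s \<and> X_norm p s x \<le> C"
proof -
  \<comment> \<open>Bounds |x_\<alpha>| (1 + |\<alpha>|); the added 1 makes it positive.\<close>
  define E where "E = A + B + 1"
  have E: "0 < E"
    using AB by (simp add: E_def)
  define \<theta> where "\<theta> = suminf s"
  have \<theta>: "0 \<le> \<theta>" "\<theta> \<le> 1" "p \<noteq> \<infinity> \<Longrightarrow> \<theta> * enn2real p \<le> enn2real p - 1"
    using conjugate_exponent_bound[OF assms(1,2) suminf_nonneg[OF s(2,1)] s(3)] suminf_nonneg[OF s(2,1)]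
    by (simp_all add: \<theta>_def)
  have le_E: "cmod (x \<alpha>) * (1 + real (total_degree \<alpha>)) \<le> E"
    if "\<And>F. finite F \<Longrightarrow> (\<Sum>\<alpha>\<in>F. cmod (x \<alpha>)) \<le> A" "\<And>\<alpha>. real (total_degree \<alpha>) * cmod (x \<alpha>) \<le> B" for x \<alpha>
    using that(1)[of "{\<alpha>}"] that(2)[of \<alpha>] by (simp add: E_def algebra_simps)
  have w: "weight s \<alpha> \<le> (1 + real (total_degree \<alpha>)) powr \<theta>" for \<alpha>
    unfolding \<theta>_def by (rule weight_le_degree_power[OF s(1,2)])
  show thesis
  proof (cases "p = \<infinity>")
    case True
    show thesis
    proof (rule that[of E])
      fix x :: family
      assume x: "\<And>F. finite F \<Longrightarrow> (\<Sum>\<alpha>\<in>F. cmod (x \<alpha>)) \<le> A" "\<And>\<alpha>. real (total_degree \<alpha>) * cmod (x \<alpha>) \<le> B"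
      have "cmod (x \<alpha> * complex_of_real (weight s \<alpha>)) \<le> E" for \<alpha>
      proof -
        have "weight s \<alpha> \<le> (1 + real (total_degree \<alpha>)) powr 1"
          using \<theta> by (intro order_trans[OF w] powr_mono) auto
        then have "cmod (x \<alpha>) * weight s \<alpha> \<le> cmod (x \<alpha>) * (1 + real (total_degree \<alpha>))"
          by (intro mult_left_mono) auto
        then show ?thesis
          using le_E[OF x, of \<alpha>] weight_pos[of s \<alpha>] by (simp add: norm_mult)
      qed
      then show "x \<in> X_space p s \<and> X_norm p s x \<le> E"
        using linf_bounded_iff[of "\<lambda>\<alpha>. x \<alpha> * complex_of_real (weight s \<alpha>)" E] True
        by (simp add: weighted_lp_space_def weighted_lp_norm_def)
    qed
  next
    case False
    define q where "q = enn2real p"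
    have q: "1 \<le> q"
      using enn2real_ge_1[OF assms(1) False] by (simp add: q_def)
    \<comment> \<open>Obtained by summing |x|^q (1 + |\<alpha>|)^(q-1) = |x| (|x| (1 +
      |\<alpha>|))^(q-1) \<le> |x| E^(q-1) over \<alpha>.\<close>
    define C where "C = (A * E powr (q - 1)) powr (1 / q)"
    have Cq: "C powr q = A * E powr (q - 1)"
      using q AB by (simp add: C_def powr_powr)
    show thesis
    proof (rule that[of C])
      fix x :: family
      assume x: "\<And>F. finite F \<Longrightarrow> (\<Sum>\<alpha>\<in>F. cmod (x \<alpha>)) \<le> A" "\<And>\<alpha>. real (total_degree \<alpha>) * cmod (x \<alpha>) \<le> B"
      have le_term: "cmod (x \<alpha> * complex_of_real (weight s \<alpha>)) powr q \<le> cmod (x \<alpha>) * E powr (q - 1)" for \<alpha>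
      proof (cases "x \<alpha> = 0")
        case False
        let ?d = "1 + real (total_degree \<alpha>)" and ?x = "cmod (x \<alpha>)"
        have "cmod (x \<alpha> * complex_of_real (weight s \<alpha>)) powr q = ?x powr q * weight s \<alpha> powr q"
          using weight_pos[of s \<alpha>] by (simp add: norm_mult powr_mult)
        also have "\<dots> \<le> ?x powr q * (?d powr \<theta>) powr q"
          using weight_pos[of s \<alpha>] q by (intro mult_left_mono powr_mono2 w) auto
        also have "\<dots> = ?x powr q * ?d powr (\<theta> * q)"
          by (simp add: powr_powr)
        also have "\<dots> \<le> ?x powr q * ?d powr (q - 1)"
          using \<theta>(3)[OF \<open>p \<noteq> \<infinity>\<close>] by (intro mult_left_mono powr_mono) (auto simp: q_def)
        also have "\<dots> = ?x * (?x * ?d) powr (q - 1)"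
          using False powr_add[of ?x 1 "q - 1"] by (simp add: powr_mult)
        also have "\<dots> \<le> ?x * E powr (q - 1)"
          using q by (intro mult_left_mono powr_mono2 le_E[OF x]) auto
        finally show ?thesis .
      qed simp
      have "(\<Sum>\<alpha>\<in>F. cmod (x \<alpha> * complex_of_real (weight s \<alpha>)) powr q) \<le> C powr q" if F: "finite F" for F
      proof -
        have "(\<Sum>\<alpha>\<in>F. cmod (x \<alpha> * complex_of_real (weight s \<alpha>)) powr q) \<le> (\<Sum>\<alpha>\<in>F. cmod (x \<alpha>)) * E powr (q - 1)"
          unfolding sum_distrib_right by (intro sum_mono le_term)
        also have "\<dots> \<le> A * E powr (q - 1)"
          by (intro mult_right_mono x(1) F) auto
        finally show ?thesis
          by (simp add: Cq)
      qed
      then show "x \<in> X_space p s \<and> X_norm p s x \<le> C"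
        using lp_bounded_iff[OF assms(1) False, of C "\<lambda>\<alpha>. x \<alpha> * complex_of_real (weight s \<alpha>)"]
        by (simp add: C_def q_def weighted_lp_space_def weighted_lp_norm_def)
    qed
  qed
qed

subsection \<open>Products of affine functions\<close>

definition affine_polynomial :: "complex \<Rightarrow> (nat \<Rightarrow> complex) \<Rightarrow> nat \<Rightarrow> polynomial"
  where "affine_polynomial a c m =
    Poly_Mapping.single 0 a + (\<Sum>k<m. Poly_Mapping.single (unit_index k) (c k))"

lemma coeff_norm_affine_polynomial:
  "coeff_norm (affine_polynomial a c m) \<le> cmod a + (\<Sum>k<m. cmod (c k))"
proof -
  have "coeff_norm (affine_polynomial a c m) \<le> coeff_norm (Poly_Mapping.single 0 a)
      + coeff_norm (\<Sum>k<m. Poly_Mapping.single (unit_index k) (c k))"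
    unfolding affine_polynomial_def by (rule coeff_norm_add)
  also have "\<dots> \<le> coeff_norm (Poly_Mapping.single 0 a)
      + (\<Sum>k<m. coeff_norm (Poly_Mapping.single (unit_index k) (c k)))"
    by (intro add_left_mono coeff_norm_sum)
  finally show ?thesis
    by simp
qed

lemma evaluate_affine_polynomial:
  "evaluate (Poly_Mapping.lookup (affine_polynomial a c m)) z = a + (\<Sum>k<m. c k * z k)"
  unfolding affine_polynomial_def evaluate_add evaluate_sum evaluate_single monomial_single by simp

lemma affine_l1_norm:
  assumes "affine_series a c \<in> lp_space 1"
  shows "cmod a + (\<Sum>k<m. cmod (c k)) \<le> lp_norm 1 (affine_series a c)"
proof -
  have inj: "inj_on unit_index {..<m}"
    by (rule inj_onI) (simp only: unit_index_eq_iff)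
  have "(\<Sum>\<alpha>\<in>insert 0 (unit_index ` {..<m}). cmod (affine_series a c \<alpha>)) \<le> lp_norm 1 (affine_series a c)"
    unfolding l1_norm using assms by (intro finite_sum_le_infsum) (auto simp: l1_iff)
  moreover have "(\<Sum>\<alpha>\<in>insert 0 (unit_index ` {..<m}). cmod (affine_series a c \<alpha>))
      = cmod a + (\<Sum>\<alpha>\<in>unit_index ` {..<m}. cmod (affine_series a c \<alpha>))"
    using unit_index_neq_0 by (subst sum.insert) (auto simp: affine_series_0 image_iff dest: sym)
  moreover have "(\<Sum>\<alpha>\<in>unit_index ` {..<m}. cmod (affine_series a c \<alpha>))
      = (\<Sum>k<m. cmod (affine_series a c (unit_index k)))"
    using sum.reindex[OF inj] by simp
  moreover have "\<dots> = (\<Sum>k<m. cmod (c k))"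
    by (simp only: affine_series_unit)
  ultimately show ?thesis
    by simp
qed

lemma polynomial_l1:
  "Poly_Mapping.lookup q \<in> lp_space 1" "lp_norm 1 (Poly_Mapping.lookup q) \<le> coeff_norm q"
proof -
  show *: "Poly_Mapping.lookup q \<in> lp_space 1"
    by (rule lp_space_finite_support) simp
  show "lp_norm 1 (Poly_Mapping.lookup q) \<le> coeff_norm q"
    unfolding l1_norm using *
    by (intro infsum_le_finite_sums sum_norm_lookup_le_coeff_norm) (auto simp: l1_iff)
qed

lemma evaluate_diff_l1:
  assumes "x \<in> lp_space 1" "y \<in> lp_space 1" and z: "\<And>j. cmod (z j) \<le> 1"
  shows "evaluate (\<lambda>\<alpha>. x \<alpha> - y \<alpha>) z = evaluate x z - evaluate y z"
proof -
  have sm: "(\<lambda>\<alpha>. x \<alpha> * monomial z \<alpha>) summable_on UNIV" if "x \<in> lp_space 1" for x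
  proof (rule abs_summable_summable, rule summable_on_comparison_test)
    show "(\<lambda>\<alpha>. cmod (x \<alpha>)) summable_on UNIV"
      using that by (simp add: l1_iff)
    show "cmod (x \<alpha> * monomial z \<alpha>) \<le> cmod (x \<alpha>)" for \<alpha>
      using monomial_le_1[of z \<alpha>] z by (simp add: norm_mult mult_left_le)
  qed simp
  have "evaluate x z = (\<Sum>\<^sub>\<infinity>\<alpha>. (x \<alpha> - y \<alpha>) * monomial z \<alpha> + y \<alpha> * monomial z \<alpha>)"
    by (simp add: evaluate_def left_diff_distrib)
  also have "\<dots> = evaluate (\<lambda>\<alpha>. x \<alpha> - y \<alpha>) z + evaluate y z"
    unfolding evaluate_def
  proof (rule infsum_add[OF sm sm])
    show "(\<lambda>\<alpha>. x \<alpha> - y \<alpha>) \<in> lp_space 1"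
      using lp_add[OF _ assms(1) lp_scale(1)[OF _ assms(2), of "-1"]] by simp
  qed (rule assms(2))
  finally show ?thesis
    by simp
qed

text \<open>The m-th polynomial has m factors in m variables. At a point with finitely many nonzero
  coordinates the truncation has no effect for large m, so the values converge; the norms of the
  factors bound the coefficient norms, and \<open>coefficients_tendsto_0\<close> applies to the
  difference from f.\<close>

lemma product_coefficients_tendsto:
  assumes f: "f \<in> lp_space 1" and aff: "\<And>j. affine_series (a j) (c j) \<in> lp_space 1"
    and bound: "\<And>m. (\<Prod>j<m. lp_norm 1 (affine_series (a j) (c j))) \<le> K"
    and lim: "\<And>N z. (\<And>j. j < N \<Longrightarrow> cmod (z j) < 1) \<Longrightarrow> (\<And>j. N \<le> j \<Longrightarrow> z j = 0) \<Longrightarrow>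
      (\<lambda>n. \<Prod>j<n. evaluate (affine_series (a j) (c j)) z) \<longlonglongrightarrow> evaluate f z"
  shows "(\<lambda>m. Poly_Mapping.lookup (\<Prod>j<m. affine_polynomial (a j) (c j) m) \<gamma>) \<longlonglongrightarrow> f \<gamma>"
proof -
  define Q where "Q = (\<lambda>m. \<Prod>j<m. affine_polynomial (a j) (c j) m)"
  have Q: "coeff_norm (Q m) \<le> K" for m
  proof -
    have "coeff_norm (\<Prod>j\<in>J. affine_polynomial (a j) (c j) m) \<le> (\<Prod>j\<in>J. coeff_norm (affine_polynomial (a j) (c j) m))"
      if "finite J" for J
      using that
    proof induction
      case (insert x F)
      then show ?case
        using coeff_norm_times[of "affine_polynomial (a x) (c x) m" "\<Prod>j\<in>F. affine_polynomial (a j) (c j) m"]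
          mult_left_mono[OF insert.IH coeff_norm_nonneg[of "affine_polynomial (a x) (c x) m"]]
        by simp
    qed simp
    then have "coeff_norm (Q m) \<le> (\<Prod>j<m. coeff_norm (affine_polynomial (a j) (c j) m))"
      by (simp add: Q_def)
    also have "\<dots> \<le> (\<Prod>j<m. lp_norm 1 (affine_series (a j) (c j)))"
      by (intro prod_mono conjI coeff_norm_nonneg order_trans[OF coeff_norm_affine_polynomial affine_l1_norm[OF aff]])
    finally show ?thesis
      using bound[of m] by linarith
  qed
  define g where "g = (\<lambda>m \<alpha>. Poly_Mapping.lookup (Q m) \<alpha> - f \<alpha>)"
  have g: "g m \<in> lp_space 1 \<and> lp_norm 1 (g m) \<le> K + lp_norm 1 f" for m
  proof -
    have "g m = (\<lambda>\<alpha>. Poly_Mapping.lookup (Q m) \<alpha> + (- 1) * f \<alpha>)"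
      by (simp add: g_def)
    then show ?thesis
      using lp_add[OF _ polynomial_l1(1)[of "Q m"] lp_scale(1)[OF _ f, of "-1"]]
        lp_scale(2)[OF _ f, of "-1"] polynomial_l1(2)[of "Q m"] Q[of m]
      by simp
  qed
  have "(\<lambda>m. g m \<gamma>) \<longlonglongrightarrow> 0"
  proof (rule coefficients_tendsto_0)
    show "(\<lambda>\<alpha>. cmod (g m \<alpha>)) summable_on UNIV" for m
      using g[of m] by (simp only: l1_iff)
    show "(\<Sum>\<^sub>\<infinity>\<alpha>. cmod (g m \<alpha>)) \<le> K + lp_norm 1 f" for m
      using g[of m] by (simp only: l1_norm)
    fix N :: nat and z :: "nat \<Rightarrow> complex"
    assume z: "\<And>j. j < N \<Longrightarrow> cmod (z j) < 1" "\<And>j. N \<le> j \<Longrightarrow> z j = 0"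
    have z1: "cmod (z j) \<le> 1" for j
      using z by (cases "j < N") (auto simp: less_imp_le not_less)
    have "evaluate (g m) z = (\<Prod>j<m. evaluate (affine_series (a j) (c j)) z) - evaluate f z" if "N \<le> m" for m
    proof -
      have "evaluate (affine_series (a j) (c j)) z = a j + (\<Sum>k<m. c j k * z k)" for j
        using z(2) that by (intro evaluate_affine_series) simp
      then show ?thesis
        unfolding g_def evaluate_diff_l1[OF polynomial_l1(1) f z1] Q_def evaluate_prod evaluate_affine_polynomial
        by simp
    qed
    then have "\<forall>\<^sub>F m in sequentially. evaluate (g m) z = (\<Prod>j<m. evaluate (affine_series (a j) (c j)) z) - evaluate f z"
      by (auto simp: eventually_sequentially)
    moreover have "(\<lambda>m. (\<Prod>j<m. evaluate (affine_series (a j) (c j)) z) - evaluate f z) \<longlonglongrightarrow> 0"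
      using lim[OF z] by (rule LIM_zero)
    ultimately show "(\<lambda>m. evaluate (g m) z) \<longlonglongrightarrow> 0"
      by (simp add: filterlim_cong)
  qed
  then show ?thesis
    unfolding g_def Q_def by (rule LIM_zero_cancel)
qed

lemma sum_le_prod_one_plus: "1 + (\<Sum>j<n. \<mu> j) \<le> (\<Prod>j<n. 1 + \<mu> j)"
  if "\<And>j. 0 \<le> \<mu> j" for \<mu> :: "nat \<Rightarrow> real"
proof (induction n)
  case (Suc n)
  have "0 \<le> (\<Sum>j<n. \<mu> j) * \<mu> n"
    using that by (simp add: sum_nonneg)
  then have "1 + (\<Sum>j<Suc n. \<mu> j) \<le> (1 + (\<Sum>j<n. \<mu> j)) * (1 + \<mu> n)"
    by (simp add: algebra_simps)
  also have "\<dots> \<le> (\<Prod>j<n. 1 + \<mu> j) * (1 + \<mu> n)"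
    using Suc that by (intro mult_right_mono) auto
  finally show ?case
    by simp
qed simp

text \<open>
  \<open>G n\<close> approximates the reciprocal of the product: each of its \<open>n\<close> factors is a Cesaro mean of a
  geometric series, with all but finitely many variables dropped.
\<close>

lemma reciprocal_approximants:
  fixes a :: "nat \<Rightarrow> complex" and d :: "nat \<Rightarrow> nat \<Rightarrow> complex"
  assumes a0: "(\<lambda>n. \<Prod>j<n. a j) \<longlonglongrightarrow> f0"
    and m_sums: "\<And>j. (\<lambda>k. cmod (d j k)) sums m j" and m1: "\<And>j. m j \<le> 1"
    and m_summable: "summable m" and prod_bound: "\<And>n. (\<Prod>j<n. 1 + 2 * m j) \<le> R"
    and coeff: "\<And>\<gamma>. (\<lambda>M. Poly_Mapping.lookup
      (\<Prod>j<M. affine_polynomial (a j) (\<lambda>k. a j * d j k) M) \<gamma>) \<longlonglongrightarrow> f \<gamma>"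
  obtains G :: "nat \<Rightarrow> polynomial" where
    "\<And>q. \<exists>A\<ge>0. \<forall>n F. finite F \<longrightarrow> (\<Sum>\<gamma>\<in>F. cmod (poly_mult (q * G n) f \<gamma>)) \<le> A"
    "\<And>q. \<exists>B\<ge>0. \<forall>n \<gamma>. real (total_degree \<gamma>) * cmod (poly_mult (q * G n) f \<gamma>) \<le> B"
    "\<And>q \<gamma>. (\<lambda>n. poly_mult (q * G n) f \<gamma>) \<longlonglongrightarrow> f0 * Poly_Mapping.lookup q \<gamma>"
proof -
  have m0: "0 \<le> m j" for j
    using sums_le[OF _ sums_zero m_sums] by simp
  define l where "l = (\<lambda>j M. \<Sum>k<M. Poly_Mapping.single (unit_index k) (d j k) :: polynomial)"
  have hom: "homogeneous 1 (l j M)" for j M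
    unfolding l_def by (intro homogeneous_sum homogeneous_single total_degree_single)
  have norm_le: "coeff_norm (\<Sum>k\<in>K. Poly_Mapping.single (unit_index k) (d j k)) \<le> (\<Sum>k\<in>K. cmod (d j k))" for j K
    using coeff_norm_sum[of "\<lambda>k. Poly_Mapping.single (unit_index k) (d j k)" K] by (simp only: coeff_norm_single)
  have partial: "(\<Sum>k<M. cmod (d j k)) \<le> m j" for j M
    using sum_le_suminf[OF sums_summable[OF m_sums[of j]], of "{..<M}"] sums_unique[OF m_sums[of j]] by simp
  have l_le: "coeff_norm (l j M) \<le> m j" for j M
    unfolding l_def by (rule order_trans[OF norm_le partial])
  have aff: "affine_polynomial (a j) (\<lambda>k. a j * d j k) M = Poly_Mapping.single 0 (a j) * (1 + l j M)" for j M
    by (simp add: affine_polynomial_def l_def distrib_left sum_distrib_left mult_single)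
  \<comment> \<open>Both the number of corrected factors and the length of their Cesaro means; the
    shift by one keeps it nonzero.\<close>
  define N where "N = (\<lambda>n :: nat. real (Suc n))"
  have N: "1 \<le> N n" for n
    by (simp add: N_def)
  \<comment> \<open>The tail beyond L must be at most m_j / N^2, because a Cesaro mean of length N
    multiplies it by N. For m_j = 0 the bound is 0 and is not delivered by strict inequalities from
    the limit, hence the case distinction.\<close>
  have "\<exists>L. Suc n \<le> L \<and> (\<forall>j<Suc n. m j - (\<Sum>k<L. cmod (d j k)) \<le> m j / (N n)\<^sup>2)" for n
  proof -
    have "\<forall>\<^sub>F L in sequentially. m j - (\<Sum>k<L. cmod (d j k)) \<le> m j / (N n)\<^sup>2" for j
    proof (cases "m j = 0")
      case True
      have "0 \<le> (\<Sum>k<L. cmod (d j k))" for L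
        by (simp add: sum_nonneg)
      then show ?thesis
        using True by simp
    next
      case False
      then have "0 < m j / (N n)\<^sup>2"
        using m0[of j] N[of n] by (simp add: less_le)
      moreover have "(\<lambda>L. m j - (\<Sum>k<L. cmod (d j k))) \<longlonglongrightarrow> m j - m j"
        using m_sums[of j] unfolding sums_def by (intro tendsto_intros)
      ultimately have "\<forall>\<^sub>F L in sequentially. m j - (\<Sum>k<L. cmod (d j k)) < m j / (N n)\<^sup>2"
        by (intro order_tendstoD) auto
      then show ?thesis
        by (rule eventually_mono) simp
    qed
    then have "\<forall>\<^sub>F L in sequentially. \<forall>j\<in>{..<Suc n}. m j - (\<Sum>k<L. cmod (d j k)) \<le> m j / (N n)\<^sup>2"
      by (intro eventually_ball_finite) auto
    with eventually_ge_at_top[of "Suc n"]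
    have "\<forall>\<^sub>F L in sequentially. Suc n \<le> L \<and> (\<forall>j<Suc n. m j - (\<Sum>k<L. cmod (d j k)) \<le> m j / (N n)\<^sup>2)"
      by eventually_elim auto
    then show ?thesis
      by (rule eventually_happens'[OF sequentially_bot])
  qed
  then obtain L where L: "\<And>n. Suc n \<le> L n"
      "\<And>n j. j < Suc n \<Longrightarrow> m j - (\<Sum>k<L n. cmod (d j k)) \<le> m j / (N n)\<^sup>2"
    by metis
  define S where "S = (\<lambda>n j. cesaro_inverse (Suc n) (l j (L n)))"
  define G where "G = (\<lambda>n. \<Prod>j<Suc n. S n j)"
  \<comment> \<open>A corrected factor leaves its Cesaro error, an uncorrected one keeps l_j itself.
    The latter has no gain 1 / N, but its size m_j belongs to the tail of a convergent
    series.\<close>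
  define e where "e = (\<lambda>n M j. if j < Suc n then S n j * (1 + l j M) - 1 else l j M)"
  define \<eta> where "\<eta> = (\<lambda>n j. if j < Suc n then 2 * m j / N n else m j)"
  have tail: "coeff_norm (l j M - l j (L n)) \<le> m j / (N n)\<^sup>2" if "L n \<le> M" "j < Suc n" for n M j
  proof -
    have split: "{..<M} = {..<L n} \<union> {L n..<M}" "{..<L n} \<inter> {L n..<M} = {}"
      using that(1) by auto
    have "l j M - l j (L n) = (\<Sum>k\<in>{L n..<M}. Poly_Mapping.single (unit_index k) (d j k))"
      unfolding l_def split(1) by (subst sum.union_disjoint) auto
    then have "coeff_norm (l j M - l j (L n)) \<le> (\<Sum>k\<in>{L n..<M}. cmod (d j k))"
      by (simp only: norm_le)
    also have "\<dots> = (\<Sum>k<M. cmod (d j k)) - (\<Sum>k<L n. cmod (d j k))"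
      unfolding split(1) by (subst sum.union_disjoint) auto
    also have "\<dots> \<le> m j / (N n)\<^sup>2"
      using L(2)[OF that(2)] partial[of j M] by linarith
    finally show ?thesis .
  qed
  have e: "coeff_norm (e n M j) \<le> 2 * m j
      \<and> real (total_degree \<gamma>) * cmod (Poly_Mapping.lookup (e n M j) \<gamma>) \<le> 2 * m j
      \<and> cmod (Poly_Mapping.lookup (e n M j) \<gamma>) \<le> \<eta> n j"
    if M: "L n \<le> M" for n M j \<gamma>
  proof (cases "j < Suc n")
    case True
    have hom': "homogeneous 1 (l j M - l j (L n))"
      using homogeneous_add[OF hom homogeneous_minus[OF hom]] by simp
    have "1 + l j (L n) + (l j M - l j (L n)) = 1 + l j M"
      by simp
    note b = cesaro_inverse_bounds[OF zero_less_Suc[of n] hom[of j "L n"] hom' l_le m1 tail[OF M True], unfolded this]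
    have Nn: "real (Suc n) = N n"
      by (simp add: N_def)
    have "N n * (m j / (N n)\<^sup>2) = m j / N n"
      using N[of n] by (simp add: power2_eq_square)
    moreover have "m j / N n \<le> m j / 1"
      using N[of n] m0[of j] by (intro divide_left_mono) auto
    moreover have "m j / (N n)\<^sup>2 \<le> m j / N n"
      using N[of n] m0[of j] by (intro divide_left_mono) (auto simp: power2_eq_square mult_le_cancel_left1)
    ultimately show ?thesis
      using b(1) b(2)[of \<gamma>] b(3)[of \<gamma>] True unfolding e_def S_def \<eta>_def Nn by simp
  next
    case False
    have "homogeneous (Suc k) (l j M)" if "k < 1" for k
      using hom that by simp
    note b = homogeneous_sum_bounds[where n = 1 and h = "\<lambda>k. l j M" and b = "m j", OF this l_le m0]
    show ?thesis
      using b(1) b(2)[of \<gamma>] b(3)[of \<gamma>] False m0[of j] by (simp add: e_def \<eta>_def)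
  qed
  define V where "V = (\<lambda>n M. \<Prod>j<M. 1 + e n M j)"
  define cM where "cM = (\<lambda>M. \<Prod>j<M. a j)"
  have GQ: "G n * (\<Prod>j<M. affine_polynomial (a j) (\<lambda>k. a j * d j k) M) = Poly_Mapping.single 0 (cM M) * V n M"
    if M: "L n \<le> M" for n M
  proof -
    have "Suc n \<le> M"
      using L(1)[of n] M by linarith
    then have "{..<M} \<inter> {j. j < Suc n} = {..<Suc n}"
      by auto
    then have "G n = (\<Prod>j<M. if j < Suc n then S n j else 1)"
      unfolding G_def by (simp add: prod.If_cases)
    moreover have "(\<Prod>j<M. Poly_Mapping.single 0 (a j) :: polynomial) = Poly_Mapping.single 0 (cM M)"
      unfolding cM_def by (induction M) (auto simp: mult_single)
    moreover have "(\<Prod>j<M. if j < Suc n then S n j else 1) * (\<Prod>j<M. 1 + l j M) = V n M"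
      unfolding V_def e_def prod.distrib[symmetric] by (intro prod.cong) auto
    ultimately show ?thesis
      unfolding aff prod.distrib by (simp add: ac_simps)
  qed
  have R: "0 \<le> R"
    using prod_bound[of 0] by simp
  define T where "T = suminf m"
  have T: "0 \<le> T" "\<And>n. (\<Sum>j<n. m j) \<le> T"
    unfolding T_def using m_summable m0 by (auto intro!: suminf_nonneg sum_le_suminf)
  \<comment> \<open>The first summand is the gain 1 / N of the corrected factors, the second the
    tail of the m_j over the uncorrected ones.\<close>
  define \<tau> where "\<tau> = (\<lambda>n. 2 * T / N n + (T - (\<Sum>j<Suc n. m j)))"
  have \<eta>_sum: "(\<Sum>j<M. \<eta> n j) \<le> \<tau> n" if "L n \<le> M" for n M
  proof -
    have "Suc n \<le> M"
      using L(1)[of n] that by linarith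
    then have split: "{..<M} = {..<Suc n} \<union> {Suc n..<M}" "{..<Suc n} \<inter> {Suc n..<M} = {}"
      by auto
    have "(\<Sum>j<M. \<eta> n j) = (\<Sum>j<Suc n. 2 * m j / N n) + (\<Sum>j\<in>{Suc n..<M}. m j)"
      unfolding split(1) by (subst sum.union_disjoint) (auto simp: \<eta>_def intro!: arg_cong2[where f = plus] sum.cong)
    also have "(\<Sum>j\<in>{Suc n..<M}. m j) = (\<Sum>j<M. m j) - (\<Sum>j<Suc n. m j)"
      unfolding split(1) by (subst sum.union_disjoint) auto
    also have "(\<Sum>j<Suc n. 2 * m j / N n) = 2 * (\<Sum>j<Suc n. m j) / N n"
      by (simp only: sum_distrib_left sum_divide_distrib)
    also have "\<dots> \<le> 2 * T / N n"
      using T(2)[of "Suc n"] N[of n] by (intro divide_right_mono mult_left_mono) auto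
    finally show ?thesis
      using T(2)[of M] by (simp add: \<tau>_def)
  qed
  have \<tau>0: "\<tau> \<longlonglongrightarrow> 0"
  proof -
    have "(\<lambda>n. T - (\<Sum>j<Suc n. m j)) \<longlonglongrightarrow> T - T"
      using LIMSEQ_Suc[OF summable_LIMSEQ[OF m_summable]] unfolding T_def by (intro tendsto_intros)
    moreover have "(\<lambda>n. 2 * T / N n) \<longlonglongrightarrow> 0"
      unfolding N_def using LIMSEQ_Suc[OF lim_const_over_n[of "2 * T"]] by simp
    ultimately show ?thesis
      using tendsto_add unfolding \<tau>_def by fastforce
  qed
  have V: "coeff_norm (V n M) \<le> R"
      "real (total_degree \<gamma>) * cmod (Poly_Mapping.lookup (V n M) \<gamma>) \<le> 2 * T * R"
      "cmod (Poly_Mapping.lookup (V n M - 1) \<gamma>) \<le> \<tau> n * R"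
    if M: "L n \<le> M" for n M \<gamma>
  proof -
    note eM = e[OF M]
    have V_eq: "(\<Prod>j<M. 1 + e n M j) = V n M"
      by (simp add: V_def)
    note b = prod_one_plus_bounds[of M "e n M" "\<lambda>j. 2 * m j" "\<eta> n",
        OF eM[THEN conjunct1] eM[THEN conjunct2, THEN conjunct1] eM[THEN conjunct2, THEN conjunct2], unfolded V_eq]
    show "coeff_norm (V n M) \<le> R"
      by (rule order_trans[OF b(1) prod_bound])
    have P0: "0 \<le> (\<Prod>j<M. 1 + 2 * m j)"
      using m0 by (intro prod_nonneg) (simp add: add_nonneg_nonneg)
    have "(\<Sum>j<M. 2 * m j) \<le> 2 * T"
      using T(2)[of M] by (simp flip: sum_distrib_left)
    then show "real (total_degree \<gamma>) * cmod (Poly_Mapping.lookup (V n M) \<gamma>) \<le> 2 * T * R"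
      using P0 T by (intro order_trans[OF b(2) mult_mono[OF _ prod_bound]]) auto
    have "0 \<le> (\<Sum>j<M. \<eta> n j)"
      using m0 N[of n] by (intro sum_nonneg) (auto simp: \<eta>_def)
    then show "cmod (Poly_Mapping.lookup (V n M - 1) \<gamma>) \<le> \<tau> n * R"
      using P0 \<eta>_sum[OF M] by (intro order_trans[OF b(3) mult_mono[OF _ prod_bound]]) auto
  qed
  obtain K0 where K0: "0 < K0" "\<And>M. cmod (cM M) \<le> K0"
    using convergent_imp_Bseq[OF convergentI[OF a0]] unfolding cM_def by (auto simp: Bseq_def)
  \<comment> \<open>A coefficient of \<open>poly_mult (q * G n) f\<close> involves only finitely
    many coefficients of f, so coefficientwise convergence of the partial products is enough.
    Estimates that hold for all M \<ge> L n then pass to f.\<close>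
  have lim: "(\<lambda>M. cM M * Poly_Mapping.lookup (q * V n M) \<gamma>) \<longlonglongrightarrow> poly_mult (q * G n) f \<gamma>" for q n \<gamma>
  proof -
    have "(\<lambda>M. poly_mult (q * G n) (Poly_Mapping.lookup (\<Prod>j<M. affine_polynomial (a j) (\<lambda>k. a j * d j k) M)) \<gamma>)
        \<longlonglongrightarrow> poly_mult (q * G n) f \<gamma>"
      unfolding poly_mult_def dilation_def
      by (intro tendsto_intros) (auto intro!: coeff tendsto_const)
    moreover have "poly_mult (q * G n) (Poly_Mapping.lookup (\<Prod>j<M. affine_polynomial (a j) (\<lambda>k. a j * d j k) M)) \<gamma>
        = cM M * Poly_Mapping.lookup (q * V n M) \<gamma>" if "L n \<le> M" for M
    proof -
      have "q * G n * (\<Prod>j<M. affine_polynomial (a j) (\<lambda>k. a j * d j k) M)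
          = Poly_Mapping.single 0 (cM M) * (q * V n M)"
        using GQ[OF that] by (simp add: ac_simps)
      then show ?thesis
        unfolding poly_mult_lookup
        by (simp only: mult_map_scale_conv_mult[symmetric]) (simp add: map.rep_eq when_def)
    qed
    then have "\<forall>\<^sub>F M in sequentially. poly_mult (q * G n)
        (Poly_Mapping.lookup (\<Prod>j<M. affine_polynomial (a j) (\<lambda>k. a j * d j k) M)) \<gamma>
        = cM M * Poly_Mapping.lookup (q * V n M) \<gamma>"
      by (auto simp: eventually_sequentially)
    ultimately show ?thesis
      by (rule Lim_transform_eventually)
  qed
  show thesis
  proof (rule that[of G])
    fix q
    show "\<exists>A\<ge>0. \<forall>n F. finite F \<longrightarrow> (\<Sum>\<gamma>\<in>F. cmod (poly_mult (q * G n) f \<gamma>)) \<le> A"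
    proof (intro exI[of _ "K0 * (coeff_norm q * R)"] conjI allI impI)
      show "0 \<le> K0 * (coeff_norm q * R)"
        using K0 R coeff_norm_nonneg by (simp add: less_imp_le)
      fix n and F :: "multiindex set"
      assume F: "finite F"
      have "(\<lambda>M. \<Sum>\<gamma>\<in>F. cmod (cM M * Poly_Mapping.lookup (q * V n M) \<gamma>))
          \<longlonglongrightarrow> (\<Sum>\<gamma>\<in>F. cmod (poly_mult (q * G n) f \<gamma>))"
        by (intro tendsto_intros lim)
      moreover have "\<forall>M\<ge>L n. (\<Sum>\<gamma>\<in>F. cmod (cM M * Poly_Mapping.lookup (q * V n M) \<gamma>)) \<le> K0 * (coeff_norm q * R)"
      proof (intro allI impI)
        fix M
        assume that: "L n \<le> M"
        have "(\<Sum>\<gamma>\<in>F. cmod (cM M * Poly_Mapping.lookup (q * V n M) \<gamma>))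
            = cmod (cM M) * (\<Sum>\<gamma>\<in>F. cmod (Poly_Mapping.lookup (q * V n M) \<gamma>))"
          by (simp add: norm_mult sum_distrib_left)
        also have "\<dots> \<le> K0 * (coeff_norm q * R)"
        proof (intro mult_mono K0(2))
          show "(\<Sum>\<gamma>\<in>F. cmod (Poly_Mapping.lookup (q * V n M) \<gamma>)) \<le> coeff_norm q * R"
            by (rule order_trans[OF sum_norm_lookup_le_coeff_norm[OF F]
                  order_trans[OF coeff_norm_times mult_left_mono[OF V(1)[OF that] coeff_norm_nonneg]]])
        qed (use K0 in \<open>auto intro: sum_nonneg\<close>)
        finally show "(\<Sum>\<gamma>\<in>F. cmod (cM M * Poly_Mapping.lookup (q * V n M) \<gamma>)) \<le> K0 * (coeff_norm q * R)" .
      qed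
      ultimately show "(\<Sum>\<gamma>\<in>F. cmod (poly_mult (q * G n) f \<gamma>)) \<le> K0 * (coeff_norm q * R)"
        by (rule Lim_bounded)
    qed
    define Dq where "Dq = (\<Sum>\<alpha>\<in>Poly_Mapping.keys q. real (total_degree \<alpha>) * cmod (Poly_Mapping.lookup q \<alpha>))"
    have Dq: "real (total_degree \<alpha>) * cmod (Poly_Mapping.lookup q \<alpha>) \<le> Dq" for \<alpha>
    proof (cases "\<alpha> \<in> Poly_Mapping.keys q")
      case True
      then show ?thesis
        unfolding Dq_def by (intro member_le_sum) auto
    qed (simp add: Dq_def in_keys_iff sum_nonneg)
    have Dq0: "0 \<le> Dq"
      by (simp add: Dq_def sum_nonneg)
    show "\<exists>B\<ge>0. \<forall>n \<gamma>. real (total_degree \<gamma>) * cmod (poly_mult (q * G n) f \<gamma>) \<le> B"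
    proof (intro exI[of _ "K0 * (Dq * R + coeff_norm q * (2 * T * R))"] conjI allI)
      show "0 \<le> K0 * (Dq * R + coeff_norm q * (2 * T * R))"
        using K0 Dq0 R T coeff_norm_nonneg[of q] by (intro mult_nonneg_nonneg add_nonneg_nonneg) auto
      fix n \<gamma>
      have "(\<lambda>M. real (total_degree \<gamma>) * cmod (cM M * Poly_Mapping.lookup (q * V n M) \<gamma>))
          \<longlonglongrightarrow> real (total_degree \<gamma>) * cmod (poly_mult (q * G n) f \<gamma>)"
        by (intro tendsto_intros lim)
      moreover have "\<forall>M\<ge>L n. real (total_degree \<gamma>) * cmod (cM M * Poly_Mapping.lookup (q * V n M) \<gamma>)
          \<le> K0 * (Dq * R + coeff_norm q * (2 * T * R))"
      proof (intro allI impI)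
        fix M
        assume that: "L n \<le> M"
        have "real (total_degree \<gamma>) * cmod (Poly_Mapping.lookup (q * V n M) \<gamma>)
            \<le> Dq * coeff_norm (V n M) + coeff_norm q * (2 * T * R)"
          by (rule degree_weighted_times_bound[OF Dq V(2)[OF that]])
        also have "\<dots> \<le> Dq * R + coeff_norm q * (2 * T * R)"
          by (intro add_right_mono mult_left_mono V(1)[OF that] Dq0)
        finally have "cmod (cM M) * (real (total_degree \<gamma>) * cmod (Poly_Mapping.lookup (q * V n M) \<gamma>))
            \<le> K0 * (Dq * R + coeff_norm q * (2 * T * R))"
          using K0 by (intro mult_mono) auto
        then show "real (total_degree \<gamma>) * cmod (cM M * Poly_Mapping.lookup (q * V n M) \<gamma>)
            \<le> K0 * (Dq * R + coeff_norm q * (2 * T * R))"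
          by (simp add: norm_mult ac_simps)
      qed
      ultimately show "real (total_degree \<gamma>) * cmod (poly_mult (q * G n) f \<gamma>)
          \<le> K0 * (Dq * R + coeff_norm q * (2 * T * R))"
        by (rule Lim_bounded)
    qed
    fix \<gamma>
    \<comment> \<open>As M grows, \<open>cM M\<close> times q tends to f0 times q, and q V - q = q
      (V - 1) has small coefficients by \<open>lookup_times_bound\<close>.\<close>
    have close: "cmod (poly_mult (q * G n) f \<gamma> - f0 * Poly_Mapping.lookup q \<gamma>) \<le> K0 * (coeff_norm q * (\<tau> n * R))" for n
    proof -
      have "(\<lambda>M. cmod (cM M * Poly_Mapping.lookup (q * V n M) \<gamma> - cM M * Poly_Mapping.lookup q \<gamma>))
          \<longlonglongrightarrow> cmod (poly_mult (q * G n) f \<gamma> - f0 * Poly_Mapping.lookup q \<gamma>)"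
        using a0 unfolding cM_def[symmetric] by (intro tendsto_intros lim)
      moreover have "\<forall>M\<ge>L n. cmod (cM M * Poly_Mapping.lookup (q * V n M) \<gamma> - cM M * Poly_Mapping.lookup q \<gamma>)
          \<le> K0 * (coeff_norm q * (\<tau> n * R))"
      proof (intro allI impI)
        fix M
        assume that: "L n \<le> M"
        have "q * V n M - q = q * (V n M - 1)"
          by (simp add: right_diff_distrib)
        then have "cM M * Poly_Mapping.lookup (q * V n M) \<gamma> - cM M * Poly_Mapping.lookup q \<gamma>
            = cM M * Poly_Mapping.lookup (q * (V n M - 1)) \<gamma>"
          by (metis lookup_minus right_diff_distrib)
        then show "cmod (cM M * Poly_Mapping.lookup (q * V n M) \<gamma> - cM M * Poly_Mapping.lookup q \<gamma>)
            \<le> K0 * (coeff_norm q * (\<tau> n * R))"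
          using K0 by (auto simp: norm_mult intro!: mult_mono lookup_times_bound V(3)[OF that])
      qed
      ultimately show ?thesis
        by (rule Lim_bounded)
    qed
    have "(\<lambda>n. K0 * (coeff_norm q * (\<tau> n * R))) \<longlonglongrightarrow> K0 * (coeff_norm q * (0 * R))"
      by (intro tendsto_intros \<tau>0)
    then have "(\<lambda>n. poly_mult (q * G n) f \<gamma> - f0 * Poly_Mapping.lookup q \<gamma>) \<longlonglongrightarrow> 0"
      by (intro Lim_null_comparison[OF always_eventually[OF allI[OF close]]]) simp
    then show "(\<lambda>n. poly_mult (q * G n) f \<gamma>) \<longlonglongrightarrow> f0 * Poly_Mapping.lookup q \<gamma>"
      by (rule LIM_zero_cancel)
  qed
qed

subsection \<open>Cyclicity\<close>

text \<open>The closure of the multiples contains f0 times every polynomial, hence, as f0 \<noteq>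
  0, every polynomial, and hence X by finite truncation. The set \<open>Y\<close> covers both
  topologies of part (3).\<close>

lemma cyclic_in_weak_topology:
  fixes p p' :: ennreal
  assumes conj: "1 \<le> p" "1 / p + 1 / p' = 1" and s: "\<And>j. 0 \<le> s j" "summable s"
    and le: "ennreal (suminf s) \<le> 1 / p'"
    and f: "f \<in> X_space p s" "f \<in> lp_space 1"
    and fac: "factorable_on (D_infty (kothe_dual (X_space p s))) f"
    and nz: "\<And>z. z \<in> D_infty (kothe_dual (X_space p s)) \<Longrightarrow> evaluate f z \<noteq> 0"
    and Y: "Y \<noteq> {}" "\<And>y. y \<in> Y \<Longrightarrow> vanishing_tails p' (\<lambda>\<alpha>. y \<alpha> / complex_of_real (weight s \<alpha>))"
  shows "cyclic_in (weak_topology (X_space p s) Y) f"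
proof -
  let ?X = "X_space p s" and ?T = "weak_topology (X_space p s) Y"
  let ?D = "D_infty (kothe_dual (X_space p s))"
  obtain a c P where aff: "\<And>j. affine_series (a j) (c j) \<in> lp_space 1"
    and lim: "\<And>z. z \<in> ?D \<Longrightarrow> (\<lambda>n. \<Prod>j<n. evaluate (affine_series (a j) (c j)) z) \<longlonglongrightarrow> evaluate f z"
    and P: "P > 0" "(\<lambda>n. \<Prod>j<n. lp_norm 1 (affine_series (a j) (c j))) \<longlonglongrightarrow> P"
    using fac unfolding factorable_on_def by blast
  have in_D: "z \<in> ?D" if "z \<in> D_section (kothe_dual ?X) N" for z N
    using that by (simp add: D_section_def)
  have ball: "z \<in> ?D" if "\<And>j. j < N \<Longrightarrow> cmod (z j) < 1" "\<And>j. N \<le> j \<Longrightarrow> z j = 0" for z N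
    by (rule in_D, rule ball_subset_D_section[OF conj s(1) that])
  \<comment> \<open>The infinite product is a limit of partial products, so one vanishing factor
    makes them eventually 0 and forces f to vanish.\<close>
  have factor_nz: "evaluate (affine_series (a j) (c j)) z \<noteq> 0" if z: "z \<in> ?D" for j z
  proof
    assume 0: "evaluate (affine_series (a j) (c j)) z = 0"
    have "(\<Prod>i<n. evaluate (affine_series (a i) (c i)) z) = 0" if "Suc j \<le> n" for n
      using 0 that by (intro prod_zero) auto
    then have "(\<lambda>n. \<Prod>i<n. evaluate (affine_series (a i) (c i)) z) \<longlonglongrightarrow> 0"
      by (intro tendsto_eventually eventually_sequentiallyI[of "Suc j"])
    then show False
      using LIMSEQ_unique[OF lim[OF z]] nz[OF z] by blast
  qed
  have zero: "(\<lambda>_. 0) \<in> ?D"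
    by (rule ball[of 0]) auto
  have eval0: "evaluate (affine_series (a j) (c j)) (\<lambda>_. 0) = a j" for j
    using evaluate_affine_series[of 0 "\<lambda>_. 0" "a j" "c j"] by simp
  define f0 where "f0 = evaluate f (\<lambda>_. 0)"
  have a_nz: "a j \<noteq> 0" for j
    using factor_nz[OF zero, of j] by (simp add: eval0)
  have f0: "f0 \<noteq> 0" "(\<lambda>n. \<Prod>j<n. a j) \<longlonglongrightarrow> f0"
    using nz[OF zero] lim[OF zero] by (simp_all add: f0_def eval0)
  define \<nu> where "\<nu> = (\<lambda>j. lp_norm 1 (affine_series (a j) (c j)))"
  define d where "d = (\<lambda>j k. c j k / a j)"
  have cd: "c j = (\<lambda>k. a j * d j k)" for j
    using a_nz by (simp add: d_def)
  have partial_d: "(\<Sum>k<M. cmod (d j k)) = (\<Sum>k<M. cmod (c j k)) / cmod (a j)" for j M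
    by (simp add: d_def norm_divide sum_divide_distrib)
  have d1: "(\<Sum>k<M. cmod (d j k)) \<le> 1" for j M
  proof -
    have "(\<Sum>k<M. cmod (c j k)) \<le> cmod (a j)"
      by (rule nonvanishing_affine_bound[where s = s, OF conj s(1)]) (use in_D factor_nz in blast)
    then show ?thesis
      using a_nz[of j] by (simp add: partial_d divide_le_eq)
  qed
  have d_summable: "summable (\<lambda>k. cmod (d j k))" for j
    by (rule summableI_nonneg_bounded[of _ 1]) (use d1 in auto)
  define m where "m = (\<lambda>j. \<Sum>\<^sub>\<infinity>k. cmod (d j k))"
  have m_sums: "(\<lambda>k. cmod (d j k)) sums m j" for j
  proof -
    have "(\<lambda>k. cmod (d j k)) summable_on UNIV"
      using d_summable[of j] by (intro summable_nonneg_imp_summable_on) auto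
    then show ?thesis
      unfolding m_def by (intro has_sum_imp_sums has_sum_infsum)
  qed
  have m0: "0 \<le> m j" for j
    by (simp add: m_def infsum_nonneg)
  have m_le: "m j \<le> B" if "\<And>M. (\<Sum>k<M. cmod (d j k)) \<le> B" for j B
    using m_sums[of j] that unfolding sums_def by (intro LIMSEQ_le_const2) auto
  have m1: "m j \<le> 1" for j
    by (rule m_le[OF d1])
  \<comment> \<open>The coefficients of f_j are a_j and a_j d_jk, so its norm is at least |a_j|
    times 1 plus any partial sum of the |d_jk|.\<close>
  have m\<nu>: "1 + m j \<le> \<nu> j / cmod (a j)" for j
  proof -
    have "(\<Sum>k<M. cmod (d j k)) \<le> \<nu> j / cmod (a j) - 1" for M
      using affine_l1_norm[OF aff[of j], of M] a_nz[of j]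
      by (simp add: partial_d \<nu>_def field_simps)
    then show ?thesis
      using m_le[of j "\<nu> j / cmod (a j) - 1"] by simp
  qed
  have prod_m: "(\<Prod>j<n. 1 + m j) \<le> (\<Prod>j<n. \<nu> j) / cmod (\<Prod>j<n. a j)" for n
  proof -
    have "(\<Prod>j<n. 1 + m j) \<le> (\<Prod>j<n. \<nu> j / cmod (a j))"
      using m\<nu> m0 by (intro prod_mono) (auto intro: add_nonneg_nonneg)
    then show ?thesis
      by (simp add: prod_dividef prod_norm)
  qed
  \<comment> \<open>Nonvanishing at the origin enters here: the denominators converge to |f0|
    \<noteq> 0, so the products of the 1 + m_j are bounded and the m_j are summable.\<close>
  have "(\<lambda>n. (\<Prod>j<n. \<nu> j) / cmod (\<Prod>j<n. a j)) \<longlonglongrightarrow> P / cmod f0"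
    using P(2) f0 unfolding \<nu>_def by (intro tendsto_divide tendsto_norm) auto
  then have "Bseq (\<lambda>n. (\<Prod>j<n. \<nu> j) / cmod (\<Prod>j<n. a j))"
    by (intro convergent_imp_Bseq convergentI)
  then obtain R0 where R0: "\<And>n. norm ((\<Prod>j<n. \<nu> j) / cmod (\<Prod>j<n. a j)) \<le> R0"
    by (auto simp: Bseq_def)
  have prod_R0: "(\<Prod>j<n. 1 + m j) \<le> R0" for n
    using prod_m[of n] abs_ge_self[of "(\<Prod>j<n. \<nu> j) / cmod (\<Prod>j<n. a j)"] R0[of n]
    unfolding real_norm_def by linarith
  have "(\<Sum>j<n. m j) \<le> R0" for n
    using sum_le_prod_one_plus[of m n, OF m0] prod_R0[of n] by linarith
  then have m_summable: "summable m"
    by (intro summableI_nonneg_bounded[of _ R0] m0)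
  \<comment> \<open>The approximants allow errors up to 2 m_j, since the dropped variables cost as
    much as m_j again; 1 + 2 m \<le> (1 + m)^2 keeps the product bounded.\<close>
  have prod_2m: "(\<Prod>j<n. 1 + 2 * m j) \<le> R0\<^sup>2" for n
  proof -
    have "(\<Prod>j<n. 1 + 2 * m j) \<le> (\<Prod>j<n. (1 + m j)\<^sup>2)"
      using m0 by (intro prod_mono) (auto simp: power2_sum add_nonneg_nonneg)
    also have "\<dots> = (\<Prod>j<n. 1 + m j)\<^sup>2"
      by (rule prod_power_distrib[symmetric])
    also have "\<dots> \<le> R0\<^sup>2"
      using m0 by (intro power_mono prod_R0 prod_nonneg) (simp add: add_nonneg_nonneg)
    finally show ?thesis .
  qed
  obtain K where K: "\<And>n. norm (\<Prod>j<n. \<nu> j) \<le> K"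
    using convergent_imp_Bseq[OF convergentI[OF P(2)]] by (auto simp: Bseq_def \<nu>_def)
  have coeff: "(\<lambda>M. Poly_Mapping.lookup (\<Prod>j<M. affine_polynomial (a j) (\<lambda>k. a j * d j k) M) \<gamma>) \<longlonglongrightarrow> f \<gamma>" for \<gamma>
    unfolding cd[symmetric]
  proof (rule product_coefficients_tendsto[OF f(2) aff])
    show "(\<Prod>j<n. lp_norm 1 (affine_series (a j) (c j))) \<le> K" for n
      using K[of n] by (simp add: \<nu>_def)
  qed (rule lim[OF ball])
  obtain G :: "nat \<Rightarrow> polynomial" where G:
    "\<And>q. \<exists>A\<ge>0. \<forall>n F. finite F \<longrightarrow> (\<Sum>\<gamma>\<in>F. cmod (poly_mult (q * G n) f \<gamma>)) \<le> A"
    "\<And>q. \<exists>B\<ge>0. \<forall>n \<gamma>. real (total_degree \<gamma>) * cmod (poly_mult (q * G n) f \<gamma>) \<le> B"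
    "\<And>q \<gamma>. (\<lambda>n. poly_mult (q * G n) f \<gamma>) \<longlonglongrightarrow> f0 * Poly_Mapping.lookup q \<gamma>"
    using reciprocal_approximants[OF f0(2) m_sums m1 m_summable prod_2m coeff] by blast
  define C where "C = ?T closure_of (range (\<lambda>q. poly_mult q f))"
  have top: "topspace ?T = ?X"
    by (rule topspace_weak_topology[OF Y(1)])
  have range_C: "poly_mult q f \<in> C" if "poly_mult q f \<in> ?X" for q
    using closure_of_subset_Int[of ?T "range (\<lambda>q. poly_mult q f)"] that by (auto simp: C_def top)
  have multiple_C: "(\<lambda>\<gamma>. f0 * Poly_Mapping.lookup q \<gamma>) \<in> C" for q
  proof -
    obtain A B where AB: "0 \<le> A" "\<And>n F. finite F \<Longrightarrow> (\<Sum>\<gamma>\<in>F. cmod (poly_mult (q * G n) f \<gamma>)) \<le> A"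
      "0 \<le> B" "\<And>n \<gamma>. real (total_degree \<gamma>) * cmod (poly_mult (q * G n) f \<gamma>) \<le> B"
      using G(1)[of q] G(2)[of q] by metis
    obtain N where N: "\<And>x. (\<And>F. finite F \<Longrightarrow> (\<Sum>\<alpha>\<in>F. cmod (x \<alpha>)) \<le> A) \<Longrightarrow>
        (\<And>\<alpha>. real (total_degree \<alpha>) * cmod (x \<alpha>) \<le> B) \<Longrightarrow> x \<in> ?X \<and> X_norm p s x \<le> N"
      by (rule X_norm_interpolation[OF conj s le AB(1,3)]) blast
    have z: "poly_mult (q * G n) f \<in> ?X \<and> X_norm p s (poly_mult (q * G n) f) \<le> N" for n
      by (rule N[OF AB(2,4)])
    note weak = pairing_tendsto[OF conj weight_pos Y(2) conjunct1[OF z] conjunct2[OF z] G(3)]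
    obtain y where "y \<in> Y"
      using Y(1) by blast
    then have "limitin ?T (\<lambda>n. poly_mult (q * G n) f) (\<lambda>\<gamma>. f0 * Poly_Mapping.lookup q \<gamma>) sequentially"
      by (intro limitin_weak_topology[OF Y(1) weak(1)] weak(2) always_eventually allI conjunct1[OF z])
    then show ?thesis
      unfolding C_def
      by (rule closure_of_limit) (use range_C z in \<open>auto simp: C_def\<close>)
  qed
  have polynomial_C: "Poly_Mapping.lookup q \<in> C" for q
  proof -
    have "f0 * Poly_Mapping.lookup (Poly_Mapping.map ((*) (1 / f0)) q) \<gamma> = Poly_Mapping.lookup q \<gamma>" for \<gamma>
      using f0(1) by (simp add: map.rep_eq when_def)
    then show ?thesis
      using multiple_C[of "Poly_Mapping.map ((*) (1 / f0)) q"] by simp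
  qed
  \<comment> \<open>Truncation along the directed set of finite index sets requires only absolute
    summability of x y. This includes p = \<infinity>, where truncations need not converge in
    norm.\<close>
  have "x \<in> C" if x: "x \<in> ?X" for x
  proof -
    define r where "r = (\<lambda>F. \<Sum>\<alpha>\<in>F. Poly_Mapping.single \<alpha> (x \<alpha>))"
    have r: "Poly_Mapping.lookup (r F) = (\<lambda>\<alpha>. if \<alpha> \<in> F then x \<alpha> else 0)" if "finite F" for F
      using that by (auto simp: r_def lookup_sum lookup_single when_def fun_eq_iff)
    have rX: "Poly_Mapping.lookup (r F) \<in> ?X" for F
      unfolding weighted_lp_space_def mem_Collect_eq
      by (rule lp_space_finite_support, rule finite_subset[OF _ finite_keys[of "r F"]])
        (auto simp: in_keys_iff)
    have "limitin ?T (\<lambda>F. Poly_Mapping.lookup (r F)) x (finite_subsets_at_top UNIV)"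
    proof (rule limitin_weak_topology[OF Y(1) x])
      show "\<forall>\<^sub>F F in finite_subsets_at_top UNIV. Poly_Mapping.lookup (r F) \<in> ?X"
        using rX by simp
      fix y
      assume "y \<in> Y"
      then have v: "(\<lambda>\<alpha>. y \<alpha> / complex_of_real (weight s \<alpha>)) \<in> lp_space p'"
        using Y(2) unfolding vanishing_tails_def by blast
      have "(\<lambda>\<alpha>. x \<alpha> * y \<alpha>) summable_on UNIV"
        by (rule abs_summable_summable, rule Hoelder_weighted[OF conj weight_pos x v, THEN conjunct1])
      then have "((\<lambda>F. \<Sum>\<alpha>\<in>F. x \<alpha> * y \<alpha>) \<longlongrightarrow> pairing x y) (finite_subsets_at_top UNIV)"
        unfolding pairing_def by (rule infsum_tendsto)
      moreover have "\<forall>\<^sub>F F in finite_subsets_at_top UNIV. (\<Sum>\<alpha>\<in>F. x \<alpha> * y \<alpha>) = pairing (Poly_Mapping.lookup (r F)) y"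
      proof (rule eventually_finite_subsets_at_top_weakI)
        fix F :: "multiindex set"
        assume F: "finite F"
        have "pairing (Poly_Mapping.lookup (r F)) y = (\<Sum>\<^sub>\<infinity>\<alpha>\<in>F. x \<alpha> * y \<alpha>)"
          unfolding pairing_def r[OF F] by (rule infsum_cong_neutral) auto
        then show "(\<Sum>\<alpha>\<in>F. x \<alpha> * y \<alpha>) = pairing (Poly_Mapping.lookup (r F)) y"
          using F by simp
      qed
      ultimately show "((\<lambda>F. pairing (Poly_Mapping.lookup (r F)) y) \<longlongrightarrow> pairing x y) (finite_subsets_at_top UNIV)"
        by (rule Lim_transform_eventually)
    qed
    then show ?thesis
      unfolding C_def
      by (rule closure_of_limit) (use polynomial_C in \<open>auto simp: C_def\<close>)
  qed
  then show ?thesis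
    using closure_of_subset_topspace[of ?T] unfolding cyclic_in_def top C_def by blast
qed

lemma product_of_discs_cong: "(\<And>j. j < N \<Longrightarrow> E j = E' j) \<Longrightarrow> product_of_discs N E = product_of_discs N E'"
  by (auto simp: product_of_discs_def)

text \<open>Excluding p = 1 makes p' finite, and for a finite exponent all tails vanish.\<close>

lemma Koethe_dual_vanishing_tails:
  fixes p p' :: ennreal
  assumes "1 \<le> p" "1 / p + 1 / p' = 1" "p \<noteq> 1" and y: "y \<in> kothe_dual (X_space p s)"
  shows "vanishing_tails p' (\<lambda>\<alpha>. y \<alpha> / complex_of_real (weight s \<alpha>))"
proof (rule vanishing_tails_finite_exponent[OF conjugate_exponent_ge_1[OF assms(1,2)]])
  show "p' \<noteq> \<infinity>"
    using assms(1,2) by (cases rule: conjugate_exponents) (use assms(3) in auto)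
  show "(\<lambda>\<alpha>. y \<alpha> / complex_of_real (weight s \<alpha>)) \<in> lp_space p'"
    using y kothe_dual_weighted_iff[where w = "weight s", OF assms(1,2) weight_pos] by blast
qed

theorem proposition7p4:
  fixes p p' :: ennreal and s :: "nat \<Rightarrow> real"
  assumes "1 \<le> p" and "1 / p + 1 / p' = 1" and "\<And>j. 0 \<le> s j"
  shows
    "(ISL (X_space p s) (X_norm p s) \<and>
      (\<forall>j. operator_norm_on (X_space p s) (X_norm p s) (dilation (unit_index j))
             \<le> ennreal (2 powr s j)) \<and>
      (\<forall>N\<ge>1.
         (\<exists>E. (\<forall>j<N. E j = ball 0 1 \<or> E j = cball 0 1) \<and>
              D_section (kothe_dual (X_space p s)) N = product_of_discs N E) \<and>
         (p > 1 \<and> (\<forall>j<N. ennreal (s j) \<le> 1 / p') \<longrightarrow>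
              D_section (kothe_dual (X_space p s)) N = product_of_discs N (\<lambda>_. ball 0 1)) \<and>
         ((p > 1 \<and> (\<forall>j<N. ennreal (s j) > 1 / p')) \<or> p = 1 \<longrightarrow>
              D_section (kothe_dual (X_space p s)) N = product_of_discs N (\<lambda>_. cball 0 1))))
     \<and>
     (\<forall>a c.
         (\<forall>N\<ge>1. \<forall>\<zeta>\<in>D_section (kothe_dual (X_space p s)) N.
             evaluate (affine_series a c) \<zeta> \<noteq> 0) \<longrightarrow>
         suminf (\<lambda>k. ennreal (cmod (c k))) \<le> ennreal (cmod a))
     \<and>
     (summable s \<longrightarrow>
       (\<forall>f \<in> X_space p s \<inter> lp_space 1.
         factorable_on (D_infty (kothe_dual (X_space p s))) f \<and>
         ennreal (suminf s) \<le> 1 / p' \<and>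
         (\<forall>\<zeta>\<in>D_infty (kothe_dual (X_space p s)). evaluate f \<zeta> \<noteq> 0) \<longrightarrow>
         cyclic_in
           (weak_topology (X_space p s)
              (if p = 1 then c0_space else kothe_dual (X_space p s))) f))"
proof (intro conjI allI impI ballI)
  show "ISL (X_space p s) (X_norm p s)"
    using assms(1,3) by (rule ISL_X)
  show "operator_norm_on (X_space p s) (X_norm p s) (dilation (unit_index j)) \<le> ennreal (2 powr s j)" for j
    using assms(1,3) by (rule operator_norm_dilation_unit)
next
  fix N :: nat
  let ?E = "\<lambda>j. if p = 1 \<or> 1 / p' < ennreal (s j) then cball 0 1 else ball (0 :: complex) 1"
  note D = D_section_eq_product_of_discs[where s = s and N = N, OF assms]
  show "\<exists>E. (\<forall>j<N. E j = ball 0 1 \<or> E j = cball 0 1) \<and>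
      D_section (kothe_dual (X_space p s)) N = product_of_discs N E"
    by (rule exI[of _ ?E]) (use D in simp)
  show "D_section (kothe_dual (X_space p s)) N = product_of_discs N (\<lambda>_. ball 0 1)"
    if "p > 1 \<and> (\<forall>j<N. ennreal (s j) \<le> 1 / p')"
    unfolding D by (rule product_of_discs_cong) (use that in \<open>auto simp: not_less\<close>)
  show "D_section (kothe_dual (X_space p s)) N = product_of_discs N (\<lambda>_. cball 0 1)"
    if "(p > 1 \<and> (\<forall>j<N. ennreal (s j) > 1 / p')) \<or> p = 1"
    unfolding D by (rule product_of_discs_cong) (use that in auto)
next
  fix a c
  assume nz: "\<forall>N\<ge>1. \<forall>\<zeta>\<in>D_section (kothe_dual (X_space p s)) N. evaluate (affine_series a c) \<zeta> \<noteq> 0"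
  have "(\<Sum>k<N. ennreal (cmod (c k))) \<le> ennreal (cmod a)" for N
  proof -
    have "(\<Sum>k<N. cmod (c k)) \<le> cmod a"
      by (rule nonvanishing_affine_bound[where s = s, OF assms]) (use nz in blast)
    then show ?thesis
      by (simp add: ennreal_leI)
  qed
  then show "suminf (\<lambda>k. ennreal (cmod (c k))) \<le> ennreal (cmod a)"
    by (intro suminf_le_const summableI)
next
  fix f
  assume s: "summable s" and f: "f \<in> X_space p s \<inter> lp_space 1"
    and *: "factorable_on (D_infty (kothe_dual (X_space p s))) f \<and> ennreal (suminf s) \<le> 1 / p' \<and>
      (\<forall>\<zeta>\<in>D_infty (kothe_dual (X_space p s)). evaluate f \<zeta> \<noteq> 0)"
  let ?Y = "if p = 1 then c0_space else kothe_dual (X_space p s)"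
  have tails: "vanishing_tails p' (\<lambda>\<alpha>. y \<alpha> / complex_of_real (weight s \<alpha>))" if y: "y \<in> ?Y" for y
  proof (cases "p = 1")
    case True
    have p': "p' = \<infinity>"
      using assms(1,2) by (cases rule: conjugate_exponents) (use True in auto)
    \<comment> \<open>For p = 1 the bound on the sum of the s_j is 1 / \<infinity> = 0. Hence all
      weights are 1, and division by them leaves the elements of c_0 unchanged.\<close>
    then have "suminf s = 0"
      using * suminf_nonneg[OF s assms(3)] by (auto simp: antisym)
    then have "weight s \<alpha> = 1" for \<alpha>
      using weight_le_degree_power[OF assms(3) s, of \<alpha>] weight_ge_1[where s = s and \<alpha> = \<alpha>, OF assms(3)] by simp
    then show ?thesis
      using vanishing_tails_c0[of y] y True p' by simp
  next
    case False
    then show ?thesis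
      using Koethe_dual_vanishing_tails[OF assms(1,2)] y by simp
  qed
  have "(\<lambda>_. 0) \<in> ?Y"
    by (auto simp: c0_space_def kothe_dual_def)
  then show "cyclic_in (weak_topology (X_space p s) ?Y) f"
    using f * by (intro cyclic_in_weak_topology[OF assms s _ _ _ _ _ _ tails]) auto
qed

end
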